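(* Let $G$ be a compact Lie group with Lie algebra $\mathfrak g$ acting by quaternionic isometries on a quaternion-Kähler manifold $M$ with moment map $\mu=\sum_{i=1}^3 I_i\otimes B_i$, where $B_i=\lambda v_i$ with $(v_1,v_2,v_3)$ an orthonormal basis of $\Psi(x)$ and $\lambda>0$ a differentiable $G$-invariant function, and let $\Psi:M_0\to\mathbb{G}_3(\mathfrak g)$ be the induced map. Suppose $\Psi(x)=V$, that $\Psi_*$ is injective at $x$, and let $X=\Psi_*^{-1}(\mathrm{grad}\,\psi)\in T_xM$. Then the subspaces $$\mathrm{span}\{\mathrm{grad}\,\psi,\tilde v_1,\tilde v_2,\tilde v_3\}\subset T_V\mathbb{G}_3(\mathfrak g),\qquad \mathrm{span}\{X,\tilde v_1,\tilde v_2,\tilde v_3\}\subset T_xM$$ are $Sp(1)$-invariant, hence quaternionic; that is, the second is preserved by $I_1,I_2,I_3$, and the first by the push-forward endomorphisms $Z\mapsto\Psi_*(I_k\Psi_*^{-1}Z)$, $k=1,2,3$.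
   Context: $M$ is a connected quaternion-Kähler (QK) manifold with nonzero scalar curvature. $S^2H$ denotes the real rank 3 bundle of endomorphisms of $TM$ locally spanned by almost complex structures $I_1,I_2,I_3$, compatible with the metric, with $I_i^2=-\mathrm{Id}$, $I_iI_j=I_k$ for $(i,j,k)$ cyclic; it is preserved by the Levi-Civita connection $\nabla$. $G$ acts by isometries preserving the QK structure; $\tilde A$ denotes the vector field generated by $A\in\mathfrak g$, both on $M$ and on $\mathbb{G}_3(\mathfrak g)$ (with the action of $G$ on the latter induced by the adjoint representation). $\mathfrak g$ has the inner product given by minus the Killing form (assumed positive definite). The moment map is the section $\mu$ of $S^2H\otimes\mathfrak g$ whose contractions $\mu_A=\langle\mu,A\rangle$ satisfy $\nabla\mu_A=\sum_{i=1}^3 (I_i\tilde A)^\flat\otimes I_i$ (the constant factor, the scalar curvature, is normalized to $1$). Locally $\mu=\sum_i I_i\otimes B_i$ with $B_i$ $\mathfrak g$-valued; $M_0\subset M$ is the set of points where $B_1,B_2,B_3$ are linearly independent, and $\Psi(x)$ is the oriented 3-plane $\mathrm{span}\{B_1(x),B_2(x),B_3(x)\}$; $\Psi$ is $G$-equivariant. $\mathbb{G}_3(\mathfrak g)$ is the Grassmannian of oriented 3-planes in $\mathfrak g$, with $T_V\mathbb{G}_3(\mathfrak g)=\mathrm{Hom}(V,V^\perp)\cong V\otimes V^\perp$ and the tensor product metric. The functional $\psi:\mathbb{G}_3(\mathfrak g)\to\mathbb{R}$ is $\psi(V)=\langle[v_1,v_2],v_3\rangle$ for an oriented orthonormal basis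 of $V$; its gradient at $V$ is $\mathrm{grad}\,\psi=v_1\otimes[v_2,v_3]^\perp+v_2\otimes[v_3,v_1]^\perp+v_3\otimes[v_1,v_2]^\perp$, where $\perp$ denotes the projection to $V^\perp$. *)

theory Defs
  imports "HOL-Analysis.Analysis" "HOL-Algebra.Group_Action"
begin

section \<open>Smooth manifolds\<close>

primrec Ck_on :: "nat \<Rightarrow> 'a::real_normed_vector set \<Rightarrow> ('a \<Rightarrow> 'b::real_normed_vector) \<Rightarrow> bool" where
  "Ck_on 0 S f \<longleftrightarrow> continuous_on S f"
| "Ck_on (Suc k) S f \<longleftrightarrow>
     (\<forall>x\<in>S. f differentiable (at x)) \<and> (\<forall>v. Ck_on k S (\<lambda>x. frechet_derivative f (at x) v))"

text \<open>Only used for open sets \<open>S\<close>.\<close>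

definition smooth_on :: "'a::real_normed_vector set \<Rightarrow> ('a \<Rightarrow> 'b::real_normed_vector) \<Rightarrow> bool" where
  "smooth_on S f \<longleftrightarrow> (\<forall>k. Ck_on k S f)"

type_synonym ('m, 'e) chart = "'m set \<times> ('m \<Rightarrow> 'e)"

definition cinv :: "('m, 'e) chart \<Rightarrow> 'e \<Rightarrow> 'm" where
  "cinv c = inv_into (fst c) (snd c)"

text \<open>
  The underlying set of a manifold is the whole type. Each point \<open>p\<close> comes with a preferred
  chart \<open>chart_at M p\<close> of the atlas around it, and the tangent space at \<open>p\<close> is the model space
  \<open>'e\<close>: the vector \<open>u :: 'e\<close> at \<open>p\<close> is the tangent vector whose coordinates in the preferred
  chart at \<open>p\<close> are \<open>u\<close>.
\<close>

record ('m, 'e) manifold =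
  atlas :: "('m, 'e) chart set"
  chart_at :: "'m \<Rightarrow> ('m, 'e) chart"

definition smooth_manifold ::
  "('m::{t2_space,second_countable_topology}, 'e::euclidean_space) manifold \<Rightarrow> bool" where
  "smooth_manifold M \<longleftrightarrow>
     (\<forall>c\<in>atlas M. open (fst c) \<and> open (snd c ` fst c) \<and>
        homeomorphism (fst c) (snd c ` fst c) (snd c) (cinv c)) \<and>
     (\<forall>c\<in>atlas M. \<forall>d\<in>atlas M. smooth_on (snd c ` (fst c \<inter> fst d)) (snd d \<circ> cinv c)) \<and>
     (\<forall>p. chart_at M p \<in> atlas M \<and> p \<in> fst (chart_at M p))"

definition prod_manifold ::
  "('a, 'e) manifold \<Rightarrow> ('b, 'f) manifold \<Rightarrow> ('a \<times> 'b, 'e \<times> 'f) manifold" where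
  "prod_manifold M N =
     \<lparr>atlas = {(fst c \<times> fst d, map_prod (snd c) (snd d)) | c d. c \<in> atlas M \<and> d \<in> atlas N},
      chart_at = (\<lambda>(p, q). (fst (chart_at M p) \<times> fst (chart_at N q),
                            map_prod (snd (chart_at M p)) (snd (chart_at N q))))\<rparr>"

definition smooth_map ::
  "('m::topological_space, 'e::euclidean_space) manifold \<Rightarrow>
   ('n::topological_space, 'f::euclidean_space) manifold \<Rightarrow> ('m \<Rightarrow> 'n) \<Rightarrow> bool" where
  "smooth_map M N f \<longleftrightarrow>
     continuous_on UNIV f \<and>
     (\<forall>c\<in>atlas M. \<forall>d\<in>atlas N.
        smooth_on (snd c ` (fst c \<inter> f -` fst d)) (snd d \<circ> f \<circ> cinv c))"

definition differentiable_at_pt ::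
  "('m, 'e::euclidean_space) manifold \<Rightarrow> ('m \<Rightarrow> real) \<Rightarrow> 'm \<Rightarrow> bool" where
  "differentiable_at_pt M f p \<longleftrightarrow>
     (\<lambda>y. f (cinv (chart_at M p) y)) differentiable (at (snd (chart_at M p) p))"

definition push ::
  "('m, 'e::euclidean_space) manifold \<Rightarrow> ('n, 'f::euclidean_space) manifold \<Rightarrow>
   ('m \<Rightarrow> 'n) \<Rightarrow> 'm \<Rightarrow> 'e \<Rightarrow> 'f" where
  "push M N f p =
     frechet_derivative (snd (chart_at N (f p)) \<circ> f \<circ> cinv (chart_at M p))
       (at (snd (chart_at M p) p))"

text \<open>Change of coordinates of tangent vectors at \<open>q\<close>, from the chart \<open>c\<close> to the chart \<open>d\<close>.\<close>

definition tchange ::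
  "('m, 'e::euclidean_space) chart \<Rightarrow> ('m, 'e) chart \<Rightarrow> 'm \<Rightarrow> 'e \<Rightarrow>\<^sub>L 'e" where
  "tchange c d q = Blinfun (frechet_derivative (snd d \<circ> cinv c) (at (snd c q)))"


section \<open>Riemannian metrics and the Levi-Civita connection\<close>

text \<open>
  \<open>met p u v\<close> is the metric on the tangent space at \<open>p\<close>; \<open>metric_in M met c q\<close> is its expression
  in the chart \<open>c\<close>. Likewise for fields of endomorphisms of the tangent bundle and \<open>endo_in\<close>.
\<close>

definition metric_in ::
  "('m, 'e::euclidean_space) manifold \<Rightarrow> ('m \<Rightarrow> 'e \<Rightarrow> 'e \<Rightarrow> real) \<Rightarrow>
   ('m, 'e) chart \<Rightarrow> 'm \<Rightarrow> 'e \<Rightarrow> 'e \<Rightarrow> real" where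
  "metric_in M met c q u v =
     met q (tchange c (chart_at M q) q u) (tchange c (chart_at M q) q v)"

definition riemannian_metric ::
  "('m, 'e::euclidean_space) manifold \<Rightarrow> ('m \<Rightarrow> 'e \<Rightarrow> 'e \<Rightarrow> real) \<Rightarrow> bool" where
  "riemannian_metric M met \<longleftrightarrow>
     (\<forall>p. bilinear (met p) \<and> (\<forall>u v. met p u v = met p v u) \<and> (\<forall>u. u \<noteq> 0 \<longrightarrow> met p u u > 0)) \<and>
     (\<forall>c\<in>atlas M. \<forall>u v. smooth_on (snd c ` fst c) (\<lambda>y. metric_in M met c (cinv c y) u v))"

definition endo_in ::
  "('m, 'e::euclidean_space) manifold \<Rightarrow> ('m, 'e) chart \<Rightarrow> ('m \<Rightarrow> 'e \<Rightarrow>\<^sub>L 'e) \<Rightarrow>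
   'm \<Rightarrow> 'e \<Rightarrow>\<^sub>L 'e" where
  "endo_in M c J q = tchange (chart_at M q) c q o\<^sub>L J q o\<^sub>L tchange c (chart_at M q) q"

definition smooth_endo_on ::
  "('m, 'e::euclidean_space) manifold \<Rightarrow> 'm set \<Rightarrow> ('m \<Rightarrow> 'e \<Rightarrow>\<^sub>L 'e) \<Rightarrow> bool" where
  "smooth_endo_on M U J \<longleftrightarrow>
     (\<forall>c\<in>atlas M. smooth_on (snd c ` (fst c \<inter> U)) (\<lambda>y. endo_in M c J (cinv c y)))"

text \<open>
  The Christoffel symbols at \<open>q\<close> in the chart \<open>c\<close>: the unique symmetric (torsion-free) bilinear
  map that is compatible with the metric.
\<close>

definition christoffel ::
  "('m, 'e::euclidean_space) manifold \<Rightarrow> ('m \<Rightarrow> 'e \<Rightarrow> 'e \<Rightarrow> real) \<Rightarrow>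
   ('m, 'e) chart \<Rightarrow> 'm \<Rightarrow> 'e \<Rightarrow>\<^sub>L 'e \<Rightarrow>\<^sub>L 'e" where
  "christoffel M met c q =
     (THE \<Gamma> :: 'e \<Rightarrow>\<^sub>L 'e \<Rightarrow>\<^sub>L 'e. (\<forall>u v. \<Gamma> u v = \<Gamma> v u) \<and>
        (\<forall>u v w. frechet_derivative (\<lambda>y. metric_in M met c (cinv c y) v w) (at (snd c q)) u =
           metric_in M met c q (\<Gamma> u v) w + metric_in M met c q v (\<Gamma> u w)))"

text \<open>The Levi-Civita covariant derivative of the endomorphism field \<open>J\<close> at \<open>p\<close> in direction \<open>u\<close>.\<close>

definition nabla_endo ::
  "('m, 'e::euclidean_space) manifold \<Rightarrow> ('m \<Rightarrow> 'e \<Rightarrow> 'e \<Rightarrow> real) \<Rightarrow>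
   ('m \<Rightarrow> 'e \<Rightarrow>\<^sub>L 'e) \<Rightarrow> 'm \<Rightarrow> 'e \<Rightarrow> 'e \<Rightarrow>\<^sub>L 'e" where
  "nabla_endo M met J p u =
     (let c = chart_at M p; \<Gamma> = christoffel M met c p in
      frechet_derivative (\<lambda>y. endo_in M c J (cinv c y)) (at (snd c p)) u
        + (\<Gamma> u o\<^sub>L J p) - (J p o\<^sub>L \<Gamma> u))"

definition curvature ::
  "('m, 'e::euclidean_space) manifold \<Rightarrow> ('m \<Rightarrow> 'e \<Rightarrow> 'e \<Rightarrow> real) \<Rightarrow> 'm \<Rightarrow> 'e \<Rightarrow> 'e \<Rightarrow> 'e \<Rightarrow> 'e" where
  "curvature M met p u v w =
     (let c = chart_at M p; \<Gamma> = christoffel M met c p;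
          D = frechet_derivative (\<lambda>y. christoffel M met c (cinv c y)) (at (snd c p)) in
      D u v w - D v u w + \<Gamma> u (\<Gamma> v w) - \<Gamma> v (\<Gamma> u w))"

definition endo_trace :: "('e::euclidean_space \<Rightarrow> 'e) \<Rightarrow> real" where
  "endo_trace f = (\<Sum>b\<in>Basis. f b \<bullet> b)"

definition ricci ::
  "('m, 'e::euclidean_space) manifold \<Rightarrow> ('m \<Rightarrow> 'e \<Rightarrow> 'e \<Rightarrow> real) \<Rightarrow> 'm \<Rightarrow> 'e \<Rightarrow> 'e \<Rightarrow> real" where
  "ricci M met p v w = endo_trace (\<lambda>u. curvature M met p u v w)"

definition scalar_curvature ::
  "('m, 'e::euclidean_space) manifold \<Rightarrow> ('m \<Rightarrow> 'e \<Rightarrow> 'e \<Rightarrow> real) \<Rightarrow> 'm \<Rightarrow> real" where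
  "scalar_curvature M met p =
     (let E = (SOME E. finite E \<and> card E = DIM('e) \<and>
                 (\<forall>a\<in>E. \<forall>b\<in>E. met p a b = (if a = b then 1 else 0)))
      in \<Sum>e\<in>E. ricci M met p e e)"


section \<open>Quaternion-Kaehler manifolds\<close>

text \<open>
  \<open>Q p\<close> is the fibre at \<open>p\<close> of the bundle \<open>S\<^sup>2H\<close>. Triples are elements of \<open>_ ^ 3\<close>, with
  components \<open>J $ 1\<close>, \<open>J $ 2\<close>, \<open>J $ 3\<close>.
\<close>

definition quat_basis ::
  "('m \<Rightarrow> 'e \<Rightarrow> 'e \<Rightarrow> real) \<Rightarrow> ('m \<Rightarrow> ('e::euclidean_space \<Rightarrow>\<^sub>L 'e) set) \<Rightarrow>
   'm \<Rightarrow> ('e \<Rightarrow>\<^sub>L 'e) ^ 3 \<Rightarrow> bool" where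
  "quat_basis met Q p J \<longleftrightarrow>
     Q p = span (range (($) J)) \<and>
     (\<forall>i u v. met p ((J $ i) u) ((J $ i) v) = met p u v) \<and>
     (\<forall>i. J $ i o\<^sub>L J $ i = - id_blinfun) \<and>
     J $ 1 o\<^sub>L J $ 2 = J $ 3 \<and> J $ 2 o\<^sub>L J $ 3 = J $ 1 \<and> J $ 3 o\<^sub>L J $ 1 = J $ 2"

definition quat_frame ::
  "('m::topological_space, 'e::euclidean_space) manifold \<Rightarrow> ('m \<Rightarrow> 'e \<Rightarrow> 'e \<Rightarrow> real) \<Rightarrow>
   ('m \<Rightarrow> ('e \<Rightarrow>\<^sub>L 'e) set) \<Rightarrow> 'm set \<Rightarrow> ('m \<Rightarrow> ('e \<Rightarrow>\<^sub>L 'e) ^ 3) \<Rightarrow> bool" where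
  "quat_frame M met Q U I \<longleftrightarrow>
     open U \<and> (\<forall>i. smooth_endo_on M U (\<lambda>p. I p $ i)) \<and> (\<forall>p\<in>U. quat_basis met Q p (I p))"

definition quaternion_kaehler ::
  "('m::{t2_space,second_countable_topology}, 'e::euclidean_space) manifold \<Rightarrow>
   ('m \<Rightarrow> 'e \<Rightarrow> 'e \<Rightarrow> real) \<Rightarrow> ('m \<Rightarrow> ('e \<Rightarrow>\<^sub>L 'e) set) \<Rightarrow> bool" where
  "quaternion_kaehler M met Q \<longleftrightarrow>
     smooth_manifold M \<and> riemannian_metric M met \<and>
     (\<forall>p. \<exists>U I. p \<in> U \<and> quat_frame M met Q U I) \<and>
     (\<forall>U J. open U \<and> smooth_endo_on M U J \<and> (\<forall>q\<in>U. J q \<in> Q q) \<longrightarrow>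
        (\<forall>p\<in>U. \<forall>u. nabla_endo M met J p u \<in> Q p))"


section \<open>Lie groups\<close>

text \<open>The Lie algebra is the tangent space at the identity, hence the model space \<open>'k\<close>.\<close>

record ('g, 'k) lie_group = "'g monoid" +
  mfd :: "('g, 'k) manifold"

definition compact_lie_group ::
  "('g::{t2_space,second_countable_topology}, 'k::euclidean_space) lie_group \<Rightarrow> bool" where
  "compact_lie_group G \<longleftrightarrow>
     group G \<and> carrier G = UNIV \<and> smooth_manifold (mfd G) \<and> compact (UNIV :: 'g set) \<and>
     smooth_map (prod_manifold (mfd G) (mfd G)) (mfd G) (\<lambda>(g, h). g \<otimes>\<^bsub>G\<^esub> h) \<and>
     smooth_map (mfd G) (mfd G) (m_inv G)"

definition Ad :: "('g, 'k::euclidean_space) lie_group \<Rightarrow> 'g \<Rightarrow> 'k \<Rightarrow> 'k" where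
  "Ad G g = push (mfd G) (mfd G) (\<lambda>h. g \<otimes>\<^bsub>G\<^esub> h \<otimes>\<^bsub>G\<^esub> m_inv G g) \<one>\<^bsub>G\<^esub>"

text \<open>The Lie bracket as \<open>ad A = d(Ad)\<^sub>1 A\<close> (that of left-invariant vector fields).\<close>

definition bracket :: "('g, 'k::euclidean_space) lie_group \<Rightarrow> 'k \<Rightarrow> 'k \<Rightarrow> 'k" where
  "bracket G A B =
     frechet_derivative (\<lambda>y. Ad G (cinv (chart_at (mfd G) \<one>\<^bsub>G\<^esub>) y) B)
       (at (snd (chart_at (mfd G) \<one>\<^bsub>G\<^esub>) \<one>\<^bsub>G\<^esub>)) A"

definition killing :: "('g, 'k::euclidean_space) lie_group \<Rightarrow> 'k \<Rightarrow> 'k \<Rightarrow> real" where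
  "killing G A B = endo_trace (bracket G A \<circ> bracket G B)"

definition ip :: "('g, 'k::euclidean_space) lie_group \<Rightarrow> 'k \<Rightarrow> 'k \<Rightarrow> real" where
  "ip G A B = - killing G A B"


section \<open>The Grassmannian of oriented 3-planes\<close>

text \<open>
  An oriented 3-plane is represented by the set of all its positively oriented bases; \<open>oplane B\<close>
  is the span of \<open>B\<close>, oriented by \<open>B\<close>, for linearly independent \<open>B\<close>.
\<close>

definition indep3 :: "'k::euclidean_space ^ 3 \<Rightarrow> bool" where
  "indep3 B \<longleftrightarrow> inj (($) B) \<and> independent (range (($) B))"

definition oplane :: "'k::euclidean_space ^ 3 \<Rightarrow> ('k ^ 3) set" where
  "oplane B = {w. \<exists>P :: real ^ 3 ^ 3. det P > 0 \<and> (\<forall>i. w $ i = (\<Sum>j\<in>UNIV. P $ i $ j *\<^sub>R B $ j))}"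

definition oriented_onb ::
  "('g, 'k::euclidean_space) lie_group \<Rightarrow> ('k ^ 3) set \<Rightarrow> 'k ^ 3 \<Rightarrow> bool" where
  "oriented_onb G V v \<longleftrightarrow> v \<in> V \<and> (\<forall>i j. ip G (v $ i) (v $ j) = (if i = j then 1 else 0))"

definition perp :: "('g, 'k::euclidean_space) lie_group \<Rightarrow> ('k ^ 3) set \<Rightarrow> 'k set" where
  "perp G V = {a. \<forall>v\<in>V. \<forall>i. ip G a (v $ i) = 0}"

text \<open>
  The tangent space \<open>Hom(V, V\<^sup>\<bottom>)\<close>: homomorphisms are extended by \<open>0\<close> on \<open>V\<^sup>\<bottom>\<close>.
\<close>

definition gr_tangent ::
  "('g, 'k::euclidean_space) lie_group \<Rightarrow> ('k ^ 3) set \<Rightarrow> ('k \<Rightarrow>\<^sub>L 'k) set" where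
  "gr_tangent G V = {L :: 'k \<Rightarrow>\<^sub>L 'k. (\<forall>a\<in>perp G V. L a = 0) \<and> (\<forall>a. L a \<in> perp G V)}"

text \<open>
  Differentials of maps into the Grassmannian are taken in the standard chart
  centred at \<open>V\<close>, in which \<open>L \<in> Hom(V, V\<^sup>\<bottom>)\<close> corresponds to its graph \<open>{v + L v | v \<in> V}\<close>,
  oriented through the isomorphism \<open>v \<mapsto> v + L v\<close>.
\<close>

definition gr_graph :: "('k::euclidean_space ^ 3) set \<Rightarrow> ('k \<Rightarrow>\<^sub>L 'k) \<Rightarrow> ('k ^ 3) set" where
  "gr_graph V L = (\<lambda>v. \<chi> i. v $ i + L (v $ i)) ` V"

definition gr_coord ::
  "('g, 'k::euclidean_space) lie_group \<Rightarrow> ('k ^ 3) set \<Rightarrow> ('k ^ 3) set \<Rightarrow> 'k \<Rightarrow>\<^sub>L 'k" where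
  "gr_coord G V W = (THE L. L \<in> gr_tangent G V \<and> gr_graph V L = W)"

definition gr_push ::
  "('g, 'k::euclidean_space) lie_group \<Rightarrow> ('m, 'e::euclidean_space) manifold \<Rightarrow>
   ('m \<Rightarrow> ('k ^ 3) set) \<Rightarrow> 'm \<Rightarrow> 'e \<Rightarrow> 'k \<Rightarrow>\<^sub>L 'k" where
  "gr_push G M f p =
     frechet_derivative (\<lambda>y. gr_coord G (f p) (f (cinv (chart_at M p) y)))
       (at (snd (chart_at M p) p))"

text \<open>The tensor product metric on \<open>V \<otimes> V\<^sup>\<bottom>\<close>.\<close>

definition gr_metric ::
  "('g, 'k::euclidean_space) lie_group \<Rightarrow> ('k ^ 3) set \<Rightarrow> ('k \<Rightarrow>\<^sub>L 'k) \<Rightarrow> ('k \<Rightarrow>\<^sub>L 'k) \<Rightarrow> real" where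
  "gr_metric G V K L =
     (let v = (SOME v. oriented_onb G V v) in \<Sum>i\<in>UNIV. ip G (K (v $ i)) (L (v $ i)))"

definition psi :: "('g, 'k::euclidean_space) lie_group \<Rightarrow> ('k ^ 3) set \<Rightarrow> real" where
  "psi G V =
     (let v = (SOME v. oriented_onb G V v) in ip G (bracket G (v $ 1) (v $ 2)) (v $ 3))"

definition grad_psi :: "('g, 'k::euclidean_space) lie_group \<Rightarrow> ('k ^ 3) set \<Rightarrow> 'k \<Rightarrow>\<^sub>L 'k" where
  "grad_psi G V =
     (THE L. L \<in> gr_tangent G V \<and>
        (\<forall>K\<in>gr_tangent G V.
           ((\<lambda>t. psi G (gr_graph V (t *\<^sub>R K))) has_real_derivative gr_metric G V L K) (at 0)))"

definition gr_act ::
  "('g, 'k::euclidean_space) lie_group \<Rightarrow> 'g \<Rightarrow> ('k ^ 3) set \<Rightarrow> ('k ^ 3) set" where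
  "gr_act G g V = (\<lambda>v. \<chi> i. Ad G g (v $ i)) ` V"

text \<open>The vector fields generated by \<open>A\<close> in the Lie algebra, on the Grassmannian and on \<open>M\<close>.\<close>

definition gr_fund ::
  "('g, 'k::euclidean_space) lie_group \<Rightarrow> 'k \<Rightarrow> ('k ^ 3) set \<Rightarrow> 'k \<Rightarrow>\<^sub>L 'k" where
  "gr_fund G A V = gr_push G (mfd G) (\<lambda>g. gr_act G g V) \<one>\<^bsub>G\<^esub> A"

definition fund ::
  "('g, 'k::euclidean_space) lie_group \<Rightarrow> ('m, 'e::euclidean_space) manifold \<Rightarrow>
   ('g \<Rightarrow> 'm \<Rightarrow> 'm) \<Rightarrow> 'k \<Rightarrow> 'm \<Rightarrow> 'e" where
  "fund G M act A p = push (mfd G) M (\<lambda>g. act g p) \<one>\<^bsub>G\<^esub> A"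


section \<open>Quaternionic isometric actions and moment maps\<close>

definition quaternionic_isometric_action ::
  "('g::topological_space, 'k::euclidean_space) lie_group \<Rightarrow>
   ('m::topological_space, 'e::euclidean_space) manifold \<Rightarrow> ('m \<Rightarrow> 'e \<Rightarrow> 'e \<Rightarrow> real) \<Rightarrow>
   ('m \<Rightarrow> ('e \<Rightarrow>\<^sub>L 'e) set) \<Rightarrow> ('g \<Rightarrow> 'm \<Rightarrow> 'm) \<Rightarrow> bool" where
  "quaternionic_isometric_action G M met Q act \<longleftrightarrow>
     group_action G UNIV act \<and>
     smooth_map (prod_manifold (mfd G) M) M (\<lambda>(g, p). act g p) \<and>
     (\<forall>g p u v. met (act g p) (push M M (act g) p u) (push M M (act g) p v) = met p u v) \<and>
     (\<forall>g p. \<forall>J\<in>Q p. \<exists>J'\<in>Q (act g p). \<forall>u. push M M (act g) p (J u) = J' (push M M (act g) p u))"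

text \<open>
  A section \<open>\<mu>\<close> of \<open>S\<^sup>2H \<otimes> \<gg>\<close> is given by its contractions: \<open>mu p A\<close> is \<open>\<langle>\<mu>, A\<rangle>\<close> at \<open>p\<close>.
\<close>

definition moment_map ::
  "('g, 'k::euclidean_space) lie_group \<Rightarrow>
   ('m::topological_space, 'e::euclidean_space) manifold \<Rightarrow> ('m \<Rightarrow> 'e \<Rightarrow> 'e \<Rightarrow> real) \<Rightarrow>
   ('m \<Rightarrow> ('e \<Rightarrow>\<^sub>L 'e) set) \<Rightarrow> ('g \<Rightarrow> 'm \<Rightarrow> 'm) \<Rightarrow> ('m \<Rightarrow> 'k \<Rightarrow> 'e \<Rightarrow>\<^sub>L 'e) \<Rightarrow> bool" where
  "moment_map G M met Q act mu \<longleftrightarrow>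
     (\<forall>p. linear (mu p)) \<and> (\<forall>p A. mu p A \<in> Q p) \<and>
     (\<forall>A. smooth_endo_on M UNIV (\<lambda>p. mu p A)) \<and>
     (\<forall>A p u J. quat_basis met Q p J \<longrightarrow>
        nabla_endo M met (\<lambda>q. mu q A) p u =
          (\<Sum>i\<in>UNIV. met p ((J $ i) (fund G M act A p)) u *\<^sub>R J $ i))"

text \<open>The identity \<open>\<mu> = \<Sum>\<^sub>i J\<^sub>i \<otimes> B\<^sub>i\<close> at \<open>p\<close>.\<close>

definition moment_coeffs ::
  "('g, 'k::euclidean_space) lie_group \<Rightarrow> ('m \<Rightarrow> 'k \<Rightarrow> 'e::euclidean_space \<Rightarrow>\<^sub>L 'e) \<Rightarrow>
   'm \<Rightarrow> ('e \<Rightarrow>\<^sub>L 'e) ^ 3 \<Rightarrow> 'k ^ 3 \<Rightarrow> bool" where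
  "moment_coeffs G mu p J B \<longleftrightarrow> (\<forall>A. mu p A = (\<Sum>i\<in>UNIV. ip G (B $ i) A *\<^sub>R J $ i))"

definition M0 ::
  "('g, 'k::euclidean_space) lie_group \<Rightarrow> ('m \<Rightarrow> 'e::euclidean_space \<Rightarrow> 'e \<Rightarrow> real) \<Rightarrow>
   ('m \<Rightarrow> ('e \<Rightarrow>\<^sub>L 'e) set) \<Rightarrow> ('m \<Rightarrow> 'k \<Rightarrow> 'e \<Rightarrow>\<^sub>L 'e) \<Rightarrow> 'm set" where
  "M0 G met Q mu = {p. \<exists>J B. quat_basis met Q p J \<and> moment_coeffs G mu p J B \<and> indep3 B}"

text \<open>
  Two quaternionic bases at a point differ by an element of \<open>SO(3)\<close>, and so do the corresponding
  coefficients; so the sets \<open>oplane B\<close> in the following union all coincide.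
\<close>

definition Psi ::
  "('g, 'k::euclidean_space) lie_group \<Rightarrow> ('m \<Rightarrow> 'e::euclidean_space \<Rightarrow> 'e \<Rightarrow> real) \<Rightarrow>
   ('m \<Rightarrow> ('e \<Rightarrow>\<^sub>L 'e) set) \<Rightarrow> ('m \<Rightarrow> 'k \<Rightarrow> 'e \<Rightarrow>\<^sub>L 'e) \<Rightarrow> 'm \<Rightarrow> ('k ^ 3) set" where
  "Psi G met Q mu p =
     \<Union>{oplane B | B. \<exists>J. quat_basis met Q p J \<and> moment_coeffs G mu p J B}"

end

theory Submission
  imports Defs
begin

text \<open>
  Both subspaces are quaternionic because the four vectors that span the second one are
  \<open>Y, I\<^sub>1 Y, I\<^sub>2 Y, I\<^sub>3 Y\<close> up to sign, for a single vector \<open>Y\<close>, the gradient of \<open>\<lambda>\<close>. Write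
  \<open>\<xi>(A)\<close> for the vector at \<open>x\<close> that \<open>A\<close> in the Lie algebra generates.

  In a quaternionic frame, \<open>\<mu>\<^sub>A = \<Sum>\<^sub>i \<langle>B\<^sub>i, A\<rangle> I\<^sub>i\<close>, and \<open>\<nabla>I\<^sub>i\<close> is a combination of
  \<open>I\<^sub>1, I\<^sub>2, I\<^sub>3\<close> without \<open>I\<^sub>i\<close>-component, since \<open>I\<^sub>i\<^sup>2 = -1\<close>. Comparing coefficients in the
  moment map equation (\<open>moment_derivative\<close>) gives two pieces of information about the
  derivative \<open>dB\<close>.

  \<^item> For \<open>A = v\<^sub>j\<close>: \<open>\<langle>dB\<^sub>j(u), v\<^sub>j\<rangle> = \<langle>I\<^sub>j \<xi>(v\<^sub>j), u\<rangle>\<close> (\<open>dB_v\<close>). The left hand side is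
    \<open>d\<lambda>(u)\<close>, whatever \<open>j\<close> is, because all \<open>B\<^sub>j\<close> have length \<open>\<lambda>\<close>. So the vectors
    \<open>I\<^sub>j \<xi>(v\<^sub>j)\<close> coincide (\<open>I_fund_const\<close>); this common vector is \<open>Y\<close>, and \<open>\<xi>(v\<^sub>j) = - I\<^sub>j Y\<close>.
  \<^item> For \<open>A\<close> orthogonal to \<open>V\<close>: \<open>\<langle>dB\<^sub>j(u), A\<rangle> = \<langle>I\<^sub>j \<xi>(A), u\<rangle>\<close> (\<open>dB_perp\<close>). The plane \<open>\<Psi>\<close> is
    spanned by the \<open>B\<^sub>j = \<lambda> v\<^sub>j\<close>, so this is the differential of \<open>\<Psi>\<close>:
    \<open>\<lambda> \<langle>d\<Psi>(u) v\<^sub>j, A\<rangle> = \<langle>I\<^sub>j \<xi>(A), u\<rangle>\<close> (\<open>dPsi_ip\<close>).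

  It remains to see that \<open>d\<Psi>(Y)\<close> is the gradient of \<open>\<psi>\<close>, for then \<open>X = Y\<close> by injectivity.
  Equivariance of \<open>\<Psi>\<close> gives \<open>d\<Psi>(\<xi>(v\<^sub>k)) v\<^sub>l = [v\<^sub>k, v\<^sub>l]\<^sup>\<bottom>\<close> (\<open>dPsi_fund\<close>). For \<open>(j, k, l)\<close> cyclic
  and \<open>A\<close> orthogonal to \<open>V\<close>, writing \<open>Y = I\<^sub>k \<xi>(v\<^sub>k)\<close>,
  \<open>\<langle>I\<^sub>j \<xi>(A), Y\<rangle> = - \<langle>\<xi>(A), I\<^sub>j I\<^sub>k \<xi>(v\<^sub>k)\<rangle> = \<langle>I\<^sub>l \<xi>(A), \<xi>(v\<^sub>k)\<rangle>\<close>,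
  that is, \<open>d\<Psi>(Y) v\<^sub>j = [v\<^sub>k, v\<^sub>l]\<^sup>\<bottom>\<close> (\<open>dPsi_Y_component\<close>), which is the formula for the
  gradient (\<open>grad_psi_oplane\<close>). The first subspace is the image of the second under \<open>d\<Psi>\<close>.

  Two foundations carry the rest of the text. The differential of a map into the Grassmannian is
  computed from a moving frame (\<open>gr_coord_has_derivative\<close>). The gradient formula needs the bracket
  to be alternating and skew for the inner product. The bracket is the derivative
  of \<open>Ad\<close>, and in coordinates it is the antisymmetrised second derivative of the group
  multiplication, so that \<open>[A, A] = 0\<close> is the symmetry of second derivatives (\<open>bracket_self\<close>);
  skewness follows from the invariance of the Killing form under \<open>Ad\<close> (\<open>ip_bracket\<close>).
\<close>

section \<open>Frames and oriented planes\<close>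

definition frame_change :: "real ^ 3 ^ 3 \<Rightarrow> 'k::real_vector ^ 3 \<Rightarrow> 'k ^ 3" where
  "frame_change P b = (\<chi> i. \<Sum>j\<in>UNIV. P $ i $ j *\<^sub>R b $ j)"

lemma frame_change_nth: "frame_change P b $ i = P $ i $ 1 *\<^sub>R b $ 1 + P $ i $ 2 *\<^sub>R b $ 2 + P $ i $ 3 *\<^sub>R b $ 3"
  by (simp add: frame_change_def sum_3)

lemma frame_change_frame_change: "frame_change P (frame_change R b) = frame_change (P ** R) b"
  by (simp add: vec_eq_iff frame_change_nth matrix_matrix_mult_def sum_3 algebra_simps)

lemma frame_change_one: "frame_change (mat 1) b = b"
  by (simp add: vec_eq_iff frame_change_def mat_def if_distrib[of "\<lambda>x. x *\<^sub>R _"] cong: if_cong)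

lemma oplane_eq_frame_change: "oplane b = {frame_change P b | P. det P > 0}"
  by (auto simp: oplane_def frame_change_def vec_eq_iff)

lemma oplane_frame_change:
  assumes "det P > 0"
  shows "oplane (frame_change P b) = oplane b"
proof -
  obtain R where R: "R ** P = mat 1" "P ** R = mat 1"
    using assms invertible_det_nz[of P] by (auto simp: invertible_def)
  have "det R * det P = 1"
    using R(1) by (metis det_I det_mul)
  then have "det R > 0"
    using assms by (metis zero_less_mult_pos2 zero_less_one)
  have T: "frame_change T b = frame_change (T ** R) (frame_change P b)" for T
    by (simp add: frame_change_frame_change R(1) flip: matrix_mul_assoc)
  show ?thesis
  proof (intro equalityI subsetI)
    fix w assume "w \<in> oplane (frame_change P b)"
    then obtain T where "det T > 0" "w = frame_change (T ** P) b"
      by (auto simp: oplane_eq_frame_change frame_change_frame_change)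
    then show "w \<in> oplane b"
      using assms by (auto simp: oplane_eq_frame_change det_mul intro!: exI[of _ "T ** P"])
  next
    fix w assume "w \<in> oplane b"
    then obtain T where "det T > 0" "w = frame_change T b"
      by (auto simp: oplane_eq_frame_change)
    then show "w \<in> oplane (frame_change P b)"
      using \<open>det R > 0\<close> T[of T] by (auto simp: oplane_eq_frame_change det_mul intro!: exI[of _ "T ** R"])
  qed
qed

lemma oplane_self: "b \<in> oplane b"
  unfolding oplane_eq_frame_change by (auto intro!: exI[of _ "mat 1"] simp: frame_change_one)

text \<open>Graphs of homomorphisms and the action of the group are both images under linear maps.\<close>

lemma image_oplane:
  assumes "linear f"
  shows "(\<lambda>w. \<chi> i. f (w $ i)) ` oplane b = oplane (\<chi> i. f (b $ i))"
proof -
  have "(\<chi> i. f (frame_change P b $ i)) = frame_change P (\<chi> i. f (b $ i))" for P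
    by (simp add: vec_eq_iff frame_change_nth linear_add[OF assms] linear_scale[OF assms])
  then show ?thesis
    unfolding oplane_eq_frame_change by (force simp: image_iff)
qed

lemma gr_graph_oplane:
  "gr_graph (oplane b) L = oplane (\<chi> i. b $ i + L (b $ i))"
  unfolding gr_graph_def
  by (rule image_oplane[of "\<lambda>a. a + blinfun_apply L a"])
    (auto intro!: linear_compose_add bounded_linear.linear[OF blinfun.bounded_linear_right] simp: linear_ident)

lemma bounded_bilinear_frame_change:
  "bounded_bilinear (frame_change :: real ^ 3 ^ 3 \<Rightarrow> 'k::euclidean_space ^ 3 \<Rightarrow> 'k ^ 3)"
  unfolding bilinear_conv_bounded_bilinear[symmetric] bilinear_def
  by (auto intro!: linearI simp: vec_eq_iff frame_change_nth algebra_simps)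

section \<open>Inverse matrices and products that vanish at a point\<close>

lemma matrix_inv_3:
  fixes A :: "real ^ 3 ^ 3"
  assumes "det A \<noteq> 0"
  shows "A ** matrix_inv A = mat 1" "matrix_inv A ** A = mat 1"
  using assms someI_ex[of "\<lambda>B. A ** B = mat 1 \<and> B ** A = mat 1"]
  unfolding invertible_det_nz[symmetric] invertible_def matrix_inv_def by blast+

text \<open>By Cramer's rule the entries of the inverse are quotients of polynomials in the entries.\<close>

lemma tendsto_matrix_inv_3:
  fixes P :: "'a \<Rightarrow> real ^ 3 ^ 3"
  assumes P: "(P \<longlongrightarrow> R) F" and R: "det R \<noteq> 0"
  shows "((\<lambda>y. matrix_inv (P y)) \<longlongrightarrow> matrix_inv R) F"
proof -
  define C where "C A = (\<chi> k c. det (\<chi> i j. if j = k then (if i = c then 1 else 0) else A $ i $ j) / det A)"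
    for A :: "real ^ 3 ^ 3"
  have C: "matrix_inv A = C A" if "det A \<noteq> 0" for A
  proof -
    have "matrix_inv A $ k $ c = C A $ k $ c" for k c
    proof -
      define e :: "real ^ 3" where "e = (\<chi> i. if i = c then 1 else 0)"
      have "A *v (matrix_inv A *v e) = e"
        using that by (simp add: matrix_vector_mul_assoc matrix_inv_3)
      then have "matrix_inv A *v e = (\<chi> k. det (\<chi> i j. if j = k then e $ i else A $ i $ j) / det A)"
        using cramer[OF that] by blast
      then have "(matrix_inv A *v e) $ k = det (\<chi> i j. if j = k then e $ i else A $ i $ j) / det A"
        by simp
      moreover have "(matrix_inv A *v e) $ k = matrix_inv A $ k $ c"
        by (simp add: e_def matrix_vector_mult_def if_distrib cong: if_cong)
      ultimately show ?thesis
        by (simp add: C_def e_def cong: if_cong)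
    qed
    then show ?thesis
      by (simp add: vec_eq_iff)
  qed
  have entry: "((\<lambda>y. P y $ i $ j) \<longlongrightarrow> R $ i $ j) F" for i j
    by (intro tendsto_vec_nth P)
  have det_tendsto: "((\<lambda>y. det (A y)) \<longlongrightarrow> det A0) F"
    if "\<And>i j. ((\<lambda>y. A y $ i $ j) \<longlongrightarrow> A0 $ i $ j) F" for A :: "'a \<Rightarrow> real ^ 3 ^ 3" and A0
    unfolding det_3 by (intro tendsto_add tendsto_diff tendsto_mult that)
  have num: "((\<lambda>y. det (\<chi> i j. if j = k then (if i = c then 1 else 0) else P y $ i $ j)) \<longlongrightarrow>
      det (\<chi> i j. if j = k then (if i = c then 1 else 0) else R $ i $ j)) F" for k c
    by (rule det_tendsto) (simp add: entry)
  have "((\<lambda>y. C (P y)) \<longlongrightarrow> C R) F"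
    unfolding C_def
    by (intro tendsto_vec_lambda tendsto_divide num R det_tendsto[OF entry])
  moreover have "eventually (\<lambda>y. det (P y) \<noteq> 0) F"
    by (rule tendsto_imp_eventually_ne[OF det_tendsto R]) (rule entry)
  then have "eventually (\<lambda>y. C (P y) = matrix_inv (P y)) F"
    by eventually_elim (simp add: C)
  ultimately show ?thesis
    using C[OF R] by (simp add: tendsto_cong)
qed

text \<open>Where the second factor of a product vanishes, the first factor contributes to the derivative only
  through its value, so it need only be continuous. This spares differentiating the inverse
  matrix in the graph chart of the Grassmannian.\<close>

lemma has_derivative_bilinear_zero:
  fixes f :: "'a::real_normed_vector \<Rightarrow> 'b::real_normed_vector"
  assumes B: "bounded_bilinear pr" and f: "isCont f x"
    and g: "(g has_derivative g') (at x)" and g0: "g x = 0"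
  shows "((\<lambda>y. pr (f y) (g y)) has_derivative (\<lambda>u. pr (f x) (g' u))) (at x)"
proof -
  interpret bounded_bilinear pr by fact
  have g'lin: "bounded_linear g'" using g by (rule has_derivative_bounded_linear)
  have "((\<lambda>y. pr (f x) (g y)) has_derivative (\<lambda>u. pr (f x) (g' u))) (at x)"
    by (rule bounded_linear.has_derivative[OF bounded_linear_right g])
  moreover have "((\<lambda>y. pr (f y - f x) (g y)) has_derivative (\<lambda>u. 0)) (at x)"
  proof -
    \<comment> \<open>\<open>g y = O(\<bar>y - x\<bar>)\<close> and \<open>f y - f x \<longlongrightarrow> 0\<close>, so the product is \<open>o(\<bar>y - x\<bar>)\<close>\<close>
    obtain K where K: "K \<ge> 0" "\<And>a b. norm (pr a b) \<le> norm a * norm b * K"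
      using nonneg_bounded by blast
    obtain N where N: "N \<ge> 0" "\<And>u. norm (g' u) \<le> norm u * N"
      using bounded_linear.nonneg_bounded[OF g'lin] by blast
    have "((\<lambda>y. norm (g y - g x - g' (y - x)) / norm (y - x)) \<longlongrightarrow> 0) (at x)"
      using g by (simp add: has_derivative_iff_norm)
    then have "((\<lambda>y. norm (f y - f x) * (norm (g y - g x - g' (y - x)) / norm (y - x) + N) * K)
        \<longlongrightarrow> norm (f x - f x) * (0 + N) * K) (at x)"
      using f unfolding isCont_def by (intro tendsto_intros)
    then have lim: "((\<lambda>y. norm (f y - f x) * (norm (g y - g x - g' (y - x)) / norm (y - x) + N) * K)
        \<longlongrightarrow> 0) (at x)"
      by simp
    have le: "norm (pr (f y - f x) (g y)) / norm (y - x)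
        \<le> norm (f y - f x) * (norm (g y - g x - g' (y - x)) / norm (y - x) + N) * K"
      if "y \<noteq> x" for y
    proof -
      have "norm (g y) \<le> norm (g y - g x - g' (y - x)) + norm (g' (y - x))"
        using norm_triangle_ineq[of "g y - g x - g' (y - x)" "g' (y - x)"] g0 by simp
      also have "\<dots> \<le> norm (g y - g x - g' (y - x)) + norm (y - x) * N"
        using N by simp
      also have "\<dots> = (norm (g y - g x - g' (y - x)) / norm (y - x) + N) * norm (y - x)"
        using that by (simp add: field_simps)
      finally have "norm (f y - f x) * norm (g y) * K
          \<le> norm (f y - f x) * ((norm (g y - g x - g' (y - x)) / norm (y - x) + N) * norm (y - x)) * K"
        using K(1) by (intro mult_right_mono mult_left_mono) auto
      with K(2)[of "f y - f x" "g y"]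
      have "norm (pr (f y - f x) (g y))
          \<le> (norm (f y - f x) * (norm (g y - g x - g' (y - x)) / norm (y - x) + N) * K) * norm (y - x)"
        by (simp add: mult_ac)
      then show ?thesis
        using that by (simp add: pos_divide_le_eq)
    qed
    have "((\<lambda>y. norm (pr (f y - f x) (g y)) / norm (y - x)) \<longlongrightarrow> 0) (at x)"
      by (rule tendsto_sandwich[OF _ _ tendsto_const lim])
        (auto simp: eventually_at_filter intro!: always_eventually le)
    then show ?thesis
      by (simp add: has_derivative_iff_norm g0 zero_right)
  qed
  ultimately have "((\<lambda>y. pr (f x) (g y) + pr (f y - f x) (g y)) has_derivative
      (\<lambda>u. pr (f x) (g' u) + 0)) (at x)"
    by (rule has_derivative_add)
  then show ?thesis
    by (simp add: diff_left)
qed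

section \<open>The graph chart of the Grassmannian\<close>

locale lie_algebra_ip =
  fixes G :: "('g, 'k::euclidean_space) lie_group"
  assumes ip_bilinear: "bilinear (ip G)"
    and ip_sym: "ip G a b = ip G b a"
    and ip_pos: "a \<noteq> 0 \<Longrightarrow> ip G a a > 0"
begin

lemmas ip_simps = bilinear_ladd[OF ip_bilinear] bilinear_radd[OF ip_bilinear]
  bilinear_lmul[OF ip_bilinear] bilinear_rmul[OF ip_bilinear]
  bilinear_lsub[OF ip_bilinear] bilinear_rsub[OF ip_bilinear]
  bilinear_lneg[OF ip_bilinear] bilinear_rneg[OF ip_bilinear]
  bilinear_lzero[OF ip_bilinear] bilinear_rzero[OF ip_bilinear]

lemma bounded_bilinear_ip: "bounded_bilinear (ip G)"
  using ip_bilinear by (simp add: bilinear_conv_bounded_bilinear)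

lemma ip_eqI: "(\<And>c. ip G a c = ip G b c) \<Longrightarrow> a = b"
  using ip_pos[of "a - b"] by (auto simp: ip_simps)

definition orthonormal :: "'k ^ 3 \<Rightarrow> bool" where
  "orthonormal v \<longleftrightarrow> (\<forall>i j. ip G (v $ i) (v $ j) = (if i = j then 1 else 0))"

lemma oriented_onb_iff:
  "oriented_onb G V v \<longleftrightarrow> v \<in> V \<and> orthonormal v"
  by (simp add: oriented_onb_def orthonormal_def)

definition normal_part :: "'k ^ 3 \<Rightarrow> 'k \<Rightarrow> 'k" where
  "normal_part v a = a - (\<Sum>i\<in>UNIV. ip G a (v $ i) *\<^sub>R v $ i)"

lemma linear_normal_part: "linear (normal_part v)"
  by (rule linearI) (simp_all add: normal_part_def sum_3 ip_simps algebra_simps)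

lemma perp_oplane: "perp G (oplane v) = {a. \<forall>i. ip G a (v $ i) = 0}"
proof -
  have "(\<forall>w\<in>oplane v. \<forall>i. ip G a (w $ i) = 0) \<longleftrightarrow> (\<forall>i. ip G a (v $ i) = 0)" for a
    using oplane_self[of v]
    by (auto simp: oplane_eq_frame_change frame_change_nth ip_simps)
  then show ?thesis
    by (simp add: perp_def)
qed

lemma normal_part_perp: "orthonormal v \<Longrightarrow> normal_part v a \<in> perp G (oplane v)"
  by (auto simp: perp_oplane normal_part_def sum_3 ip_simps orthonormal_def
      forall_3)

lemma ip_normal_part: "c \<in> perp G (oplane v) \<Longrightarrow> ip G (normal_part v a) c = ip G a c"
  by (auto simp: perp_oplane normal_part_def sum_3 ip_simps ip_sym[of _ c])

lemma normal_part_self: "orthonormal v \<Longrightarrow> normal_part v (v $ i) = 0"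
  using exhaust_3[of i] by (auto simp: normal_part_def sum_3 orthonormal_def)

lemma perp_eqI:
  assumes "a \<in> perp G (oplane v)" "b \<in> perp G (oplane v)"
    and "\<And>c. c \<in> perp G (oplane v) \<Longrightarrow> ip G a c = ip G b c"
  shows "a = b"
proof -
  have "a - b \<in> perp G (oplane v)"
    using assms(1,2) by (simp add: perp_oplane ip_simps)
  then show ?thesis
    using assms(3)[of "a - b"] ip_pos[of "a - b"] by (auto simp: ip_simps)
qed

text \<open>The map \<open>\<Sum>\<^sub>j v\<^sub>j \<otimes> n\<^sub>j\<close>, that is, \<open>v\<^sub>j \<mapsto> n\<^sub>j\<close> on the span of an orthonormal \<open>v\<close> and zero on its
  orthogonal complement. With \<open>n\<^sub>j\<close> orthogonal to \<open>v\<close> these are the elements of \<open>Hom(V, V\<^sup>\<bottom>)\<close>.\<close>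

definition hom3 :: "'k ^ 3 \<Rightarrow> 'k ^ 3 \<Rightarrow> 'k \<Rightarrow>\<^sub>L 'k" where
  "hom3 v n = Blinfun (\<lambda>a. \<Sum>j\<in>UNIV. ip G a (v $ j) *\<^sub>R n $ j)"

lemma hom3_apply: "hom3 v n a = (\<Sum>j\<in>UNIV. ip G a (v $ j) *\<^sub>R n $ j)"
proof -
  have "linear (\<lambda>a. \<Sum>j\<in>UNIV. ip G a (v $ j) *\<^sub>R n $ j)"
    by (rule linearI) (simp_all add: sum_3 ip_simps algebra_simps)
  then show ?thesis
    unfolding hom3_def by (subst bounded_linear_Blinfun_apply) (simp_all add: linear_conv_bounded_linear)
qed

lemma hom3_nth: "orthonormal v \<Longrightarrow> hom3 v n (v $ i) = n $ i"
  using exhaust_3[of i] by (auto simp: hom3_apply sum_3 orthonormal_def)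

lemma bounded_linear_hom3: "bounded_linear (hom3 v)"
  unfolding linear_conv_bounded_linear[symmetric]
  by (rule linearI) (simp_all add: blinfun_eqI hom3_apply blinfun.add_left blinfun.scaleR_left
      sum_3 algebra_simps)

lemma hom3_gr_tangent:
  assumes "\<And>i. n $ i \<in> perp G (oplane v)"
  shows "hom3 v n \<in> gr_tangent G (oplane v)"
  using assms by (auto simp: gr_tangent_def hom3_apply perp_oplane sum_3 ip_simps)

lemma gr_tangentD:
  assumes "L \<in> gr_tangent G V"
  shows "a \<in> perp G V \<Longrightarrow> blinfun_apply L a = 0" "blinfun_apply L a \<in> perp G V"
  using assms by (auto simp: gr_tangent_def)

lemma gr_tangent_eqI:
  assumes v: "orthonormal v"
    and L: "L \<in> gr_tangent G (oplane v)" "K \<in> gr_tangent G (oplane v)"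
    and eq: "\<And>i. blinfun_apply L (v $ i) = blinfun_apply K (v $ i)"
  shows "L = K"
proof (rule blinfun_eqI)
  fix a
  have a: "a = normal_part v a + (\<Sum>i\<in>UNIV. ip G a (v $ i) *\<^sub>R v $ i)"
    by (simp add: normal_part_def)
  have "blinfun_apply L a = (\<Sum>i\<in>UNIV. ip G a (v $ i) *\<^sub>R blinfun_apply L (v $ i))"
    if "L \<in> gr_tangent G (oplane v)" for L
    using gr_tangentD(1)[OF that normal_part_perp[OF v], of a]
    by (subst a) (simp add: blinfun.add_right blinfun.sum_right blinfun.scaleR_right)
  then show "blinfun_apply L a = blinfun_apply K a"
    using L eq by simp
qed

text \<open>A matrix that relates the frames \<open>v\<^sub>i + L v\<^sub>i\<close> and \<open>v\<^sub>i + K v\<^sub>i\<close> is the identity, as the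
  projection of both frames to \<open>V\<close> is \<open>v\<close>.\<close>

lemma gr_graph_inj:
  assumes v: "orthonormal v"
    and L: "L \<in> gr_tangent G (oplane v)" "K \<in> gr_tangent G (oplane v)"
    and eq: "gr_graph (oplane v) L = gr_graph (oplane v) K"
  shows "L = K"
proof (rule gr_tangent_eqI[OF v L])
  fix i
  define l where "l = (\<chi> i. v $ i + blinfun_apply L (v $ i))"
  define k where "k = (\<chi> i. v $ i + blinfun_apply K (v $ i))"
  have "l \<in> oplane k"
    using eq oplane_self[of l] by (simp add: gr_graph_oplane l_def k_def)
  then obtain P where P: "l = frame_change P k"
    by (auto simp: oplane_eq_frame_change)
  have perp: "ip G (blinfun_apply L a) (v $ j) = 0" "ip G (blinfun_apply K a) (v $ j) = 0" for a j
    using gr_tangentD(2)[OF L(1)] gr_tangentD(2)[OF L(2)] by (auto simp: perp_oplane)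
  have lv: "ip G (l $ i) (v $ j) = (if i = j then 1 else 0)"
    and kv: "ip G (k $ i) (v $ j) = (if i = j then 1 else 0)" for i j
    using v by (auto simp: l_def k_def ip_simps perp orthonormal_def)
  have "P $ i $ j = (if i = j then 1 else 0)" for j
  proof -
    have "ip G (l $ i) (v $ j) = P $ i $ j"
      using exhaust_3[of j] by (auto simp: P frame_change_nth ip_simps kv)
    then show ?thesis
      by (simp add: lv)
  qed
  then have "l $ i = k $ i"
    using exhaust_3[of i] by (auto simp: P frame_change_nth)
  then show "blinfun_apply L (v $ i) = blinfun_apply K (v $ i)"
    by (simp add: l_def k_def)
qed

lemma gr_coord_eqI:
  assumes "orthonormal v" "L \<in> gr_tangent G (oplane v)" "gr_graph (oplane v) L = W"
  shows "gr_coord G (oplane v) W = L"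
  unfolding gr_coord_def using assms by (auto intro!: the_equality intro: gr_graph_inj)

text \<open>Write \<open>b = P v + n\<close> with \<open>n\<close> orthogonal to \<open>v\<close>. Then \<open>P\<^sup>-\<^sup>1 b = v + P\<^sup>-\<^sup>1 n\<close> is a frame of the same
  oriented plane, and it lies on the graph of \<open>v\<^sub>j \<mapsto> (P\<^sup>-\<^sup>1 n)\<^sub>j\<close>.\<close>

lemma gr_coord_oplane:
  assumes v: "orthonormal v"
    and P: "det (\<chi> i j. ip G (b $ i) (v $ j)) > 0"
  shows "gr_coord G (oplane v) (oplane b) =
    hom3 v (frame_change (matrix_inv (\<chi> i j. ip G (b $ i) (v $ j))) (\<chi> i. normal_part v (b $ i)))"
    (is "_ = ?L")
proof (rule gr_coord_eqI[OF v])
  define P where "P = (\<chi> i j. ip G (b $ i) (v $ j))"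
  define n where "n = (\<chi> i. normal_part v (b $ i))"
  define m where "m = frame_change (matrix_inv P) n"
  have "m $ i \<in> perp G (oplane v)" for i
    using normal_part_perp[OF v] by (auto simp: m_def n_def frame_change_nth perp_oplane ip_simps)
  then show "?L \<in> gr_tangent G (oplane v)"
    unfolding P_def[symmetric] n_def[symmetric] m_def[symmetric] by (rule hom3_gr_tangent)
  have "frame_change P (v + m) = b"
  proof -
    have "frame_change P m = n"
      using matrix_inv_3(1)[of P] P by (simp add: m_def frame_change_frame_change frame_change_one P_def)
    moreover have "frame_change P (v + m) = frame_change P v + frame_change P m"
      by (simp add: vec_eq_iff frame_change_nth algebra_simps)
    moreover have "frame_change P v + n = b"
      by (simp add: vec_eq_iff frame_change_def P_def n_def normal_part_def)
    ultimately show ?thesis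
      by simp
  qed
  then have "oplane b = oplane (v + m)"
    using oplane_frame_change[of P "v + m"] P by (simp add: P_def)
  also have "v + m = (\<chi> i. v $ i + hom3 v m (v $ i))"
    by (simp add: vec_eq_iff hom3_nth[OF v])
  finally show "gr_graph (oplane v) ?L = oplane b"
    by (simp add: gr_graph_oplane P_def m_def n_def)
qed

text \<open>The differential of a plane spanned by a moving frame \<open>b\<close>: only the normal part of the motion of
  \<open>b\<close> counts. A frame that starts at \<open>s v\<close> instead of \<open>v\<close> moves the plane at \<open>1/s\<close> of the speed;
  below \<open>s\<close> is \<open>\<lambda>\<close> for the moment map and \<open>1\<close> for the group action.\<close>

lemma gr_coord_has_derivative:
  fixes b :: "'a::real_normed_vector \<Rightarrow> 'k ^ 3"
  assumes v: "orthonormal v"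
    and b: "(b has_derivative b') (at y)" and b_y: "b y = s *\<^sub>R v" and s: "s > 0"
    and f: "\<forall>\<^sub>F z in nhds y. f z = oplane (b z)"
  shows "((\<lambda>z. gr_coord G (oplane v) (f z)) has_derivative
    (\<lambda>u. hom3 v (\<chi> j. normal_part v (b' u $ j) /\<^sub>R s))) (at y)"
proof -
  define P where "P z = (\<chi> i j. ip G (b z $ i) (v $ j))" for z
  define N where "N z = (\<chi> i. normal_part v (b z $ i))" for z
  have bcont: "(b \<longlongrightarrow> b y) (at y)"
    using has_derivative_continuous[OF b] by (simp add: continuous_at)
  have Pcont: "(P \<longlongrightarrow> P y) (at y)"
    unfolding P_def
    by (intro tendsto_vec_lambda bounded_bilinear.tendsto[OF bounded_bilinear_ip] tendsto_vec_nth
        tendsto_const bcont)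
  have Py: "P y = mat s"
    using v by (auto simp: P_def b_y vec_eq_iff ip_simps orthonormal_def mat_def)
  have matP: "frame_change (mat s :: real ^ 3 ^ 3) w = s *\<^sub>R w" for w :: "'k ^ 3"
    by (auto simp: vec_eq_iff forall_3 frame_change_nth mat_def)
  have det: "det (P y) > 0"
    unfolding Py using s by (simp add: det_3 mat_def)
  have "((\<lambda>z. det (P z)) \<longlongrightarrow> det (P y)) (at y)"
    unfolding det_3 by (intro tendsto_add tendsto_diff tendsto_mult tendsto_vec_nth Pcont)
  then have "\<forall>\<^sub>F z in at y. det (P z) > 0"
    using det by (rule order_tendstoD)
  then have "\<forall>\<^sub>F z in nhds y. det (P z) > 0"
    using det by (simp add: eventually_nhds_conv_at)
  with f have ev: "\<forall>\<^sub>F z in nhds y. gr_coord G (oplane v) (f z) = hom3 v (frame_change (matrix_inv (P z)) (N z))"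
    by eventually_elim (simp add: P_def N_def gr_coord_oplane[OF v])
  have "bounded_linear (\<lambda>w::'k^3. \<chi> i. normal_part v (w $ i))"
    unfolding linear_conv_bounded_linear[symmetric]
    by (rule linearI) (simp_all add: vec_eq_iff linear_add[OF linear_normal_part] linear_scale[OF linear_normal_part])
  then have "(N has_derivative (\<lambda>u. \<chi> i. normal_part v (b' u $ i))) (at y)"
    unfolding N_def using b by (rule bounded_linear.has_derivative)
  moreover have "N y = 0"
    by (simp add: N_def b_y vec_eq_iff linear_scale[OF linear_normal_part] normal_part_self[OF v])
  moreover have "isCont (\<lambda>z. matrix_inv (P z)) y"
    unfolding isCont_def using det by (intro tendsto_matrix_inv_3 Pcont) auto
  ultimately have "((\<lambda>z. frame_change (matrix_inv (P z)) (N z)) has_derivative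
      (\<lambda>u. frame_change (matrix_inv (P y)) (\<chi> i. normal_part v (b' u $ i)))) (at y)"
    by (intro has_derivative_bilinear_zero[OF bounded_bilinear_frame_change])
  moreover have "frame_change (matrix_inv (P y)) w = w /\<^sub>R s" for w :: "'k ^ 3"
  proof -
    have "s *\<^sub>R frame_change (matrix_inv (P y)) w = w"
      using matrix_inv_3(1)[of "P y"] det
      by (simp add: frame_change_frame_change frame_change_one Py flip: matP)
    then show ?thesis
      using s by (metis inverse_eq_divide scaleR_one scaleR_scaleR left_inverse less_irrefl)
  qed
  ultimately have "((\<lambda>z. frame_change (matrix_inv (P z)) (N z)) has_derivative
      (\<lambda>u. \<chi> j. normal_part v (b' u $ j) /\<^sub>R s)) (at y)"
    by (simp add: scaleR_vec_def)
  from bounded_linear.has_derivative[OF bounded_linear_hom3 this]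
  show ?thesis
    by (rule has_derivative_transform_eventually)
      (use ev in \<open>auto simp: eventually_nhds_conv_at elim: eventually_mono\<close>)
qed

end

section \<open>The gradient of the functional on the Grassmannian\<close>

locale lie_algebra_inv = lie_algebra_ip G
  for G :: "('g, 'k::euclidean_space) lie_group" +
  assumes bracket_bilinear: "bilinear (bracket G)"
    and bracket_self: "bracket G a a = 0"
    and ip_bracket: "ip G (bracket G c a) b = - ip G a (bracket G c b)"
begin

lemmas bracket_simps = bilinear_ladd[OF bracket_bilinear] bilinear_radd[OF bracket_bilinear]
  bilinear_lmul[OF bracket_bilinear] bilinear_rmul[OF bracket_bilinear]

lemma bracket_antisym: "bracket G a b = - bracket G b a"
proof -
  have "bracket G a b + bracket G b a = bracket G (a + b) (a + b)"
    unfolding bracket_simps by (simp add: bracket_self)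
  then show ?thesis
    by (simp only: bracket_self eq_neg_iff_add_eq_0)
qed

text \<open>The alternating 3-form whose value on orthonormal frames is the functional \<open>\<psi>\<close>.\<close>

definition tri :: "'k \<Rightarrow> 'k \<Rightarrow> 'k \<Rightarrow> real" where
  "tri a b c = ip G (bracket G a b) c"

lemma tri_linear:
  "tri (a + a') b c = tri a b c + tri a' b c" "tri (r *\<^sub>R a) b c = r * tri a b c"
  "tri a (b + b') c = tri a b c + tri a b' c" "tri a (r *\<^sub>R b) c = r * tri a b c"
  "tri a b (c + c') = tri a b c + tri a b c'" "tri a b (r *\<^sub>R c) = r * tri a b c"
  by (simp_all add: tri_def bracket_simps ip_simps)

lemma tri_swap: "tri b a c = - tri a b c" "tri a c b = - tri a b c"
proof -
  show "tri b a c = - tri a b c"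
    using bracket_antisym[of b a] by (simp add: tri_def ip_simps)
  show "tri a c b = - tri a b c"
    using ip_bracket[of a b c] ip_sym[of b] by (simp add: tri_def)
qed

lemma tri_same: "tri a a c = 0" "tri a c a = 0" "tri c a a = 0"
  using tri_swap(1)[of a a c] tri_swap(2)[of c a a] tri_swap(2)[of a a c] by auto

lemma tri_cyclic: "tri a b c = tri b c a"
  using tri_swap(1)[of b a c] tri_swap(2)[of b a c] by simp

text \<open>As a function of a frame, the alternating form changes by determinants.\<close>

definition tri3 :: "'k ^ 3 \<Rightarrow> real" where
  "tri3 b = tri (b $ 1) (b $ 2) (b $ 3)"

lemma tri3_frame_change: "tri3 (frame_change P b) = det P * tri3 b"
proof -
  have s: "tri (b $ 2) (b $ 1) (b $ 3) = - tri3 b" "tri (b $ 1) (b $ 3) (b $ 2) = - tri3 b"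
    "tri (b $ 3) (b $ 2) (b $ 1) = - tri3 b" "tri (b $ 2) (b $ 3) (b $ 1) = tri3 b"
    "tri (b $ 3) (b $ 1) (b $ 2) = tri3 b" "tri (b $ 1) (b $ 2) (b $ 3) = tri3 b"
    unfolding tri3_def using tri_swap by metis+
  show ?thesis
    unfolding tri3_def[of "frame_change P b"] frame_change_nth
    by (simp add: tri_linear tri_same s det_3 algebra_simps)
qed

definition gram :: "'k ^ 3 \<Rightarrow> real ^ 3 ^ 3" where
  "gram b = (\<chi> i j. ip G (b $ i) (b $ j))"

lemma gram_frame_change: "gram (frame_change P b) = P ** gram b ** transpose P"
  by (simp add: vec_eq_iff gram_def frame_change_nth matrix_matrix_mult_def transpose_def sum_3 ip_simps
      algebra_simps)

lemma gram_orthonormal: "orthonormal v \<longleftrightarrow> gram v = mat 1"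
  by (auto simp: gram_def orthonormal_def mat_def vec_eq_iff)

text \<open>The Gram matrix of \<open>P b\<close> is \<open>P (gram b) P\<^sup>T\<close>; take determinants.\<close>

lemma det_gram_orthonormal:
  assumes "orthonormal (frame_change P b)" "det P > 0"
  shows "det P = 1 / sqrt (det (gram b))"
proof -
  have "det P * det (gram b) * det P = 1"
    using assms(1) unfolding gram_orthonormal gram_frame_change
    by (metis det_I det_mul det_transpose)
  then have "det (gram b) = (1 / det P)\<^sup>2"
    using assms(2) by (simp add: field_simps power2_eq_square)
  then show ?thesis
    using assms(2) by (simp add: real_sqrt_divide)
qed

text \<open>The change of frame is lower triangular with positive diagonal, so the orthonormal frame has the
  same orientation.\<close>

lemma gram_schmidt:
  assumes indep: "\<And>c :: real ^ 3. (\<Sum>i\<in>UNIV. c $ i *\<^sub>R b $ i) = 0 \<Longrightarrow> c = 0"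
  obtains P where "det P > 0" "orthonormal (frame_change P b)"
proof -
  have nz: "r *\<^sub>R b $ 1 + s *\<^sub>R b $ 2 + t *\<^sub>R b $ 3 \<noteq> 0" if "r \<noteq> 0 \<or> s \<noteq> 0 \<or> t \<noteq> 0" for r s t
  proof
    assume "r *\<^sub>R b $ 1 + s *\<^sub>R b $ 2 + t *\<^sub>R b $ 3 = 0"
    then have "(vector [r, s, t] :: real ^ 3) = 0"
      by (intro indep) (simp add: sum_3)
    then have "(vector [r, s, t] :: real ^ 3) $ i = 0" for i
      by simp
    from this[of 1] this[of 2] this[of 3] show False
      using that by simp
  qed
  define unit where "unit a = a /\<^sub>R sqrt (ip G a a)" for a
  have unit1: "ip G (unit a) (unit a) = 1" if "a \<noteq> 0" for a
    using ip_pos[OF that] by (simp add: unit_def ip_simps field_simps flip: real_sqrt_mult)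
  have unit0: "ip G (unit a) c = 0" if "ip G a c = 0" for a c
    using that by (simp add: unit_def ip_simps)
  define n :: "'k \<Rightarrow> real" where "n a = 1 / sqrt (ip G a a)" for a
  have n: "n a > 0" if "a \<noteq> 0" for a
    using ip_pos[OF that] by (simp add: n_def)
  have unit: "unit a = n a *\<^sub>R a" for a
    by (simp add: unit_def n_def divide_inverse)
  define e1 where "e1 = unit (b $ 1)"
  define c2 where "c2 = b $ 2 - ip G (b $ 2) e1 *\<^sub>R e1"
  define e2 where "e2 = unit c2"
  define c3 where "c3 = b $ 3 - ip G (b $ 3) e1 *\<^sub>R e1 - ip G (b $ 3) e2 *\<^sub>R e2"
  define e3 where "e3 = unit c3"
  have b1: "b $ 1 \<noteq> 0"
    using nz[of 1 0 0] by simp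
  define p where "p = - ip G (b $ 2) e1 * n (b $ 1)"
  have c2: "c2 = p *\<^sub>R b $ 1 + b $ 2"
    by (simp add: c2_def e1_def unit p_def)
  then have c2nz: "c2 \<noteq> 0"
    using nz[of p 1 0] by simp
  define q where "q = - ip G (b $ 3) e1 * n (b $ 1) - ip G (b $ 3) e2 * n c2 * p"
  define r where "r = - ip G (b $ 3) e2 * n c2"
  have e2: "e2 = n c2 *\<^sub>R (p *\<^sub>R b $ 1 + b $ 2)"
    unfolding e2_def unit using c2 by simp
  have c3: "c3 = q *\<^sub>R b $ 1 + r *\<^sub>R b $ 2 + b $ 3"
    unfolding c3_def q_def r_def e2 by (simp add: e1_def unit algebra_simps)
  then have c3nz: "c3 \<noteq> 0"
    using nz[of q r 1] by simp
  have o11: "ip G e1 e1 = 1" and o22: "ip G e2 e2 = 1" and o33: "ip G e3 e3 = 1"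
    using b1 c2nz c3nz by (auto simp: e1_def e2_def e3_def unit1)
  have o21: "ip G e2 e1 = 0"
    unfolding e2_def by (rule unit0) (simp add: c2_def ip_simps o11)
  have o12: "ip G e1 e2 = 0"
    using o21 ip_sym by metis
  have o31: "ip G e3 e1 = 0"
    unfolding e3_def by (rule unit0) (simp add: c3_def ip_simps o11 o21)
  have o32: "ip G e3 e2 = 0"
    unfolding e3_def by (rule unit0) (simp add: c3_def ip_simps o12 o22)
  have o13: "ip G e1 e3 = 0" and o23: "ip G e2 e3 = 0"
    using o31 o32 ip_sym by metis+
  define P :: "real ^ 3 ^ 3" where
    "P = vector [vector [n (b $ 1), 0, 0], vector [n c2 * p, n c2, 0], vector [n c3 * q, n c3 * r, n c3]]"
  have "det P = n (b $ 1) * n c2 * n c3"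
    by (simp add: P_def det_3)
  then have "det P > 0"
    using n b1 c2nz c3nz by simp
  moreover have "e3 = n c3 *\<^sub>R (q *\<^sub>R b $ 1 + r *\<^sub>R b $ 2 + b $ 3)"
    unfolding e3_def unit using c3 by simp
  then have "frame_change P b $ 1 = e1" "frame_change P b $ 2 = e2" "frame_change P b $ 3 = e3"
    unfolding frame_change_nth e2 by (simp_all add: P_def e1_def unit scaleR_add_right)
  then have "orthonormal (frame_change P b)"
    by (simp add: orthonormal_def forall_3 o11 o22 o33 o12 o13 o21 o23 o31 o32)
  ultimately show thesis
    using that by blast
qed

text \<open>This extends \<open>\<psi>\<close> from orthonormal frames to all frames of a plane, so that the curves
  \<open>v\<^sub>i + t K v\<^sub>i\<close> of frames can be used to differentiate it.\<close>

lemma psi_oplane: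
  assumes indep: "\<And>c :: real ^ 3. (\<Sum>i\<in>UNIV. c $ i *\<^sub>R b $ i) = 0 \<Longrightarrow> c = 0"
  shows "psi G (oplane b) = tri3 b / sqrt (det (gram b))"
proof -
  define e where "e = (SOME e. oriented_onb G (oplane b) e)"
  have "\<exists>e. oriented_onb G (oplane b) e"
    using gram_schmidt[OF indep] by (metis oplane_frame_change oplane_self oriented_onb_iff)
  then have "oriented_onb G (oplane b) e"
    unfolding e_def by (rule someI_ex)
  then obtain P where P: "det P > 0" "e = frame_change P b" "orthonormal (frame_change P b)"
    by (auto simp: oriented_onb_iff oplane_eq_frame_change)
  have "psi G (oplane b) = tri3 e"
    by (simp add: psi_def e_def Let_def tri3_def tri_def)
  also have "\<dots> = det P * tri3 b"
    by (simp add: P(2) tri3_frame_change)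
  finally show ?thesis
    using det_gram_orthonormal[OF P(3,1)] by simp
qed

text \<open>The orthonormal frame chosen in the definition of the metric differs from \<open>v\<close> by an orthogonal matrix.\<close>

lemma gr_metric_oplane:
  assumes v: "orthonormal v"
  shows "gr_metric G (oplane v) K L =
    (\<Sum>i\<in>UNIV. ip G (blinfun_apply K (v $ i)) (blinfun_apply L (v $ i)))"
proof -
  define e where "e = (SOME e. oriented_onb G (oplane v) e)"
  have "oriented_onb G (oplane v) e"
    unfolding e_def using v oplane_self by (metis oriented_onb_iff someI_ex)
  then obtain P where P: "det P > 0" "e = frame_change P v" "orthonormal (frame_change P v)"
    by (auto simp: oriented_onb_iff oplane_eq_frame_change)
  have "P ** transpose P = mat 1"
    using P(3) v by (simp add: gram_orthonormal gram_frame_change)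
  then have "transpose P ** P = mat 1"
    by (rule matrix_left_right_inverse[THEN iffD1])
  then have PP: "(transpose P ** P) $ i $ j = (if i = j then 1 else 0)" for i j
    by (simp add: mat_def)
  have e: "e $ i = (\<Sum>j\<in>UNIV. P $ i $ j *\<^sub>R v $ j)" for i
    by (simp add: P(2) frame_change_def)
  have sum_ip: "ip G (sum f UNIV) (sum g UNIV) = (\<Sum>i\<in>UNIV. \<Sum>j\<in>UNIV. ip G (f i) (g j))"
    for f g :: "3 \<Rightarrow> 'k"
    by (simp add: sum_3 ip_simps)
  have "gr_metric G (oplane v) K L = (\<Sum>i\<in>UNIV. ip G (blinfun_apply K (e $ i)) (blinfun_apply L (e $ i)))"
    by (simp add: gr_metric_def e_def Let_def)
  also have "\<dots> = (\<Sum>i\<in>UNIV. \<Sum>j\<in>UNIV. \<Sum>k\<in>UNIV. P $ i $ k * P $ i $ j *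
      ip G (blinfun_apply K (v $ j)) (blinfun_apply L (v $ k)))"
    by (simp add: e blinfun.sum_right blinfun.scaleR_right sum_ip ip_simps mult.assoc)
  also have "\<dots> = (\<Sum>j\<in>UNIV. \<Sum>k\<in>UNIV. (transpose P ** P) $ j $ k *
      ip G (blinfun_apply K (v $ j)) (blinfun_apply L (v $ k)))"
    by (simp add: matrix_matrix_mult_def transpose_def sum_3 algebra_simps)
  also have "\<dots> = (\<Sum>j\<in>UNIV. ip G (blinfun_apply K (v $ j)) (blinfun_apply L (v $ j)))"
    unfolding PP by (simp add: sum_3)
  finally show ?thesis .
qed

lemma gr_metric_pos:
  assumes v: "orthonormal v" and L: "L \<in> gr_tangent G (oplane v)"
    and 0: "gr_metric G (oplane v) L L = 0"
  shows "L = 0"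
proof (rule gr_tangent_eqI[OF v L])
  show "0 \<in> gr_tangent G (oplane v)"
    by (simp add: gr_tangent_def perp_oplane ip_simps)
  have nonneg: "ip G a a \<ge> 0" for a
    using ip_pos[of a] by (cases "a = 0") (auto simp: ip_simps)
  have "\<forall>i\<in>UNIV. ip G (blinfun_apply L (v $ i)) (blinfun_apply L (v $ i)) = 0"
    using 0 unfolding gr_metric_oplane[OF v] by (subst (asm) sum_nonneg_eq_0_iff) (auto simp: nonneg)
  then show "blinfun_apply L (v $ i) = blinfun_apply 0 (v $ i)" for i
    using ip_pos[of "blinfun_apply L (v $ i)"] by fastforce
qed

text \<open>Along \<open>v + t k\<close> with \<open>k\<close> orthogonal to \<open>v\<close> the Gram matrix is \<open>1 + t\<^sup>2 \<langle>k\<^sub>i, k\<^sub>j\<rangle>\<close>. It is constant to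
  first order, so only the alternating form contributes.\<close>

lemma psi_has_derivative:
  assumes v: "orthonormal v" and K: "K \<in> gr_tangent G (oplane v)"
  shows "((\<lambda>t. psi G (gr_graph (oplane v) (t *\<^sub>R K))) has_real_derivative
     (tri (K (v $ 1)) (v $ 2) (v $ 3) + tri (v $ 1) (K (v $ 2)) (v $ 3)
       + tri (v $ 1) (v $ 2) (K (v $ 3)))) (at 0)"
proof -
  define k where "k = (\<chi> i. blinfun_apply K (v $ i))"
  have k: "ip G (k $ i) (v $ j) = 0" "ip G (v $ j) (k $ i) = 0" for i j
    using gr_tangentD(2)[OF K] ip_sym[of "v $ j"] by (auto simp: perp_oplane k_def)
  have gr: "gr_graph (oplane v) (t *\<^sub>R K) = oplane (v + t *\<^sub>R k)" for t
    unfolding gr_graph_oplane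
    by (intro arg_cong[where f = oplane]) (simp add: vec_eq_iff k_def blinfun.scaleR_left)
  have psi: "psi G (gr_graph (oplane v) (t *\<^sub>R K)) =
      tri3 (v + t *\<^sub>R k) / sqrt (det (gram (v + t *\<^sub>R k)))" for t
    unfolding gr
  proof (rule psi_oplane)
    fix c :: "real ^ 3"
    assume "(\<Sum>i\<in>UNIV. c $ i *\<^sub>R (v + t *\<^sub>R k) $ i) = 0"
    then have "ip G (\<Sum>i\<in>UNIV. c $ i *\<^sub>R (v + t *\<^sub>R k) $ i) (v $ j) = 0" for j
      by (simp add: ip_simps)
    from this[of 1] this[of 2] this[of 3] show "c = 0"
      using v by (simp add: vec_eq_iff forall_3 sum_3 ip_simps k orthonormal_def)
  qed
  define m where "m i j = ip G (k $ i) (k $ j)" for i j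
  have gram: "gram (v + t *\<^sub>R k) = (\<chi> i j. (if i = j then 1 else 0) + t * t * m i j)" for t
    using v by (simp add: gram_def vec_eq_iff ip_simps k m_def orthonormal_def)
  have det: "((\<lambda>t. det (gram (v + t *\<^sub>R k))) has_real_derivative 0) (at 0)"
    unfolding gram det_3 by (auto intro!: derivative_eq_intros)
  have det0: "det (gram (v + 0 *\<^sub>R k)) = 1"
    using v by (simp add: gram_orthonormal)
  have "((\<lambda>t. tri3 (v + t *\<^sub>R k)) has_real_derivative
      (tri (k $ 1) (v $ 2) (v $ 3) + tri (v $ 1) (k $ 2) (v $ 3) + tri (v $ 1) (v $ 2) (k $ 3))) (at 0)"
    unfolding tri3_def vector_add_component vector_scaleR_component tri_linear
    by (auto intro!: derivative_eq_intros)
  moreover have "((\<lambda>t. sqrt (det (gram (v + t *\<^sub>R k)))) has_real_derivative 0) (at 0)"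
    using DERIV_chain2[OF DERIV_real_sqrt det] det0 by simp
  ultimately have "((\<lambda>t. tri3 (v + t *\<^sub>R k) / sqrt (det (gram (v + t *\<^sub>R k)))) has_real_derivative
      ((tri (k $ 1) (v $ 2) (v $ 3) + tri (v $ 1) (k $ 2) (v $ 3) + tri (v $ 1) (v $ 2) (k $ 3))
         * sqrt (det (gram (v + 0 *\<^sub>R k))) - tri3 (v + 0 *\<^sub>R k) * 0)
        / (sqrt (det (gram (v + 0 *\<^sub>R k))) * sqrt (det (gram (v + 0 *\<^sub>R k))))) (at 0)"
    using det0 by (intro DERIV_divide) auto
  then have "((\<lambda>t. tri3 (v + t *\<^sub>R k) / sqrt (det (gram (v + t *\<^sub>R k)))) has_real_derivative
      (tri (k $ 1) (v $ 2) (v $ 3) + tri (v $ 1) (k $ 2) (v $ 3) + tri (v $ 1) (v $ 2) (k $ 3))) (at 0)"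
    using det0 by simp
  then show ?thesis
    unfolding psi by (simp add: k_def)
qed

text \<open>By cyclicity of the alternating form each term of the derivative reads \<open>\<langle>[v\<^sub>k, v\<^sub>l], K v\<^sub>j\<rangle>\<close> with
  \<open>(j, k, l)\<close> cyclic, which is a pairing with \<open>K\<close>.\<close>

lemma grad_psi_oplane:
  assumes v: "orthonormal v"
  shows "grad_psi G (oplane v) = hom3 v (vector [normal_part v (bracket G (v $ 2) (v $ 3)),
     normal_part v (bracket G (v $ 3) (v $ 1)), normal_part v (bracket G (v $ 1) (v $ 2))])"
    (is "_ = ?L")
proof -
  define n where "n = (vector [normal_part v (bracket G (v $ 2) (v $ 3)),
     normal_part v (bracket G (v $ 3) (v $ 1)), normal_part v (bracket G (v $ 1) (v $ 2))] :: 'k ^ 3)"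
  have L: "hom3 v n \<in> gr_tangent G (oplane v)"
  proof (rule hom3_gr_tangent)
    show "n $ i \<in> perp G (oplane v)" for i
      using exhaust_3[of i] by (auto simp: n_def normal_part_perp[OF v])
  qed
  have metric: "gr_metric G (oplane v) (hom3 v n) K =
      tri (K (v $ 1)) (v $ 2) (v $ 3) + tri (v $ 1) (K (v $ 2)) (v $ 3) + tri (v $ 1) (v $ 2) (K (v $ 3))"
    if K: "K \<in> gr_tangent G (oplane v)" for K
  proof -
    have "gr_metric G (oplane v) (hom3 v n) K = tri (v $ 2) (v $ 3) (K (v $ 1))
       + tri (v $ 3) (v $ 1) (K (v $ 2)) + tri (v $ 1) (v $ 2) (K (v $ 3))"
      by (simp add: gr_metric_oplane[OF v] sum_3 hom3_nth[OF v] n_def ip_normal_part gr_tangentD(2)[OF K] tri_def)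
    then show ?thesis
      by (simp add: tri_cyclic[of "K (v $ 1)"] tri_cyclic[of "v $ 1" "K (v $ 2)"]
          tri_cyclic[of "K (v $ 2)"])
  qed
  have "grad_psi G (oplane v) = hom3 v n"
    unfolding grad_psi_def
  proof (rule the_equality, intro conjI ballI L)
    fix K assume K: "K \<in> gr_tangent G (oplane v)"
    show "((\<lambda>t. psi G (gr_graph (oplane v) (t *\<^sub>R K))) has_real_derivative
        gr_metric G (oplane v) (hom3 v n) K) (at 0)"
      unfolding metric[OF K] by (rule psi_has_derivative[OF v K])
  next
    fix M
    assume M: "M \<in> gr_tangent G (oplane v) \<and> (\<forall>K\<in>gr_tangent G (oplane v).
      ((\<lambda>t. psi G (gr_graph (oplane v) (t *\<^sub>R K))) has_real_derivative gr_metric G (oplane v) M K) (at 0))"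
    have eq: "gr_metric G (oplane v) M K = gr_metric G (oplane v) (hom3 v n) K"
      if K: "K \<in> gr_tangent G (oplane v)" for K
      using M K psi_has_derivative[OF v K] unfolding metric[OF K] by (blast intro: DERIV_unique)
    define D where "D = M - hom3 v n"
    have D: "D \<in> gr_tangent G (oplane v)"
      using M L by (auto simp: D_def gr_tangent_def perp_oplane blinfun.diff_left ip_simps)
    have "gr_metric G (oplane v) D D = gr_metric G (oplane v) M D - gr_metric G (oplane v) (hom3 v n) D"
      by (simp add: gr_metric_oplane[OF v] D_def blinfun.diff_left ip_simps sum_subtractf)
    then have "D = 0"
      using eq[OF D] gr_metric_pos[OF v D] by simp
    then show "M = hom3 v n"
      by (simp add: D_def)
  qed
  then show ?thesis
    by (simp add: n_def)
qed

end

section \<open>Maps between manifolds in preferred charts\<close>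

lemma frechet_derivative_eventually_eq:
  assumes "f differentiable (at x)" "\<forall>\<^sub>F y in nhds x. f y = g y"
  shows "g differentiable (at x)" "frechet_derivative g (at x) = frechet_derivative f (at x)"
proof -
  obtain X where X: "open X" "x \<in> X" "\<And>y. y \<in> X \<Longrightarrow> f y = g y"
    using assms(2) by (auto simp: eventually_nhds)
  have "(f has_derivative frechet_derivative f (at x)) (at x)"
    using assms(1) by (simp add: frechet_derivative_works)
  then have g: "(g has_derivative frechet_derivative f (at x)) (at x)"
    using X by (rule has_derivative_transform_within_open)
  then show "g differentiable (at x)" "frechet_derivative g (at x) = frechet_derivative f (at x)"
    using frechet_derivative_at[OF g] by (auto simp: differentiable_def)
qed

definition chart_pt :: "('m, 'e) manifold \<Rightarrow> 'm \<Rightarrow> 'e" where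
  "chart_pt M p = snd (chart_at M p) p"

definition chart_rep :: "('m, 'e) manifold \<Rightarrow> ('n, 'f) manifold \<Rightarrow> ('m \<Rightarrow> 'n) \<Rightarrow> 'm \<Rightarrow> 'e \<Rightarrow> 'f" where
  "chart_rep M N f p = snd (chart_at N (f p)) \<circ> f \<circ> cinv (chart_at M p)"

lemma push_eq: "push M N f p = frechet_derivative (chart_rep M N f p) (at (chart_pt M p))"
  by (simp add: push_def chart_rep_def chart_pt_def)

text \<open>Continuity is part of the condition: a local representative through \<open>cinv\<close> says nothing about \<open>f\<close>
  near \<open>p\<close> unless \<open>f\<close> maps a neighbourhood of \<open>p\<close> into the chart at \<open>f p\<close>.\<close>

definition diff_pt ::
  "('m::t2_space, 'e::euclidean_space) manifold \<Rightarrow>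
   ('n::t2_space, 'f::euclidean_space) manifold \<Rightarrow> ('m \<Rightarrow> 'n) \<Rightarrow> 'm \<Rightarrow> bool" where
  "diff_pt M N f p \<longleftrightarrow> isCont f p \<and> chart_rep M N f p differentiable (at (chart_pt M p))"

lemma cinv_left:
  assumes "smooth_manifold M" "c \<in> atlas M" "p \<in> fst c"
  shows "cinv c (snd c p) = p"
proof -
  have "homeomorphism (fst c) (snd c ` fst c) (snd c) (cinv c)"
    using assms by (auto simp: smooth_manifold_def)
  then show ?thesis
    using assms(3) by (simp add: homeomorphism_def)
qed

lemma chart_nhds:
  assumes M: "smooth_manifold M" and c: "c \<in> atlas M" "p \<in> fst c"
  shows "\<forall>\<^sub>F y in nhds (snd c p). cinv c y \<in> fst c \<and> snd c (cinv c y) = y"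
    and "isCont (cinv c) (snd c p)"
    and "isCont (snd c) p"
    and "\<forall>\<^sub>F q in nhds p. q \<in> fst c"
proof -
  have h: "homeomorphism (fst c) (snd c ` fst c) (snd c) (cinv c)"
    and o: "open (fst c)" "open (snd c ` fst c)"
    using assms by (auto simp: smooth_manifold_def)
  have "\<forall>\<^sub>F y in nhds (snd c p). y \<in> snd c ` fst c"
    using o c by (intro eventually_nhds_in_open) auto
  then show "\<forall>\<^sub>F y in nhds (snd c p). cinv c y \<in> fst c \<and> snd c (cinv c y) = y"
    by eventually_elim (use h in \<open>auto simp: homeomorphism_def\<close>)
  show "isCont (cinv c) (snd c p)"
    using h o c by (auto simp: homeomorphism_def continuous_on_eq_continuous_at)
  show "isCont (snd c) p"
    using h o c by (auto simp: homeomorphism_def continuous_on_eq_continuous_at)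
  show "\<forall>\<^sub>F q in nhds p. q \<in> fst c"
    using o c by (intro eventually_nhds_in_open) auto
qed

lemma chart_at_atlas:
  "smooth_manifold M \<Longrightarrow> chart_at M p \<in> atlas M" "smooth_manifold M \<Longrightarrow> p \<in> fst (chart_at M p)"
  by (auto simp: smooth_manifold_def)

lemma chart_at_nhds:
  assumes M: "smooth_manifold M"
  shows "\<forall>\<^sub>F y in nhds (chart_pt M p). cinv (chart_at M p) y \<in> fst (chart_at M p) \<and>
      snd (chart_at M p) (cinv (chart_at M p) y) = y"
    and "isCont (cinv (chart_at M p)) (chart_pt M p)"
    and "isCont (snd (chart_at M p)) p"
    and "\<forall>\<^sub>F q in nhds p. q \<in> fst (chart_at M p)"
    and "cinv (chart_at M p) (chart_pt M p) = p"
  unfolding chart_pt_def using chart_nhds[OF M chart_at_atlas[OF M]] cinv_left[OF M chart_at_atlas[OF M]]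
  by blast+

lemma eventually_cinv:
  assumes M: "smooth_manifold M" and P: "\<forall>\<^sub>F q in nhds p. P q"
  shows "\<forall>\<^sub>F y in nhds (chart_pt M p). P (cinv (chart_at M p) y)"
proof -
  have "filterlim (cinv (chart_at M p)) (nhds (cinv (chart_at M p) (chart_pt M p))) (nhds (chart_pt M p))"
    using chart_at_nhds(2)[OF M, of p] by (simp only: isCont_def tendsto_at_iff_tendsto_nhds)
  then have "filterlim (cinv (chart_at M p)) (nhds p) (nhds (chart_pt M p))"
    by (simp add: chart_at_nhds(5)[OF M])
  then show ?thesis
    using P by (rule eventually_compose_filterlim[rotated])
qed

lemma eventually_isCont:
  assumes "isCont f p" "\<forall>\<^sub>F q in nhds (f p). P q"
  shows "\<forall>\<^sub>F q in nhds p. P (f q)"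
  using assms unfolding isCont_def tendsto_at_iff_tendsto_nhds
  by (rule eventually_compose_filterlim[rotated])

lemma chart_rep_chart_pt:
  assumes M: "smooth_manifold M"
  shows "chart_rep M N f p (chart_pt M p) = chart_pt N (f p)"
  by (simp add: chart_rep_def chart_at_nhds[OF M]) (simp add: chart_pt_def)

lemma diff_pt_compose:
  assumes M: "smooth_manifold M" and N: "smooth_manifold N"
    and f: "diff_pt M N f p" and g: "diff_pt N P g (f p)"
  shows "diff_pt M P (\<lambda>q. g (f q)) p"
    and "push M P (\<lambda>q. g (f q)) p u = push N P g (f p) (push M N f p u)"
proof -
  let ?f = "chart_rep M N f p" and ?g = "chart_rep N P g (f p)"
  have "\<forall>\<^sub>F q in nhds p. f q \<in> fst (chart_at N (f p))"
    using f chart_at_nhds(4)[OF N]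
    by (intro eventually_isCont[where f = f and P = "\<lambda>r. r \<in> fst (chart_at N (f p))"])
      (auto simp: diff_pt_def)
  then have "\<forall>\<^sub>F y in nhds (chart_pt M p). f (cinv (chart_at M p) y) \<in> fst (chart_at N (f p))"
    by (rule eventually_cinv[OF M])
  then have ev: "\<forall>\<^sub>F y in nhds (chart_pt M p). (?g \<circ> ?f) y = chart_rep M P (\<lambda>q. g (f q)) p y"
    by eventually_elim (simp add: chart_rep_def cinv_left[OF N chart_at_atlas(1)[OF N]])
  have df: "?f differentiable (at (chart_pt M p))" and dg: "?g differentiable (at (?f (chart_pt M p)))"
    using f g by (auto simp: diff_pt_def chart_rep_chart_pt[OF M])
  have gf: "(?g \<circ> ?f) differentiable (at (chart_pt M p))"
    using df dg by (rule differentiable_chain_at)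
  show "diff_pt M P (\<lambda>q. g (f q)) p"
    unfolding diff_pt_def
    using f g frechet_derivative_eventually_eq(1)[OF gf ev] by (auto simp: diff_pt_def intro: isCont_o2)
  show "push M P (\<lambda>q. g (f q)) p u = push N P g (f p) (push M N f p u)"
    unfolding push_eq frechet_derivative_eventually_eq(2)[OF gf ev]
    using frechet_derivative_compose[OF df dg] by (simp add: chart_rep_chart_pt[OF M])
qed

lemma linear_push: "diff_pt M N f p \<Longrightarrow> linear (push M N f p)"
  unfolding push_eq by (auto simp: diff_pt_def intro: linear_frechet_derivative)

lemma push_id:
  assumes M: "smooth_manifold M"
  shows "push M M (\<lambda>q. q) p u = u"
proof -
  have "\<forall>\<^sub>F y in nhds (chart_pt M p). y = chart_rep M M (\<lambda>q. q) p y"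
    using chart_at_nhds(1)[OF M, of p] by eventually_elim (simp add: chart_rep_def)
  from frechet_derivative_eventually_eq(2)[OF differentiable_ident this]
  show ?thesis
    by (simp add: push_eq)
qed

lemma Ck_on_cong:
  assumes "open S" "\<And>x. x \<in> S \<Longrightarrow> f x = g x" "Ck_on k S f"
  shows "Ck_on k S g"
  using assms(2,3)
proof (induction k arbitrary: f g)
  case 0
  then show ?case
    by (simp cong: continuous_on_cong)
next
  case (Suc k)
  have ev: "\<forall>\<^sub>F y in nhds x. f y = g y" if "x \<in> S" for x
    using \<open>open S\<close> that Suc.prems(1) by (auto simp: eventually_nhds)
  have g: "g differentiable (at x)" "frechet_derivative f (at x) v = frechet_derivative g (at x) v"
    if "x \<in> S" for x v
    using Suc.prems(2) that frechet_derivative_eventually_eq[OF _ ev[OF that]] by simp_all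
  moreover have "Ck_on k S (\<lambda>x. frechet_derivative g (at x) v)" for v
  proof (rule Suc.IH)
    show "Ck_on k S (\<lambda>x. frechet_derivative f (at x) v)"
      using Suc.prems(2) by simp
  qed (rule g(2))
  ultimately show ?case
    by auto
qed

lemma smooth_on_cong:
  "open S \<Longrightarrow> (\<And>x. x \<in> S \<Longrightarrow> f x = g x) \<Longrightarrow> smooth_on S f \<Longrightarrow> smooth_on S g"
  unfolding smooth_on_def using Ck_on_cong by blast

lemma smooth_on_differentiable: "smooth_on S f \<Longrightarrow> x \<in> S \<Longrightarrow> f differentiable (at x)"
  by (metis Ck_on.simps(2) smooth_on_def)

lemma smooth_on_frechet: "smooth_on S f \<Longrightarrow> smooth_on S (\<lambda>x. frechet_derivative f (at x) v)"
  unfolding smooth_on_def by (metis Ck_on.simps(2))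

lemma smooth_map_diff_pt:
  assumes M: "smooth_manifold M" and N: "smooth_manifold N" and f: "smooth_map M N f"
  shows "diff_pt M N f p"
proof -
  let ?c = "chart_at M p" and ?d = "chart_at N (f p)"
  have "smooth_on (snd ?c ` (fst ?c \<inter> f -` fst ?d)) (snd ?d \<circ> f \<circ> cinv ?c)"
    using f chart_at_atlas[OF M] chart_at_atlas[OF N] by (auto simp: smooth_map_def)
  moreover have "chart_pt M p \<in> snd ?c ` (fst ?c \<inter> f -` fst ?d)"
    using chart_at_atlas[OF M] chart_at_atlas[OF N] by (auto simp: chart_pt_def)
  ultimately have "chart_rep M N f p differentiable (at (chart_pt M p))"
    unfolding chart_rep_def by (rule smooth_on_differentiable)
  moreover have "isCont f p"
    using f by (auto simp: smooth_map_def continuous_on_eq_continuous_at)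
  ultimately show ?thesis
    by (simp add: diff_pt_def)
qed

lemma cinv_prod:
  assumes M: "smooth_manifold M" and N: "smooth_manifold N"
    and c: "c \<in> atlas M" "p \<in> fst c" and d: "d \<in> atlas N" "q \<in> fst d"
  shows "cinv (fst c \<times> fst d, map_prod (snd c) (snd d)) (snd c p, snd d q) = (p, q)"
proof -
  have "inj_on (map_prod (snd c) (snd d)) (fst c \<times> fst d)"
    using cinv_left[OF M c(1)] cinv_left[OF N d(1)] by (intro map_prod_inj_on) (metis inj_onI)+
  then show ?thesis
    unfolding cinv_def using c d by (intro inv_into_f_eq) auto
qed

text \<open>A smooth map of two variables in arbitrary charts, as a function of a pair of
  coordinates on an explicit open domain.\<close>

lemma smooth_map_prod_chart:
  assumes M: "smooth_manifold M" and N: "smooth_manifold N"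
    and f: "smooth_map (prod_manifold M N) P f"
    and c: "c \<in> atlas M" and d: "d \<in> atlas N" and h: "h \<in> atlas P" "open (fst h)"
  defines "S \<equiv> (\<lambda>(p, q). (snd c p, snd d q)) ` {(p, q). p \<in> fst c \<and> q \<in> fst d \<and> f (p, q) \<in> fst h}"
  shows "open S" and "smooth_on S (\<lambda>(y, z). snd h (f (cinv c y, cinv d z)))"
proof -
  define k where "k = (fst c \<times> fst d, map_prod (snd c) (snd d))"
  have hc: "homeomorphism (fst c) (snd c ` fst c) (snd c) (cinv c)" "open (snd c ` fst c)"
    and hd: "homeomorphism (fst d) (snd d ` fst d) (snd d) (cinv d)" "open (snd d ` fst d)"
    using M N c d by (auto simp: smooth_manifold_def)
  have S: "S = (snd c ` fst c \<times> snd d ` fst d) \<inter> (\<lambda>y. f (cinv c (fst y), cinv d (snd y))) -` fst h"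
    using cinv_left[OF M c] cinv_left[OF N d] by (force simp: S_def)
  have "continuous_on (snd c ` fst c \<times> snd d ` fst d) (\<lambda>y. f (cinv c (fst y), cinv d (snd y)))"
  proof (rule continuous_on_compose2[of UNIV f])
    show "continuous_on UNIV f"
      using f by (simp add: smooth_map_def)
    show "continuous_on (snd c ` fst c \<times> snd d ` fst d) (\<lambda>x. (cinv c (fst x), cinv d (snd x)))"
      using hc(1) hd(1) unfolding homeomorphism_def
      by (intro continuous_on_Pair continuous_on_compose2[of _ "cinv c" _ fst]
          continuous_on_compose2[of _ "cinv d" _ snd] continuous_on_fst continuous_on_snd continuous_on_id)
        auto
  qed auto
  then show "open S"
    unfolding S using hc(2) hd(2) h(2) by (intro continuous_open_preimage open_Times)
  have "k \<in> atlas (prod_manifold M N)"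
    unfolding prod_manifold_def manifold.select_convs k_def
    by (rule CollectI, rule exI[of _ c], rule exI[of _ d]) (simp add: c d)
  then have "smooth_on (snd k ` (fst k \<inter> f -` fst h)) (snd h \<circ> f \<circ> cinv k)"
    using f h(1) unfolding smooth_map_def by blast
  moreover have "snd k ` (fst k \<inter> f -` fst h) = S"
    by (force simp: k_def S_def)
  moreover have "(snd h \<circ> f \<circ> cinv k) y = (\<lambda>(y, z). snd h (f (cinv c y, cinv d z))) y" if "y \<in> S" for y
    using that cinv_prod[OF M N c _ d] cinv_left[OF M c] cinv_left[OF N d]
    by (auto simp: S_def k_def)
  ultimately show "smooth_on S (\<lambda>(y, z). snd h (f (cinv c y, cinv d z)))"
    using smooth_on_cong[OF \<open>open S\<close>, of "snd h \<circ> f \<circ> cinv k"] by simp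
qed

lemma smooth_map_slices:
  assumes M: "smooth_manifold M" and N: "smooth_manifold N" and P: "smooth_manifold P"
    and f: "smooth_map (prod_manifold M N) P f"
  shows "diff_pt M P (\<lambda>p. f (p, q)) p" "diff_pt N P (\<lambda>q. f (p, q)) q"
proof -
  let ?c = "chart_at M p" and ?d = "chart_at N q" and ?h = "chart_at P (f (p, q))"
  define S where "S = (\<lambda>(p, q). (snd ?c p, snd ?d q)) ` {(p, q). p \<in> fst ?c \<and> q \<in> fst ?d \<and> f (p, q) \<in> fst ?h}"
  define F where "F = (\<lambda>(y, z). snd ?h (f (cinv ?c y, cinv ?d z)))"
  have "open (fst ?h)"
    using P by (auto simp: smooth_manifold_def)
  then have "smooth_on S F"
    unfolding S_def F_def using chart_at_atlas[OF M] chart_at_atlas[OF N] chart_at_atlas[OF P]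
    by (intro smooth_map_prod_chart[OF M N f])
  moreover have "(chart_pt M p, chart_pt N q) \<in> S"
    using chart_at_atlas[OF M] chart_at_atlas[OF N] chart_at_atlas[OF P] by (force simp: S_def chart_pt_def)
  ultimately have F: "F differentiable (at (chart_pt M p, chart_pt N q))"
    by (rule smooth_on_differentiable)
  have "(\<lambda>y. F (y, chart_pt N q)) differentiable (at (chart_pt M p))"
    using differentiable_chain_at[of "\<lambda>y. (y, chart_pt N q)" "chart_pt M p" F] F by (simp add: o_def)
  moreover have "(\<lambda>y. F (y, chart_pt N q)) = chart_rep M P (\<lambda>p. f (p, q)) p"
    by (simp add: F_def chart_rep_def fun_eq_iff chart_at_nhds[OF N])
  moreover have "(\<lambda>z. F (chart_pt M p, z)) differentiable (at (chart_pt N q))"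
    using differentiable_chain_at[of "\<lambda>z. (chart_pt M p, z)" "chart_pt N q" F] F by (simp add: o_def)
  moreover have "(\<lambda>z. F (chart_pt M p, z)) = chart_rep N P (\<lambda>q. f (p, q)) q"
    by (simp add: F_def chart_rep_def fun_eq_iff chart_at_nhds[OF M])
  moreover have "isCont f (p, q)"
    using f by (simp add: smooth_map_def continuous_on_eq_continuous_at)
  then have "isCont (\<lambda>p. f (p, q)) p" "isCont (\<lambda>q. f (p, q)) q"
    using isCont_o2[where f = "\<lambda>p. (p, q)" and g = f and a = p]
      isCont_o2[where f = "\<lambda>q. (p, q)" and g = f and a = q]
    by (simp_all add: continuous_Pair)
  ultimately show "diff_pt M P (\<lambda>p. f (p, q)) p" "diff_pt N P (\<lambda>q. f (p, q)) q"
    by (auto simp: diff_pt_def)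
qed

section \<open>Symmetry of second derivatives\<close>

lemma smooth_on_has_derivative:
  "smooth_on S f \<Longrightarrow> x \<in> S \<Longrightarrow> (f has_derivative frechet_derivative f (at x)) (at x)"
  using smooth_on_differentiable frechet_derivative_works by blast

lemma DERIV_along_line:
  fixes f :: "'a::real_normed_vector \<Rightarrow> 'b::real_inner"
  assumes "smooth_on S f" "q + s *\<^sub>R u \<in> S"
  shows "((\<lambda>s. f (q + s *\<^sub>R u) \<bullet> b) has_real_derivative
    frechet_derivative f (at (q + s *\<^sub>R u)) u \<bullet> b) (at s)"
proof -
  have lin: "linear (frechet_derivative f (at (q + s *\<^sub>R u)))"
    using assms smooth_on_differentiable linear_frechet_derivative by blast
  have "((\<lambda>s. f (q + s *\<^sub>R u)) has_derivative (\<lambda>r. frechet_derivative f (at (q + s *\<^sub>R u)) (r *\<^sub>R u))) (at s)"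
    by (rule has_derivative_compose[where f = "\<lambda>s. q + s *\<^sub>R u" and g = f and x = s and s = UNIV,
          OF _ smooth_on_has_derivative[OF assms]])
      (auto intro!: derivative_eq_intros)
  then have "((\<lambda>s. f (q + s *\<^sub>R u) \<bullet> b) has_derivative
      (\<lambda>r. frechet_derivative f (at (q + s *\<^sub>R u)) (r *\<^sub>R u) \<bullet> b)) (at s)"
    by (rule has_derivative_inner_left)
  then show ?thesis
    by (simp add: has_field_derivative_def linear_scale[OF lin] mult.commute[of _ "_ \<bullet> b"])
qed

text \<open>The mean value theorem, applied to \<open>s \<mapsto> f (p + s u + h w) - f (p + s u)\<close> and then in the
  direction of \<open>w\<close>.\<close>

lemma mixed_difference:
  fixes f :: "'a::real_normed_vector \<Rightarrow> 'b::real_inner"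
  assumes f: "smooth_on S f" and h: "h > 0"
    and S: "\<And>s t. 0 \<le> s \<Longrightarrow> s \<le> h \<Longrightarrow> 0 \<le> t \<Longrightarrow> t \<le> h \<Longrightarrow> p + s *\<^sub>R u + t *\<^sub>R w \<in> S"
  obtains s t where "0 \<le> s" "s \<le> h" "0 \<le> t" "t \<le> h"
    "(f (p + h *\<^sub>R u + h *\<^sub>R w) - f (p + h *\<^sub>R u) - f (p + h *\<^sub>R w) + f p) \<bullet> b =
      h * h * (frechet_derivative (\<lambda>x. frechet_derivative f (at x) u) (at (p + s *\<^sub>R u + t *\<^sub>R w)) w \<bullet> b)"
proof -
  let ?D = "\<lambda>x. frechet_derivative f (at x) u"
  define F where "F s = f (p + s *\<^sub>R u + h *\<^sub>R w) \<bullet> b - f (p + s *\<^sub>R u) \<bullet> b" for s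
  have "(F has_real_derivative ?D (p + s *\<^sub>R u + h *\<^sub>R w) \<bullet> b - ?D (p + s *\<^sub>R u) \<bullet> b) (at s)"
    if "0 \<le> s" "s \<le> h" for s
    using DERIV_diff[OF DERIV_along_line[OF f, of "p + h *\<^sub>R w" s u b] DERIV_along_line[OF f, of p s u b]]
      S[of s h] S[of s 0] that h
    unfolding F_def by (simp add: add_ac)
  from MVT2[OF h this] obtain s where s: "0 < s" "s < h"
    "F h - F 0 = (h - 0) * (?D (p + s *\<^sub>R u + h *\<^sub>R w) \<bullet> b - ?D (p + s *\<^sub>R u) \<bullet> b)"
    by auto
  have "((\<lambda>t. ?D (p + s *\<^sub>R u + t *\<^sub>R w) \<bullet> b) has_real_derivative
      frechet_derivative ?D (at (p + s *\<^sub>R u + t *\<^sub>R w)) w \<bullet> b) (at t)"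
    if "0 \<le> t" "t \<le> h" for t
    using that s S[of s t] by (intro DERIV_along_line[OF smooth_on_frechet[OF f]]) auto
  from MVT2[OF h this] obtain t where t: "0 < t" "t < h"
    "?D (p + s *\<^sub>R u + h *\<^sub>R w) \<bullet> b - ?D (p + s *\<^sub>R u + 0 *\<^sub>R w) \<bullet> b =
      (h - 0) * (frechet_derivative ?D (at (p + s *\<^sub>R u + t *\<^sub>R w)) w \<bullet> b)"
    by auto
  have "F h - F 0 = h * h * (frechet_derivative ?D (at (p + s *\<^sub>R u + t *\<^sub>R w)) w \<bullet> b)"
    using s(3) t(3) by simp
  moreover have "F h - F 0 = (f (p + h *\<^sub>R u + h *\<^sub>R w) - f (p + h *\<^sub>R u) - f (p + h *\<^sub>R w) + f p) \<bullet> b"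
    by (simp add: F_def inner_diff_left inner_add_left)
  ultimately show thesis
    using that[of s t] s(1,2) t(1,2) by simp
qed

lemma smooth_on_isCont: "smooth_on S f \<Longrightarrow> x \<in> S \<Longrightarrow> isCont f x"
  by (metis differentiable_imp_continuous_within smooth_on_differentiable)

text \<open>The mixed difference is symmetric in \<open>u\<close> and \<open>w\<close>, and by continuity it determines either iterated
  derivative at \<open>p\<close>.\<close>

lemma second_derivative_symmetric:
  fixes f :: "'a::real_normed_vector \<Rightarrow> 'b::real_inner"
  assumes S: "open S" "p \<in> S" and f: "smooth_on S f"
  shows "frechet_derivative (\<lambda>x. frechet_derivative f (at x) u) (at p) w =
    frechet_derivative (\<lambda>x. frechet_derivative f (at x) w) (at p) u"
proof (rule vector_eq_ldot[THEN iffD1], rule allI)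
  fix b
  define D where "D u w x = b \<bullet> frechet_derivative (\<lambda>x. frechet_derivative f (at x) u) (at x) w" for u w x
  have cont: "isCont (D u w) p" for u w
    unfolding D_def
    by (intro continuous_intros smooth_on_isCont[OF _ S(2)] smooth_on_frechet f)
  have bound: "\<bar>D u w p - D w u p\<bar> \<le> e + e" if "e > 0" for e
  proof -
    have "\<forall>\<^sub>F x in nhds p. dist (D u w x) (D u w p) < e \<and> dist (D w u x) (D w u p) < e \<and> x \<in> S"
      using cont[of u w] cont[of w u] S that
      by (intro eventually_conj tendstoD eventually_nhds_in_open)
        (auto simp: isCont_def tendsto_at_iff_tendsto_nhds)
    then obtain d where d: "d > 0" "\<And>x. dist x p < d \<Longrightarrow>
        dist (D u w x) (D u w p) < e \<and> dist (D w u x) (D w u p) < e \<and> x \<in> S"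
      unfolding eventually_nhds_metric by blast
    define n where "n = norm u + norm w + 1"
    have n: "n > 0"
      by (simp add: n_def add_nonneg_pos)
    define h where "h = d / (2 * n)"
    have h: "h > 0"
      using d n by (simp add: h_def)
    have hd: "h * n < d"
      using d n by (simp add: h_def)
    have near: "dist (p + s *\<^sub>R u + t *\<^sub>R w) p < d" if "0 \<le> s" "s \<le> h" "0 \<le> t" "t \<le> h" for s t
    proof -
      have "dist (p + s *\<^sub>R u + t *\<^sub>R w) p = norm (s *\<^sub>R u + t *\<^sub>R w)"
        by (simp add: dist_norm algebra_simps)
      also have "\<dots> \<le> s * norm u + t * norm w"
        using norm_triangle_ineq[of "s *\<^sub>R u" "t *\<^sub>R w"] that by simp
      also have "\<dots> \<le> h * norm u + h * norm w"
        using that by (intro add_mono mult_right_mono) auto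
      also have "\<dots> < d"
        using hd h by (simp add: n_def algebra_simps)
      finally show ?thesis .
    qed
    obtain s t where st: "0 \<le> s" "s \<le> h" "0 \<le> t" "t \<le> h"
      "(f (p + h *\<^sub>R u + h *\<^sub>R w) - f (p + h *\<^sub>R u) - f (p + h *\<^sub>R w) + f p) \<bullet> b =
        h * h * D u w (p + s *\<^sub>R u + t *\<^sub>R w)"
      using mixed_difference[OF f h, of p u w b] near d(2) unfolding D_def inner_commute[of b] by metis
    obtain s' t' where st': "0 \<le> s'" "s' \<le> h" "0 \<le> t'" "t' \<le> h"
      "(f (p + h *\<^sub>R w + h *\<^sub>R u) - f (p + h *\<^sub>R w) - f (p + h *\<^sub>R u) + f p) \<bullet> b =
        h * h * D w u (p + s' *\<^sub>R w + t' *\<^sub>R u)"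
    proof (rule mixed_difference[OF f h, of p w u b])
      show "p + s *\<^sub>R w + t *\<^sub>R u \<in> S" if "0 \<le> s" "s \<le> h" "0 \<le> t" "t \<le> h" for s t
        using near[of t s] d(2)[of "p + t *\<^sub>R u + s *\<^sub>R w"] that by (simp add: add_ac)
    qed (auto simp: D_def inner_commute[of b])
    have comm: "f (p + h *\<^sub>R w + h *\<^sub>R u) - f (p + h *\<^sub>R w) - f (p + h *\<^sub>R u) + f p =
        f (p + h *\<^sub>R u + h *\<^sub>R w) - f (p + h *\<^sub>R u) - f (p + h *\<^sub>R w) + f p"
      by (simp add: add_ac)
    have "h * h * D u w (p + s *\<^sub>R u + t *\<^sub>R w) = h * h * D w u (p + s' *\<^sub>R w + t' *\<^sub>R u)"
      unfolding st(5)[symmetric] st'(5)[symmetric] comm ..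
    then have eq: "D u w (p + s *\<^sub>R u + t *\<^sub>R w) = D w u (p + s' *\<^sub>R w + t' *\<^sub>R u)"
      using h by simp
    have "dist (D u w (p + s *\<^sub>R u + t *\<^sub>R w)) (D u w p) < e"
      using d(2)[OF near[OF st(1-4)]] by simp
    moreover have "dist (D w u (p + s' *\<^sub>R w + t' *\<^sub>R u)) (D w u p) < e"
      using d(2)[of "p + s' *\<^sub>R w + t' *\<^sub>R u"] near[of t' s'] st' by (simp add: add_ac)
    ultimately show ?thesis
      using eq by (simp add: dist_real_def)
  qed
  have "\<bar>D u w p - D w u p\<bar> \<le> 0"
  proof (rule field_le_epsilon)
    show "\<bar>D u w p - D w u p\<bar> \<le> 0 + r" if "r > 0" for r
      using bound[of "r / 2"] that by simp
  qed
  then show "b \<bullet> frechet_derivative (\<lambda>x. frechet_derivative f (at x) u) (at p) w =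
      b \<bullet> frechet_derivative (\<lambda>x. frechet_derivative f (at x) w) (at p) u"
    by (simp add: D_def)
qed

section \<open>The adjoint representation, the bracket and the Killing form\<close>

lemma linear_sum_Basis:
  fixes L :: "'a::euclidean_space \<Rightarrow> 'b::real_vector"
  assumes "linear L"
  shows "L w = (\<Sum>b\<in>Basis. (w \<bullet> b) *\<^sub>R L b)"
proof -
  have "L w = L (\<Sum>b\<in>Basis. (w \<bullet> b) *\<^sub>R b)"
    by (simp add: euclidean_representation)
  then show ?thesis
    by (simp add: linear_sum[OF assms] linear_scale[OF assms])
qed

text \<open>Product rule for a family of linear maps applied to a moving vector. The family is only assumed
  to be differentiable at each fixed vector, which is the form in which smoothness provides derivatives.\<close>

lemma linear_family_has_derivative:
  fixes L :: "'a::real_normed_vector \<Rightarrow> 'b::euclidean_space \<Rightarrow> 'c::real_normed_vector"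
  assumes lin: "\<forall>\<^sub>F y in nhds x. linear (L y)"
    and L: "\<And>w. ((\<lambda>y. L y w) has_derivative L' w) (at x)"
    and g: "(g has_derivative g') (at x)"
  shows "((\<lambda>y. L y (g y)) has_derivative (\<lambda>u. L x (g' u) + L' (g x) u)) (at x)"
proof -
  have linx: "linear (L x)"
    using lin by (rule eventually_nhds_x_imp_x)
  have "((\<lambda>y. \<Sum>b\<in>Basis. (g y \<bullet> b) *\<^sub>R L y b) has_derivative
      (\<lambda>u. \<Sum>b\<in>Basis. (g x \<bullet> b) *\<^sub>R L' b u + (g' u \<bullet> b) *\<^sub>R L x b)) (at x)"
    by (intro has_derivative_sum has_derivative_scaleR has_derivative_inner_left g L)
  moreover have "\<forall>\<^sub>F y in nhds x. (\<Sum>b\<in>Basis. (g y \<bullet> b) *\<^sub>R L y b) = L y (g y)"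
    using lin by eventually_elim (simp add: linear_sum_Basis[symmetric])
  ultimately have *: "((\<lambda>y. L y (g y)) has_derivative
      (\<lambda>u. \<Sum>b\<in>Basis. (g x \<bullet> b) *\<^sub>R L' b u + (g' u \<bullet> b) *\<^sub>R L x b)) (at x)"
    by (auto intro: has_derivative_transform_eventually simp: eventually_nhds_conv_at)
  have L'w: "L' w u = (\<Sum>b\<in>Basis. (w \<bullet> b) *\<^sub>R L' b u)" for w u
  proof -
    have "((\<lambda>y. \<Sum>b\<in>Basis. (w \<bullet> b) *\<^sub>R L y b) has_derivative
        (\<lambda>u. \<Sum>b\<in>Basis. (w \<bullet> b) *\<^sub>R L' b u)) (at x)"
      by (intro has_derivative_sum has_derivative_scaleR_right L)
    moreover have "\<forall>\<^sub>F y in nhds x. (\<Sum>b\<in>Basis. (w \<bullet> b) *\<^sub>R L y b) = L y w"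
      using lin by eventually_elim (simp add: linear_sum_Basis[symmetric])
    ultimately have "((\<lambda>y. L y w) has_derivative (\<lambda>u. \<Sum>b\<in>Basis. (w \<bullet> b) *\<^sub>R L' b u)) (at x)"
      by (auto intro: has_derivative_transform_eventually simp: eventually_nhds_conv_at)
    then show ?thesis
      using fun_cong[OF has_derivative_unique[OF L[of w]]] by blast
  qed
  show ?thesis
    using * unfolding sum.distrib L'w[of "g x", symmetric] linear_sum_Basis[OF linx, symmetric]
    by (simp add: add.commute)
qed

lemma endo_trace_comp:
  fixes f g :: "'k::euclidean_space \<Rightarrow> 'k"
  assumes "linear f" "linear g"
  shows "endo_trace (f \<circ> g) = endo_trace (g \<circ> f)"
proof -
  have "endo_trace (f \<circ> g) = (\<Sum>b\<in>Basis. \<Sum>c\<in>Basis. (g b \<bullet> c) * (f c \<bullet> b))"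
    if "linear f" for f g :: "'k \<Rightarrow> 'k"
    unfolding endo_trace_def o_def
    by (intro sum.cong refl) (subst linear_sum_Basis[OF that], simp add: inner_sum_left)
  then show ?thesis
    using assms by (simp add: mult.commute) (rule sum.swap)
qed

locale lie =
  fixes G :: "('g::{t2_space,second_countable_topology}, 'k::euclidean_space) lie_group"
  assumes lie: "compact_lie_group G"
begin

lemma grp: "group G" and carr: "carrier G = UNIV" and mfd: "smooth_manifold (mfd G)"
  and smooth_mult: "smooth_map (prod_manifold (mfd G) (mfd G)) (mfd G) (\<lambda>(g, h). g \<otimes>\<^bsub>G\<^esub> h)"
  and smooth_inv: "smooth_map (mfd G) (mfd G) (m_inv G)"
  using lie by (auto simp: compact_lie_group_def)

abbreviation one_G ("e") where "e \<equiv> \<one>\<^bsub>G\<^esub>"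
abbreviation mul (infixl "\<cdot>" 70) where "g \<cdot> h \<equiv> g \<otimes>\<^bsub>G\<^esub> h"
abbreviation "iv g \<equiv> inv\<^bsub>G\<^esub> g"

lemma group_simps [simp]:
  "e \<cdot> g = g" "g \<cdot> e = g" "iv g \<cdot> g = e" "g \<cdot> iv g = e" "iv (g \<cdot> h) = iv h \<cdot> iv g"
  "iv e = e" "iv (iv g) = g" "iv g \<cdot> (g \<cdot> h) = h" "g \<cdot> (iv g \<cdot> h) = h"
  using group.is_monoid[OF grp] grp carr
  by (simp_all add: monoid.l_one monoid.r_one group.l_inv group.r_inv group.inv_mult_group
      group.inv_inv monoid.inv_one group.inv_solve_left' flip: monoid.m_assoc)

lemma mult_assoc: "(g \<cdot> h) \<cdot> k = g \<cdot> (h \<cdot> k)"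
  using group.is_monoid[OF grp] carr by (simp add: monoid.m_assoc)

abbreviation "chart \<equiv> chart_at (mfd G) e"
abbreviation "E \<equiv> cinv chart"
abbreviation "o0 \<equiv> chart_pt (mfd G) e"

lemma E_o0 [simp]: "E o0 = e"
  by (rule chart_at_nhds(5)[OF mfd])

lemma snd_chart_e [simp]: "snd chart e = o0"
  by (simp add: chart_pt_def)

text \<open>Conjugation is a left translation followed by a right translation.\<close>

lemma diff_pt_conj: "diff_pt (mfd G) (mfd G) (\<lambda>h. g \<cdot> h \<cdot> iv g) h"
proof -
  have "diff_pt (mfd G) (mfd G) (\<lambda>h. g \<cdot> h) h"
    using smooth_map_slices(2)[OF mfd mfd mfd smooth_mult, of g h] by simp
  moreover have "diff_pt (mfd G) (mfd G) (\<lambda>k. k \<cdot> iv g) (g \<cdot> h)"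
    using smooth_map_slices(1)[OF mfd mfd mfd smooth_mult, of "iv g" "g \<cdot> h"] by simp
  ultimately show ?thesis
    by (rule diff_pt_compose(1)[OF mfd mfd])
qed

lemma linear_Ad: "linear (Ad G g)"
  unfolding Ad_def by (rule linear_push[OF diff_pt_conj])

lemma Ad_one: "Ad G e A = A"
  unfolding Ad_def by (simp add: push_id[OF mfd])

lemma Ad_mult: "Ad G (g \<cdot> h) A = Ad G g (Ad G h A)"
proof -
  have "push (mfd G) (mfd G) (\<lambda>q. g \<cdot> (h \<cdot> q \<cdot> iv h) \<cdot> iv g) e A =
      push (mfd G) (mfd G) (\<lambda>q. g \<cdot> q \<cdot> iv g) (h \<cdot> e \<cdot> iv h) (push (mfd G) (mfd G) (\<lambda>q. h \<cdot> q \<cdot> iv h) e A)"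
    by (rule diff_pt_compose(2)[OF mfd mfd diff_pt_conj diff_pt_conj])
  then show ?thesis
    by (simp add: Ad_def mult_assoc)
qed

text \<open>The group multiplication in the chart at the identity, and the open set on which it is smooth.\<close>

definition chart_mult :: "'k \<times> 'k \<Rightarrow> 'k" where
  "chart_mult = (\<lambda>(y, z). snd chart (E y \<cdot> E z))"

definition mult_dom :: "('k \<times> 'k) set" where
  "mult_dom = (\<lambda>(p, q). (snd chart p, snd chart q)) ` {(p, q). p \<in> fst chart \<and> q \<in> fst chart \<and> p \<cdot> q \<in> fst chart}"

lemma open_chart: "open (fst chart)"
  using mfd by (auto simp: smooth_manifold_def)

lemma open_mult_dom: "open mult_dom" and smooth_chart_mult: "smooth_on mult_dom chart_mult"
  unfolding mult_dom_def chart_mult_def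
  using smooth_map_prod_chart[OF mfd mfd smooth_mult chart_at_atlas(1)[OF mfd] chart_at_atlas(1)[OF mfd]
      chart_at_atlas(1)[OF mfd] open_chart] by auto

lemma E_chart [simp]: "p \<in> fst chart \<Longrightarrow> E (snd chart p) = p"
  by (rule cinv_left[OF mfd chart_at_atlas(1)[OF mfd]])

lemma e_chart [simp]: "e \<in> fst chart"
  by (rule chart_at_atlas(2)[OF mfd])

lemma mult_domI: "p \<in> fst chart \<Longrightarrow> q \<in> fst chart \<Longrightarrow> p \<cdot> q \<in> fst chart \<Longrightarrow> (snd chart p, snd chart q) \<in> mult_dom"
  by (force simp: mult_dom_def)

lemma chart_mult_eq: "p \<in> fst chart \<Longrightarrow> q \<in> fst chart \<Longrightarrow> chart_mult (snd chart p, snd chart q) = snd chart (p \<cdot> q)"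
  by (simp add: chart_mult_def)

lemma near_e: "\<forall>\<^sub>F y in nhds o0. E y \<in> fst chart \<and> snd chart (E y) = y \<and> iv (E y) \<in> fst chart"
proof -
  have "isCont (m_inv G) e"
    using smooth_inv by (auto simp: smooth_map_def continuous_on_eq_continuous_at)
  then have "\<forall>\<^sub>F p in nhds e. iv p \<in> fst chart"
    using open_chart eventually_isCont[where f = "m_inv G" and P = "\<lambda>p. p \<in> fst chart" and p = e]
    by (simp add: eventually_nhds_in_open)
  from eventually_cinv[OF mfd this] chart_at_nhds(1)[OF mfd, of e] show ?thesis
    by eventually_elim simp
qed

definition chart_inv :: "'k \<Rightarrow> 'k" where "chart_inv y = snd chart (iv (E y))"

lemma chart_inv_differentiable: "chart_inv differentiable (at o0)"
  using smooth_map_diff_pt[OF mfd mfd smooth_inv, of e]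
  by (simp add: diff_pt_def chart_rep_def chart_inv_def[abs_def] o_def)

lemma chart_inv_o0: "chart_inv o0 = o0"
  by (simp add: chart_inv_def)

abbreviation Dmult :: "'k \<times> 'k \<Rightarrow> 'k \<times> 'k \<Rightarrow> 'k" where
  "Dmult y \<equiv> frechet_derivative chart_mult (at y)"

lemma Dmult: "y \<in> mult_dom \<Longrightarrow> (chart_mult has_derivative Dmult y) (at y)"
  by (rule smooth_on_has_derivative[OF smooth_chart_mult])

lemma linear_Dmult: "y \<in> mult_dom \<Longrightarrow> linear (Dmult y)"
  using smooth_on_differentiable[OF smooth_chart_mult] linear_frechet_derivative by blast

text \<open>In the chart at the identity, conjugation by \<open>E y\<close> is \<open>c\<^sub>y(z) = (y z) y\<^sup>-\<^sup>1\<close>. The chain rule gives the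
  first identity, which shows that \<open>Ad\<close> is differentiable. The second one comes from
  \<open>c\<^sub>y(z) y = y z\<close>. It contains no inverse, so differentiating it in \<open>y\<close> gives the bracket in terms
  of second derivatives of the multiplication alone.\<close>

lemma Ad_chart:
  assumes y: "E y \<in> fst chart" "snd chart (E y) = y" "iv (E y) \<in> fst chart"
  shows "Ad G (E y) B = Dmult (y, chart_inv y) (Dmult (y, o0) (0, B), 0)"
    and "Dmult (o0, y) (Ad G (E y) B, 0) = Dmult (y, o0) (0, B)"
    and "(y, o0) \<in> mult_dom" "(o0, y) \<in> mult_dom" "(y, chart_inv y) \<in> mult_dom"
proof -
  show dom: "(y, o0) \<in> mult_dom" "(o0, y) \<in> mult_dom" "(y, chart_inv y) \<in> mult_dom"
    using mult_domI[of "E y" e] mult_domI[of e "E y"] mult_domI[of "E y" "iv (E y)"] y by (auto simp: chart_inv_def)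
  define F where "F = chart_rep (mfd G) (mfd G) (\<lambda>h. E y \<cdot> h \<cdot> iv (E y)) e"
  have F_eq: "F z = snd chart (E y \<cdot> E z \<cdot> iv (E y))" for z
    by (simp add: F_def chart_rep_def)
  have Fo: "F o0 = o0"
    by (simp add: F_eq)
  have F: "(F has_derivative Ad G (E y)) (at o0)"
    unfolding Ad_def push_eq F_def using diff_pt_conj[of "E y" e]
    by (simp add: diff_pt_def frechet_derivative_works[symmetric])
  have slice: "((\<lambda>z. chart_mult (y, z)) has_derivative (\<lambda>u. Dmult (y, o0) (0, u))) (at o0)"
    by (rule has_derivative_compose[where f = "\<lambda>z. (y, z)" and g = chart_mult and x = o0 and s = UNIV, OF _ Dmult[OF dom(1)]])
      (auto intro!: derivative_eq_intros)
  have mult_o0: "chart_mult (y, o0) = y"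
    using chart_mult_eq[of "E y" e] y by simp
  have cont: "isCont (\<lambda>h. E y \<cdot> h) e" "isCont (\<lambda>h. E y \<cdot> h \<cdot> iv (E y)) e"
    using smooth_map_slices(2)[OF mfd mfd mfd smooth_mult, of "E y" e] diff_pt_conj[of "E y" e]
    by (auto simp: diff_pt_def)
  have near: "\<forall>\<^sub>F z in nhds o0. E z \<in> fst chart \<and> snd chart (E z) = z \<and>
      E y \<cdot> E z \<in> fst chart \<and> E y \<cdot> E z \<cdot> iv (E y) \<in> fst chart"
  proof -
    have "\<forall>\<^sub>F h in nhds e. E y \<cdot> h \<in> fst chart"
      using eventually_isCont[OF cont(1), of "\<lambda>p. p \<in> fst chart"] y open_chart
      by (simp add: eventually_nhds_in_open)
    moreover have "\<forall>\<^sub>F h in nhds e. E y \<cdot> h \<cdot> iv (E y) \<in> fst chart"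
      using eventually_isCont[OF cont(2), of "\<lambda>p. p \<in> fst chart"] open_chart
      by (simp add: eventually_nhds_in_open)
    ultimately have "\<forall>\<^sub>F h in nhds e. E y \<cdot> h \<in> fst chart \<and> E y \<cdot> h \<cdot> iv (E y) \<in> fst chart"
      by (rule eventually_conj)
    from eventually_cinv[OF mfd this] near_e show ?thesis
      by eventually_elim simp
  qed
  have "((\<lambda>z. chart_mult (chart_mult (y, z), chart_inv y)) has_derivative (\<lambda>u. Dmult (y, chart_inv y) (Dmult (y, o0) (0, u), 0))) (at o0)"
    using has_derivative_compose[where f = "\<lambda>z. (chart_mult (y, z), chart_inv y)" and g = chart_mult and x = o0 and s = UNIV,
        OF has_derivative_Pair[OF slice has_derivative_const[of "chart_inv y"]]] Dmult[OF dom(3)]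
    by (simp add: mult_o0)
  moreover have "\<forall>\<^sub>F z in nhds o0. chart_mult (chart_mult (y, z), chart_inv y) = F z"
    using near
  proof eventually_elim
    case (elim z)
    then have "chart_mult (y, z) = snd chart (E y \<cdot> E z)"
      by (simp add: chart_mult_def)
    then show ?case
      using elim chart_mult_eq[of "E y \<cdot> E z" "iv (E y)"] y by (simp add: F_eq chart_inv_def)
  qed
  ultimately have "(F has_derivative (\<lambda>u. Dmult (y, chart_inv y) (Dmult (y, o0) (0, u), 0))) (at o0)"
    by (auto intro: has_derivative_transform_eventually simp: eventually_nhds_conv_at)
  from has_derivative_unique[OF F this] show "Ad G (E y) B = Dmult (y, chart_inv y) (Dmult (y, o0) (0, B), 0)"
    by simp
  have "((\<lambda>z. chart_mult (F z, y)) has_derivative (\<lambda>u. Dmult (o0, y) (Ad G (E y) u, 0))) (at o0)"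
    using has_derivative_compose[where f = "\<lambda>z. (F z, y)" and g = chart_mult and x = o0 and s = UNIV,
        OF has_derivative_Pair[OF F has_derivative_const[of y]]] Dmult[OF dom(2)]
    by (simp add: Fo)
  moreover have "\<forall>\<^sub>F z in nhds o0. chart_mult (F z, y) = chart_mult (y, z)"
    using near
  proof eventually_elim
    case (elim z)
    then have "chart_mult (F z, y) = snd chart (E y \<cdot> E z \<cdot> iv (E y) \<cdot> E y)"
      using chart_mult_eq[of "E y \<cdot> E z \<cdot> iv (E y)" "E y"] y by (simp add: F_eq)
    then show ?case
      by (simp add: mult_assoc chart_mult_def)
  qed
  ultimately have "((\<lambda>z. chart_mult (y, z)) has_derivative (\<lambda>u. Dmult (o0, y) (Ad G (E y) u, 0))) (at o0)"
    by (auto intro: has_derivative_transform_eventually simp: eventually_nhds_conv_at)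
  from fun_cong[OF has_derivative_unique[OF this slice], of B]
  show "Dmult (o0, y) (Ad G (E y) B, 0) = Dmult (y, o0) (0, B)" .
qed

lemma origin_mult_dom: "(o0, o0) \<in> mult_dom"
  using mult_domI[of e e] by simp

lemma Dmult_has_derivative:
  assumes g: "(g has_derivative g') (at o0)" and go: "g o0 = (o0, o0)"
  shows "((\<lambda>y. Dmult (g y) w) has_derivative
    (\<lambda>u. frechet_derivative (\<lambda>x. Dmult x w) (at (o0, o0)) (g' u))) (at o0)"
  using has_derivative_compose[OF g] smooth_on_has_derivative[OF smooth_on_frechet[OF smooth_chart_mult] origin_mult_dom, of w]
  by (simp add: go)

lemma Ad_differentiable: "(\<lambda>y. Ad G (E y) B) differentiable (at o0)"
proof -
  let ?r = "\<lambda>y. Dmult (y, o0) (0, B)"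
  let ?D = "\<lambda>w. frechet_derivative (\<lambda>x. Dmult x w) (at (o0, o0))"
  have r: "(?r has_derivative (\<lambda>u. ?D (0, B) (u, 0))) (at o0)"
    by (rule Dmult_has_derivative) (auto intro!: derivative_eq_intros)
  obtain chart_inv' where chart_inv': "(chart_inv has_derivative chart_inv') (at o0)"
    using chart_inv_differentiable by (auto simp: differentiable_def)
  have "((\<lambda>y. Dmult (y, chart_inv y) (?r y, 0)) has_derivative
    (\<lambda>u. Dmult (o0, chart_inv o0) (?D (0, B) (u, 0), 0) + ?D (?r o0, 0) (u, chart_inv' u))) (at o0)"
  proof (rule linear_family_has_derivative[where L = "\<lambda>y w. Dmult (y, chart_inv y) (w, 0)" and g = ?r])
    show "\<forall>\<^sub>F y in nhds o0. linear (\<lambda>w. Dmult (y, chart_inv y) (w, 0))"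
      using near_e
    proof eventually_elim
      case (elim y)
      then have "linear (Dmult (y, chart_inv y))"
        by (intro linear_Dmult Ad_chart) auto
      then have "linear (Dmult (y, chart_inv y) \<circ> (\<lambda>w. (w, 0)))"
        by (intro linear_compose) (auto intro!: linearI)
      then show ?case
        by (simp add: o_def)
    qed
    show "((\<lambda>y. Dmult (y, chart_inv y) (w, 0)) has_derivative (\<lambda>u. ?D (w, 0) (u, chart_inv' u))) (at o0)" for w
      by (rule Dmult_has_derivative) (auto intro!: derivative_eq_intros chart_inv' simp: chart_inv_o0)
  qed (rule r)
  moreover have "\<forall>\<^sub>F y in nhds o0. Dmult (y, chart_inv y) (?r y, 0) = Ad G (E y) B"
    using near_e by eventually_elim (simp add: Ad_chart(1))
  ultimately have "((\<lambda>y. Ad G (E y) B) has_derivative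
      (\<lambda>u. Dmult (o0, chart_inv o0) (?D (0, B) (u, 0), 0) + ?D (?r o0, 0) (u, chart_inv' u))) (at o0)"
    by (auto intro: has_derivative_transform_eventually simp: eventually_nhds_conv_at)
  then show ?thesis
    by (auto simp: differentiable_def)
qed

lemma bracket_eq: "bracket G A B = frechet_derivative (\<lambda>y. Ad G (E y) B) (at o0) A"
  by (simp add: bracket_def)

lemma Ad_has_derivative: "((\<lambda>y. Ad G (E y) B) has_derivative (\<lambda>A. bracket G A B)) (at o0)"
  using Ad_differentiable[of B] by (simp add: frechet_derivative_works bracket_eq)

lemma bilinear_bracket: "bilinear (bracket G)"
  unfolding bilinear_def
proof (intro conjI allI)
  show "linear (\<lambda>A. bracket G A B)" for B
    using has_derivative_linear[OF Ad_has_derivative] by blast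
  show "linear (bracket G A)" for A
  proof (rule linearI)
    fix B C and r :: real
    have "((\<lambda>y. Ad G (E y) (B + C)) has_derivative (\<lambda>A. bracket G A B + bracket G A C)) (at o0)"
      using has_derivative_add[OF Ad_has_derivative[of B] Ad_has_derivative[of C]]
      by (simp add: linear_add[OF linear_Ad])
    from fun_cong[OF has_derivative_unique[OF Ad_has_derivative this], of A]
    show "bracket G A (B + C) = bracket G A B + bracket G A C" .
    have "((\<lambda>y. Ad G (E y) (r *\<^sub>R B)) has_derivative (\<lambda>A. r *\<^sub>R bracket G A B)) (at o0)"
      using has_derivative_scaleR_right[OF Ad_has_derivative[of B], of r]
      by (simp add: linear_scale[OF linear_Ad])
    from fun_cong[OF has_derivative_unique[OF Ad_has_derivative this], of A]
    show "bracket G A (r *\<^sub>R B) = r *\<^sub>R bracket G A B" .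
  qed
qed

text \<open>Differentiate the second identity of \<open>Ad_chart\<close> in \<open>y\<close>. As multiplication by the identity is
  the identity map, this says that \<open>[A, B]\<close> is the mixed second derivative of the multiplication in
  \<open>(A, 0)\<close> and \<open>(0, B)\<close> minus the one in \<open>(0, A)\<close> and \<open>(B, 0)\<close>.\<close>

lemma bracket_self: "bracket G A A = 0"
proof -
  let ?D = "\<lambda>w. frechet_derivative (\<lambda>x. Dmult x w) (at (o0, o0))"
  have left: "Dmult (o0, o0) (w, 0) = w" for w
  proof -
    have "((\<lambda>y. chart_mult (y, o0)) has_derivative (\<lambda>u. Dmult (o0, o0) (u, 0))) (at o0)"
      by (rule has_derivative_compose[where f = "\<lambda>z. (z, o0)" and g = chart_mult and x = o0 and s = UNIV, OF _ Dmult[OF origin_mult_dom]])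
        (auto intro!: derivative_eq_intros)
    moreover have "\<forall>\<^sub>F y in nhds o0. chart_mult (y, o0) = y"
      using near_e by eventually_elim (simp add: chart_mult_def)
    ultimately have "((\<lambda>y. y) has_derivative (\<lambda>u. Dmult (o0, o0) (u, 0))) (at o0)"
      by (auto intro: has_derivative_transform_eventually simp: eventually_nhds_conv_at)
    from fun_cong[OF has_derivative_unique[OF this has_derivative_ident], of w] show ?thesis .
  qed
  have "((\<lambda>y. Dmult (o0, y) (Ad G (E y) A, 0)) has_derivative
    (\<lambda>u. Dmult (o0, o0) (bracket G u A, 0) + ?D (Ad G (E o0) A, 0) (0, u))) (at o0)"
  proof (rule linear_family_has_derivative[where L = "\<lambda>y w. Dmult (o0, y) (w, 0)"])
    show "\<forall>\<^sub>F y in nhds o0. linear (\<lambda>w. Dmult (o0, y) (w, 0))"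
      using near_e
    proof eventually_elim
      case (elim y)
      then have "linear (Dmult (o0, y))"
        by (intro linear_Dmult Ad_chart) auto
      then have "linear (Dmult (o0, y) \<circ> (\<lambda>w. (w, 0)))"
        by (intro linear_compose) (auto intro!: linearI)
      then show ?case
        by (simp add: o_def)
    qed
    show "((\<lambda>y. Dmult (o0, y) (w, 0)) has_derivative (\<lambda>u. ?D (w, 0) (0, u))) (at o0)" for w
      by (rule Dmult_has_derivative) (auto intro!: derivative_eq_intros)
  qed (rule Ad_has_derivative)
  moreover have "\<forall>\<^sub>F y in nhds o0. Dmult (o0, y) (Ad G (E y) A, 0) = Dmult (y, o0) (0, A)"
    using near_e by eventually_elim (simp add: Ad_chart(2))
  ultimately have "((\<lambda>y. Dmult (y, o0) (0, A)) has_derivative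
      (\<lambda>u. bracket G u A + ?D (A, 0) (0, u))) (at o0)"
    by (auto intro: has_derivative_transform_eventually simp: eventually_nhds_conv_at left Ad_one)
  moreover have "((\<lambda>y. Dmult (y, o0) (0, A)) has_derivative (\<lambda>u. ?D (0, A) (u, 0))) (at o0)"
    by (rule Dmult_has_derivative) (auto intro!: derivative_eq_intros)
  ultimately have "(\<lambda>u. bracket G u A + ?D (A, 0) (0, u)) = (\<lambda>u. ?D (0, A) (u, 0))"
    by (rule has_derivative_unique)
  then have "bracket G A A + ?D (A, 0) (0, A) = ?D (0, A) (A, 0)"
    by (rule fun_cong)
  then show ?thesis
    using second_derivative_symmetric[OF open_mult_dom origin_mult_dom smooth_chart_mult, of "(A, 0)" "(0, A)"] by simp
qed

text \<open>Differentiate \<open>Ad (g h g\<^sup>-\<^sup>1) = Ad g \<circ> Ad h \<circ> Ad g\<^sup>-\<^sup>1\<close> in \<open>h\<close> at the identity.\<close>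

lemma bracket_Ad: "bracket G (Ad G g A) B = Ad G g (bracket G A (Ad G (iv g) B))"
proof -
  define F where "F = chart_rep (mfd G) (mfd G) (\<lambda>h. g \<cdot> h \<cdot> iv g) e"
  have Fo: "F o0 = o0"
    by (simp add: F_def chart_rep_def)
  have F: "(F has_derivative Ad G g) (at o0)"
    unfolding Ad_def push_eq F_def using diff_pt_conj[of g e]
    by (simp add: diff_pt_def frechet_derivative_works[symmetric])
  have "((\<lambda>y. Ad G (E (F y)) B) has_derivative (\<lambda>u. bracket G (Ad G g u) B)) (at o0)"
    by (rule has_derivative_compose[OF F, where g = "\<lambda>y. Ad G (E y) B"])
      (simp add: Fo Ad_has_derivative)
  moreover have "\<forall>\<^sub>F y in nhds o0. Ad G (E (F y)) B = Ad G g (Ad G (E y) (Ad G (iv g) B))"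
  proof -
    have "\<forall>\<^sub>F h in nhds e. g \<cdot> h \<cdot> iv g \<in> fst chart"
      using diff_pt_conj[of g e] eventually_isCont[of e "\<lambda>h. g \<cdot> h \<cdot> iv g" "\<lambda>p. p \<in> fst chart"] open_chart
      by (simp add: eventually_nhds_in_open diff_pt_def)
    from eventually_cinv[OF mfd this] show ?thesis
      by eventually_elim (simp add: F_def chart_rep_def Ad_mult mult_assoc)
  qed
  ultimately have "((\<lambda>y. Ad G g (Ad G (E y) (Ad G (iv g) B))) has_derivative
      (\<lambda>u. bracket G (Ad G g u) B)) (at o0)"
    by (auto intro: has_derivative_transform_eventually simp: eventually_nhds_conv_at)
  moreover have "((\<lambda>y. Ad G g (Ad G (E y) (Ad G (iv g) B))) has_derivative
      (\<lambda>u. Ad G g (bracket G u (Ad G (iv g) B)))) (at o0)"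
    using linear_Ad[of g] Ad_has_derivative
    by (intro bounded_linear.has_derivative[of "Ad G g"]) (simp_all add: linear_conv_bounded_linear)
  ultimately have "(\<lambda>u. bracket G (Ad G g u) B) = (\<lambda>u. Ad G g (bracket G u (Ad G (iv g) B)))"
    by (rule has_derivative_unique)
  then show ?thesis
    by (rule fun_cong)
qed

lemma killing_Ad: "killing G (Ad G g A) (Ad G g B) = killing G A B"
proof -
  have lin: "linear (bracket G A)" for A
    using bilinear_bracket by (simp add: bilinear_def)
  have inv: "Ad G (iv g) (Ad G g C) = C" "Ad G g (Ad G (iv g) C) = C" for C
    by (simp_all add: Ad_one flip: Ad_mult)
  have "killing G (Ad G g A) (Ad G g B) =
      endo_trace (Ad G g \<circ> (bracket G A \<circ> bracket G B \<circ> Ad G (iv g)))"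
    unfolding killing_def by (intro arg_cong[where f = endo_trace]) (auto simp: bracket_Ad inv)
  also have "\<dots> = endo_trace ((bracket G A \<circ> bracket G B \<circ> Ad G (iv g)) \<circ> Ad G g)"
    by (intro endo_trace_comp linear_Ad linear_compose lin)
  also have "\<dots> = killing G A B"
    unfolding killing_def by (intro arg_cong[where f = endo_trace]) (auto simp: inv)
  finally show ?thesis .
qed

lemma ip_bilinear: "bilinear (ip G)"
  using bilinear_bracket unfolding bilinear_def
  by (auto intro!: linearI simp: ip_def killing_def endo_trace_def linear_add linear_scale
      bilinear_ladd[OF bilinear_bracket] bilinear_lmul[OF bilinear_bracket]
      inner_add_left sum.distrib sum_distrib_left)

lemma ip_sym: "ip G A B = ip G B A"
  using bilinear_bracket by (auto simp: ip_def killing_def bilinear_def intro: endo_trace_comp)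

text \<open>Differentiate the invariance of the Killing form under \<open>Ad\<close>.\<close>

lemma ip_bracket: "ip G (bracket G C A) B = - ip G A (bracket G C B)"
proof -
  have "bounded_bilinear (ip G)"
    using ip_bilinear by (simp add: bilinear_conv_bounded_bilinear)
  from bounded_bilinear.FDERIV[OF this Ad_has_derivative[of A] Ad_has_derivative[of B]]
  have "((\<lambda>y. ip G A B) has_derivative (\<lambda>C. ip G A (bracket G C B) + ip G (bracket G C A) B)) (at o0)"
    using killing_Ad by (simp add: ip_def Ad_one)
  from fun_cong[OF has_derivative_unique[OF this has_derivative_const], of C]
  have "ip G A (bracket G C B) + ip G (bracket G C A) B = 0" .
  then show ?thesis
    by simp
qed

lemma lie_algebra_inv:
  assumes "\<And>A. A \<noteq> 0 \<Longrightarrow> ip G A A > 0"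
  shows "lie_algebra_inv G"
  using assms ip_bilinear ip_sym bilinear_bracket bracket_self ip_bracket
  by unfold_locales

end

section \<open>Quaternionic triples\<close>

text \<open>Traces read off coefficients in a quaternionic triple \<open>J\<close>, because \<open>tr (J\<^sub>i J\<^sub>j) = 0\<close> for
  \<open>i \<noteq> j\<close> and \<open>tr (J\<^sub>i\<^sup>2)\<close> is minus the dimension. They are linear and
  therefore also show that the coefficients of a differentiable field are differentiable.\<close>

definition btrace :: "('e::euclidean_space \<Rightarrow>\<^sub>L 'e) \<Rightarrow> real" where
  "btrace f = endo_trace (blinfun_apply f)"

lemma bounded_linear_btrace: "bounded_linear (btrace :: ('e::euclidean_space \<Rightarrow>\<^sub>L 'e) \<Rightarrow> real)"
  unfolding btrace_def endo_trace_def
  by (intro bounded_linear_sum bounded_linear_compose[OF bounded_linear_inner_left]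
      blinfun.bounded_linear_left)

lemmas btrace_linear = linear_simps[OF bounded_linear_btrace]

lemma btrace_scaleR: "btrace (r *\<^sub>R f) = r * btrace f"
  using btrace_linear(5)[of r f] by simp

lemma btrace_sum: "btrace (sum f A) = (\<Sum>i\<in>A. btrace (f i))"
  by (rule linear_sum[OF bounded_linear.linear[OF bounded_linear_btrace]])

lemma btrace_commute:
  fixes f g :: "'e::euclidean_space \<Rightarrow>\<^sub>L 'e"
  shows "btrace (f o\<^sub>L g) = btrace (g o\<^sub>L f)"
proof -
  have "blinfun_apply (f o\<^sub>L g) = blinfun_apply f \<circ> blinfun_apply g" for f g :: "'e \<Rightarrow>\<^sub>L 'e"
    by auto
  then show ?thesis
    using endo_trace_comp[of "blinfun_apply f" "blinfun_apply g"]
    by (simp add: btrace_def bounded_linear.linear blinfun.bounded_linear_right)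
qed

lemma btrace_id: "btrace (id_blinfun :: 'e::euclidean_space \<Rightarrow>\<^sub>L 'e) = real DIM('e)"
  by (simp add: btrace_def endo_trace_def)

lemmas blinfun_compose_simps =
  bounded_bilinear.add_left[OF bounded_bilinear_blinfun_compose]
  bounded_bilinear.add_right[OF bounded_bilinear_blinfun_compose]
  bounded_bilinear.diff_left[OF bounded_bilinear_blinfun_compose]
  bounded_bilinear.diff_right[OF bounded_bilinear_blinfun_compose]
  bounded_bilinear.minus_left[OF bounded_bilinear_blinfun_compose]
  bounded_bilinear.minus_right[OF bounded_bilinear_blinfun_compose]
  bounded_bilinear.scaleR_left[OF bounded_bilinear_blinfun_compose]
  bounded_bilinear.scaleR_right[OF bounded_bilinear_blinfun_compose]
  bounded_bilinear.sum_left[OF bounded_bilinear_blinfun_compose]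
  bounded_bilinear.sum_right[OF bounded_bilinear_blinfun_compose]

lemma comp_id [simp]: "f o\<^sub>L id_blinfun = f" "id_blinfun o\<^sub>L f = f"
  by (auto intro!: blinfun_eqI)

lemma comp_assoc: "(f o\<^sub>L g) o\<^sub>L h = f o\<^sub>L (g o\<^sub>L h)"
  by (auto intro!: blinfun_eqI)

definition quat_triple :: "('e::euclidean_space \<Rightarrow>\<^sub>L 'e) ^ 3 \<Rightarrow> bool" where
  "quat_triple J \<longleftrightarrow> (\<forall>i. J $ i o\<^sub>L J $ i = - id_blinfun) \<and>
     J $ 1 o\<^sub>L J $ 2 = J $ 3 \<and> J $ 2 o\<^sub>L J $ 3 = J $ 1 \<and> J $ 3 o\<^sub>L J $ 1 = J $ 2"

lemma quat_basis_triple: "quat_basis met Q p J \<Longrightarrow> quat_triple J"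
  by (simp add: quat_basis_def quat_triple_def)

text \<open>The anticommutation relations follow, for instance \<open>J\<^sub>2 J\<^sub>1 = J\<^sub>2 J\<^sub>2 J\<^sub>3 = - J\<^sub>3\<close>.\<close>

lemma quat_triple_mult:
  assumes "quat_triple J"
  shows "J $ i o\<^sub>L J $ i = - id_blinfun"
    "J $ 1 o\<^sub>L J $ 2 = J $ 3" "J $ 2 o\<^sub>L J $ 3 = J $ 1" "J $ 3 o\<^sub>L J $ 1 = J $ 2"
    "J $ 2 o\<^sub>L J $ 1 = - J $ 3" "J $ 3 o\<^sub>L J $ 2 = - J $ 1" "J $ 1 o\<^sub>L J $ 3 = - J $ 2"
proof -
  show sq: "J $ i o\<^sub>L J $ i = - id_blinfun" for i
    using assms by (simp add: quat_triple_def)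
  show m: "J $ 1 o\<^sub>L J $ 2 = J $ 3" "J $ 2 o\<^sub>L J $ 3 = J $ 1" "J $ 3 o\<^sub>L J $ 1 = J $ 2"
    using assms by (simp_all add: quat_triple_def)
  have "J $ i o\<^sub>L (J $ i o\<^sub>L K) = - K" for i K
    by (simp add: sq blinfun_compose_simps flip: comp_assoc)
  from this[of 2 "J $ 3"] this[of 3 "J $ 1"] this[of 1 "J $ 2"]
  show "J $ 2 o\<^sub>L J $ 1 = - J $ 3" "J $ 3 o\<^sub>L J $ 2 = - J $ 1" "J $ 1 o\<^sub>L J $ 3 = - J $ 2"
    by (simp_all add: m)
qed

lemma quat_triple_btrace:
  fixes J :: "('e::euclidean_space \<Rightarrow>\<^sub>L 'e) ^ 3"
  assumes J: "quat_triple J"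
  shows "btrace (J $ i) = 0" "btrace (J $ i o\<^sub>L J $ j) = (if i = j then - real DIM('e) else 0)"
proof -
  note m = quat_triple_mult[OF J]
  have 0: "btrace (J $ i) = 0" for i
    using btrace_commute[of "J $ 1" "J $ 2"] btrace_commute[of "J $ 2" "J $ 3"]
      btrace_commute[of "J $ 3" "J $ 1"] exhaust_3[of i]
    by (auto simp: m btrace_linear)
  show "btrace (J $ i) = 0"
    by (rule 0)
  show "btrace (J $ i o\<^sub>L J $ j) = (if i = j then - real DIM('e) else 0)"
    using exhaust_3[of i] exhaust_3[of j] by (auto simp: m btrace_linear 0 btrace_id)
qed

lemma quat_triple_coeff:
  fixes J :: "('e::euclidean_space \<Rightarrow>\<^sub>L 'e) ^ 3"
  assumes J: "quat_triple J"
  shows "btrace ((\<Sum>i\<in>UNIV. c i *\<^sub>R J $ i) o\<^sub>L J $ j) = - (real DIM('e) * c j)"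
  by (simp add: blinfun_compose_simps btrace_sum btrace_scaleR quat_triple_btrace[OF J] if_distrib
      cong: if_cong)

lemma quat_triple_independent:
  fixes J :: "('e::euclidean_space \<Rightarrow>\<^sub>L 'e) ^ 3"
  assumes J: "quat_triple J" and eq: "(\<Sum>i\<in>UNIV. c i *\<^sub>R J $ i) = (\<Sum>i\<in>UNIV. d i *\<^sub>R J $ i)"
  shows "c j = d j"
  using quat_triple_coeff[OF J, of c j] quat_triple_coeff[OF J, of d j] by (simp add: eq)

lemma span_triple:
  fixes J :: "'a::real_vector ^ 3"
  assumes "a \<in> span (range (($) J))"
  obtains c where "a = (\<Sum>i\<in>UNIV. c i *\<^sub>R J $ i)"
proof -
  have "span (range (($) J)) \<subseteq> range (\<lambda>c :: real ^ 3. \<Sum>i\<in>UNIV. c $ i *\<^sub>R J $ i)"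
  proof (rule span_minimal)
    show "range (($) J) \<subseteq> range (\<lambda>c :: real ^ 3. \<Sum>i\<in>UNIV. c $ i *\<^sub>R J $ i)"
    proof
      fix a assume "a \<in> range (($) J)"
      then obtain k where "a = J $ k"
        by auto
      then have "a = (\<Sum>i\<in>UNIV. axis k (1 :: real) $ i *\<^sub>R J $ i)"
        by (simp add: axis_def if_distrib[of "\<lambda>x. x *\<^sub>R _"] cong: if_cong)
      then show "a \<in> range (\<lambda>c :: real ^ 3. \<Sum>i\<in>UNIV. c $ i *\<^sub>R J $ i)"
        by (rule range_eqI)
    qed
    have "linear (\<lambda>c :: real ^ 3. \<Sum>i\<in>UNIV. c $ i *\<^sub>R J $ i)"
      by (rule linearI) (simp_all add: sum_3 algebra_simps)
    then show "subspace (range (\<lambda>c :: real ^ 3. \<Sum>i\<in>UNIV. c $ i *\<^sub>R J $ i))"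
      by (rule linear_subspace_image) simp
  qed
  then show thesis
    using assms that by blast
qed

text \<open>The relation \<open>J'\<^sub>1 J'\<^sub>2 = J'\<^sub>3\<close> says that the third row of \<open>R\<close> is the cross product of the first
  two. Therefore \<open>det R\<close> is the squared length of the third row.\<close>

lemma quat_basis_change:
  fixes J J' :: "('e::euclidean_space \<Rightarrow>\<^sub>L 'e) ^ 3"
  assumes J: "quat_basis met Q p J" and J': "quat_basis met Q p J'"
  obtains R :: "real ^ 3 ^ 3" where "det R > 0" "J' = frame_change R J"
proof -
  note tJ = quat_basis_triple[OF J] and tJ' = quat_basis_triple[OF J']
  note m = quat_triple_mult[OF tJ]
  have "\<exists>c. J' $ i = (\<Sum>j\<in>UNIV. c j *\<^sub>R J $ j)" for i
  proof -
    have "J' $ i \<in> span (range (($) J'))"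
      by (rule span_base) simp
    then have "J' $ i \<in> span (range (($) J))"
      using J J' by (simp add: quat_basis_def)
    then show ?thesis
      by (elim span_triple) blast
  qed
  then obtain c where c: "J' $ i = (\<Sum>j\<in>UNIV. c i j *\<^sub>R J $ j)" for i
    by metis
  define R :: "real ^ 3 ^ 3" where "R = (\<chi> i j. c i j)"
  have R: "J' = frame_change R J"
    by (simp add: vec_eq_iff c frame_change_def R_def)
  \<comment> \<open>the cross product of the first two rows\<close>
  define d where "d = (\<lambda>k :: 3. if k = 1 then c 1 2 * c 2 3 - c 1 3 * c 2 2 else
    if k = 2 then c 1 3 * c 2 1 - c 1 1 * c 2 3 else c 1 1 * c 2 2 - c 1 2 * c 2 1)"
  have "J' $ 1 o\<^sub>L J' $ 2 = (\<Sum>k\<in>UNIV. d k *\<^sub>R J $ k) - (c 1 1 * c 2 1 + c 1 2 * c 2 2 + c 1 3 * c 2 3) *\<^sub>R id_blinfun"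
    by (simp add: c sum_3 blinfun_compose_simps m d_def algebra_simps)
  then have "J' $ 3 = (\<Sum>k\<in>UNIV. d k *\<^sub>R J $ k) - (c 1 1 * c 2 1 + c 1 2 * c 2 2 + c 1 3 * c 2 3) *\<^sub>R id_blinfun"
    using quat_triple_mult(2)[OF tJ'] by simp
  then have "btrace (J' $ 3 o\<^sub>L J $ j) = - (real DIM('e) * d j)" for j
    by (simp add: blinfun_compose_simps(3,7) btrace_linear btrace_scaleR quat_triple_coeff[OF tJ] quat_triple_btrace[OF tJ])
  then have "c 3 j = d j" for j
    using quat_triple_coeff[OF tJ, of "c 3" j] by (simp add: c)
  moreover have "det R = c 3 1 * d 1 + c 3 2 * d 2 + c 3 3 * d 3"
    by (simp add: R_def det_3 d_def algebra_simps)
  ultimately have "det R = (c 3 1)\<^sup>2 + (c 3 2)\<^sup>2 + (c 3 3)\<^sup>2"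
    by (simp add: power2_eq_square)
  moreover have "c 3 1 \<noteq> 0 \<or> c 3 2 \<noteq> 0 \<or> c 3 3 \<noteq> 0"
  proof (rule ccontr)
    assume "\<not> ?thesis"
    then have "J' $ 3 = 0"
      by (simp add: c sum_3)
    then show False
      using quat_triple_btrace(2)[OF tJ', of 3 3] by (simp add: btrace_linear)
  qed
  ultimately have "det R > 0"
    by (auto simp: add_pos_nonneg add_nonneg_pos sum_power2_gt_zero_iff)
  then show thesis
    using R that by blast
qed

context lie_algebra_ip
begin

text \<open>If \<open>J' = R J\<close> are two bases of the fibre, then the coefficients satisfy \<open>B = R\<^sup>T B'\<close>. As \<open>det R > 0\<close>,
  they span the same oriented plane.\<close>

lemma Psi_eq_oplane:
  assumes J: "quat_basis met Q p J" and B: "moment_coeffs G mu p J B"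
  shows "Psi G met Q mu p = oplane B"
proof -
  have "oplane B' = oplane B" if J': "quat_basis met Q p J'" and B': "moment_coeffs G mu p J' B'" for J' B'
  proof -
    obtain R where R: "det R > 0" "J' = frame_change R J"
      by (rule quat_basis_change[OF J J'])
    have "frame_change (transpose R) B' = B"
    proof (rule vec_eq_iff[THEN iffD2], intro allI ip_eqI)
      fix j A
      have "(\<Sum>i\<in>UNIV. ip G (B $ i) A *\<^sub>R J $ i) = (\<Sum>i\<in>UNIV. ip G (B' $ i) A *\<^sub>R J' $ i)"
        using B B' by (simp add: moment_coeffs_def)
      also have "\<dots> = (\<Sum>j\<in>UNIV. (\<Sum>i\<in>UNIV. R $ i $ j * ip G (B' $ i) A) *\<^sub>R J $ j)"
        by (simp add: R(2) frame_change_nth sum_3 algebra_simps)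
      finally have "ip G (B $ j) A = (\<Sum>i\<in>UNIV. R $ i $ j * ip G (B' $ i) A)"
        by (rule quat_triple_independent[OF quat_basis_triple[OF J]])
      then show "ip G (frame_change (transpose R) B' $ j) A = ip G (B $ j) A"
        by (simp add: frame_change_nth transpose_def sum_3 ip_simps)
    qed
    then show ?thesis
      using oplane_frame_change[of "transpose R" B'] R(1) by (simp add: det_transpose)
  qed
  then have "{oplane B | B. \<exists>J. quat_basis met Q p J \<and> moment_coeffs G mu p J B} = {oplane B}"
    using J B by blast
  then show ?thesis
    by (simp add: Psi_def)
qed

end

section \<open>Endomorphism fields in a chart\<close>

lemma transition_differentiable:
  assumes M: "smooth_manifold M" and c: "c \<in> atlas M" "q \<in> fst c" and d: "d \<in> atlas M" "q \<in> fst d"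
  shows "(snd d \<circ> cinv c) differentiable (at (snd c q))"
proof -
  have "smooth_on (snd c ` (fst c \<inter> fst d)) (snd d \<circ> cinv c)"
    using M c d by (auto simp: smooth_manifold_def)
  then show ?thesis
    by (rule smooth_on_differentiable) (use c d in auto)
qed

lemma tchange_apply:
  assumes "smooth_manifold M" "c \<in> atlas M" "q \<in> fst c" "d \<in> atlas M" "q \<in> fst d"
  shows "blinfun_apply (tchange c d q) = frechet_derivative (snd d \<circ> cinv c) (at (snd c q))"
  unfolding tchange_def
  using linear_frechet_derivative[OF transition_differentiable[OF assms]]
  by (intro bounded_linear_Blinfun_apply) (simp add: linear_conv_bounded_linear)

lemma tchange_inverse:
  assumes M: "smooth_manifold M" and c: "c \<in> atlas M" "q \<in> fst c" and d: "d \<in> atlas M" "q \<in> fst d"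
  shows "tchange d c q o\<^sub>L tchange c d q = id_blinfun"
proof (rule blinfun_eqI)
  fix u
  let ?f = "snd d \<circ> cinv c" and ?g = "snd c \<circ> cinv d"
  have fq: "?f (snd c q) = snd d q"
    using cinv_left[OF M c] by simp
  have df: "?f differentiable (at (snd c q))" and dg: "?g differentiable (at (?f (snd c q)))"
    unfolding fq by (rule transition_differentiable[OF M c d] transition_differentiable[OF M d c])+
  have "\<forall>\<^sub>F p in nhds q. p \<in> fst d"
    by (rule chart_nhds(4)[OF M d])
  then have "\<forall>\<^sub>F y in nhds (snd c q). cinv c y \<in> fst d"
    using eventually_isCont[OF chart_nhds(2)[OF M c], of "\<lambda>p. p \<in> fst d"] cinv_left[OF M c] by simp
  then have "\<forall>\<^sub>F y in nhds (snd c q). (?g \<circ> ?f) y = y"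
    using chart_nhds(1)[OF M c] by eventually_elim (simp add: cinv_left[OF M d(1)])
  from frechet_derivative_eventually_eq(2)[OF differentiable_chain_at[OF df dg] this]
  have id: "frechet_derivative (?g \<circ> ?f) (at (snd c q)) = (\<lambda>u. u)"
    by (simp only: frechet_derivative_ident)
  have "blinfun_apply (tchange d c q o\<^sub>L tchange c d q) u =
      (frechet_derivative ?g (at (snd d q)) \<circ> frechet_derivative ?f (at (snd c q))) u"
    by (simp only: blinfun_apply_blinfun_compose tchange_apply[OF M c d] tchange_apply[OF M d c] comp_apply)
  also have "\<dots> = frechet_derivative (?g \<circ> ?f) (at (snd c q)) u"
    by (simp only: frechet_derivative_compose[OF df dg] fq)
  finally show "blinfun_apply (tchange d c q o\<^sub>L tchange c d q) u = blinfun_apply id_blinfun u"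
    by (simp only: id blinfun_apply_id_blinfun id_apply)
qed

lemma tchange_self:
  assumes M: "smooth_manifold M" and c: "c \<in> atlas M" "q \<in> fst c"
  shows "tchange c c q = id_blinfun"
proof (rule blinfun_eqI)
  fix u
  have "\<forall>\<^sub>F y in nhds (snd c q). y = (snd c \<circ> cinv c) y"
    using chart_nhds(1)[OF M c] by eventually_elim simp
  from frechet_derivative_eventually_eq(2)[OF differentiable_ident this]
  show "blinfun_apply (tchange c c q) u = blinfun_apply id_blinfun u"
    by (simp only: tchange_apply[OF M c c] frechet_derivative_ident blinfun_apply_id_blinfun id_apply)
qed

text \<open>Passing to a chart is a conjugation by a change of coordinates, hence compatible with products.\<close>

lemma endo_in_compose:
  fixes M :: "('m::{t2_space,second_countable_topology}, 'e::euclidean_space) manifold"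
  assumes M: "smooth_manifold M" and c: "c \<in> atlas M" "q \<in> fst c"
  shows "endo_in M c J q o\<^sub>L endo_in M c K q = endo_in M c (\<lambda>p. J p o\<^sub>L K p) q"
proof -
  have "tchange c (chart_at M q) q o\<^sub>L (tchange (chart_at M q) c q o\<^sub>L X) = X"
    for X :: "'e \<Rightarrow>\<^sub>L 'e"
    by (simp add: tchange_inverse[OF M chart_at_atlas[OF M] c] flip: comp_assoc)
  then show ?thesis
    by (simp add: endo_in_def comp_assoc)
qed

lemma endo_in_minus_id:
  assumes M: "smooth_manifold M" and c: "c \<in> atlas M" "q \<in> fst c"
  shows "endo_in M c (\<lambda>p. - id_blinfun) q = - id_blinfun"
  using tchange_inverse[OF M c chart_at_atlas[OF M]]
  by (simp add: endo_in_def blinfun_compose_simps)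

lemma endo_in_sum:
  "endo_in M c (\<lambda>p. \<Sum>i\<in>A. r i p *\<^sub>R J i p) q = (\<Sum>i\<in>A. r i q *\<^sub>R endo_in M c (J i) q)"
  by (simp add: endo_in_def blinfun_compose_simps)

lemma endo_in_cong: "J q = K q \<Longrightarrow> endo_in M c J q = endo_in M c K q"
  by (simp add: endo_in_def)

lemma endo_in_self:
  assumes M: "smooth_manifold M"
  shows "endo_in M (chart_at M p) J p = J p"
  by (simp add: endo_in_def tchange_self[OF M chart_at_atlas[OF M]])

lemma quat_triple_endo_in:
  assumes M: "smooth_manifold M" and c: "c \<in> atlas M" "q \<in> fst c" and J: "quat_triple (J q)"
  shows "quat_triple (\<chi> i. endo_in M c (\<lambda>p. J p $ i) q)"
  unfolding quat_triple_def
  using J endo_in_cong[of "\<lambda>p. J p $ i o\<^sub>L J p $ i" q "\<lambda>p. - id_blinfun" M c for i]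
    endo_in_cong[of "\<lambda>p. J p $ 1 o\<^sub>L J p $ 2" q "\<lambda>p. J p $ 3" M c]
    endo_in_cong[of "\<lambda>p. J p $ 2 o\<^sub>L J p $ 3" q "\<lambda>p. J p $ 1" M c]
    endo_in_cong[of "\<lambda>p. J p $ 3 o\<^sub>L J p $ 1" q "\<lambda>p. J p $ 2" M c]
  by (auto simp: endo_in_compose[OF M c] endo_in_minus_id[OF M c] quat_triple_def)

section \<open>The moment map equation in a frame\<close>

lemma has_derivative_vec_lambda:
  fixes f :: "'i::finite \<Rightarrow> 'a::real_normed_vector \<Rightarrow> 'b::euclidean_space"
  assumes "\<And>i. (f i has_derivative f' i) (at x)"
  shows "((\<lambda>y. \<chi> i. f i y) has_derivative (\<lambda>u. \<chi> i. f' i u)) (at x)"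
proof -
  have ax: "(\<chi> i. g i) = (\<Sum>i\<in>UNIV. axis i (g i))" for g :: "'i \<Rightarrow> 'b"
    by (simp add: vec_eq_iff axis_def if_distrib cong: if_cong)
  have lin: "bounded_linear (axis i :: 'b \<Rightarrow> 'b ^ 'i)" for i
    unfolding linear_conv_bounded_linear[symmetric]
    by (rule linearI) (simp_all add: vec_eq_iff axis_def)
  show ?thesis
    unfolding ax by (intro has_derivative_sum bounded_linear.has_derivative[OF lin] assms)
qed

context lie_algebra_ip
begin

text \<open>A vector is recovered linearly from its inner products with a basis, since the inner product is
  nondegenerate.\<close>

lemma differentiable_of_ip:
  fixes b :: "'a::real_normed_vector \<Rightarrow> 'k"
  assumes "\<And>A. (\<lambda>y. ip G (b y) A) differentiable (at x)"
  shows "b differentiable (at x)"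
proof -
  define f where "f a = (\<Sum>c\<in>Basis. ip G a c *\<^sub>R c)" for a :: 'k
  have "linear f"
    by (rule linearI) (simp_all add: f_def ip_simps sum.distrib scaleR_add_left scaleR_sum_right)
  moreover have "inj f"
  proof (rule injI, rule ip_eqI)
    fix a a' A assume eq: "f a = f a'"
    have "f a \<bullet> c = ip G a c" if "c \<in> Basis" for a c
      using that by (simp add: f_def inner_sum_left inner_Basis if_distrib sum.If_cases cong: if_cong)
    then have "ip G a c = ip G a' c" if "c \<in> Basis" for c
      using that eq by metis
    moreover have "ip G a A = (\<Sum>c\<in>Basis. (A \<bullet> c) * ip G a c)" for a
      using linear_sum_Basis[of "ip G a" A] ip_bilinear by (simp add: bilinear_def)
    ultimately show "ip G a A = ip G a' A"
      by simp
  qed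
  ultimately obtain h where h: "linear h" "h \<circ> f = id"
    using linear_injective_left_inverse by blast
  have "\<forall>c. \<exists>D. ((\<lambda>y. ip G (b y) c) has_derivative D) (at x)"
    using assms by (simp add: differentiable_def)
  then obtain D where D: "\<And>c. ((\<lambda>y. ip G (b y) c) has_derivative D c) (at x)"
    by metis
  have "((\<lambda>y. f (b y)) has_derivative (\<lambda>u. \<Sum>c\<in>Basis. D c u *\<^sub>R c)) (at x)"
    unfolding f_def by (intro has_derivative_sum has_derivative_scaleR_left D)
  then have "(\<lambda>y. f (b y)) differentiable (at x)"
    by (auto simp: differentiable_def)
  then have "(\<lambda>y. h (f (b y))) differentiable (at x)"
    using h(1) differentiable_compose[of h "\<lambda>y. f (b y)"]
    by (simp add: linear_imp_differentiable)
  moreover have "h (f a) = a" for a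
    using h(2) by (simp add: fun_eq_iff)
  ultimately show ?thesis
    by simp
qed

end

lemma differentiable_btrace:
  fixes f :: "'a::real_normed_vector \<Rightarrow> 'e::euclidean_space \<Rightarrow>\<^sub>L 'e"
  assumes "f differentiable (at x)"
  shows "(\<lambda>y. btrace (f y)) differentiable (at x)"
  using assms bounded_linear.has_derivative[OF bounded_linear_btrace]
  unfolding differentiable_def by blast

lemma differentiable_blinfun_compose:
  fixes f g :: "'a::real_normed_vector \<Rightarrow> 'e::euclidean_space \<Rightarrow>\<^sub>L 'e"
  assumes "f differentiable (at x)" "g differentiable (at x)"
  shows "(\<lambda>y. f y o\<^sub>L g y) differentiable (at x)"
  using assms bounded_bilinear.FDERIV[OF bounded_bilinear_blinfun_compose]
  unfolding differentiable_def by blast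

text \<open>The local data near \<open>x\<close>: in the frame \<open>I\<close> the three coefficients of the moment map are orthogonal
  and all of length \<open>lam\<close>, which is positive at \<open>x\<close>.\<close>

locale quaternionic_moment =
  lie_algebra_ip G
  for G :: "('g::{t2_space,second_countable_topology}, 'k::euclidean_space) lie_group" +
  fixes M :: "('m::{t2_space,second_countable_topology}, 'e::euclidean_space) manifold"
    and met :: "'m \<Rightarrow> 'e \<Rightarrow> 'e \<Rightarrow> real"
    and Q :: "'m \<Rightarrow> ('e \<Rightarrow>\<^sub>L 'e) set"
    and act :: "'g \<Rightarrow> 'm \<Rightarrow> 'm"
    and mu :: "'m \<Rightarrow> 'k \<Rightarrow> 'e \<Rightarrow>\<^sub>L 'e"
    and lam :: "'m \<Rightarrow> real"
    and U :: "'m set"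
    and I :: "'m \<Rightarrow> ('e \<Rightarrow>\<^sub>L 'e) ^ 3"
    and B v :: "'m \<Rightarrow> 'k ^ 3"
    and x :: 'm
  assumes qk: "quaternion_kaehler M met Q"
    and moment: "moment_map G M met Q act mu"
    and frame: "quat_frame M met Q U I" and xU: "x \<in> U"
    and coeffs: "p \<in> U \<Longrightarrow> moment_coeffs G mu p (I p) (B p)"
    and lam_pos: "lam x > 0"
    and B_eq: "p \<in> U \<Longrightarrow> B p $ i = lam p *\<^sub>R v p $ i"
    and v_orthonormal: "p \<in> U \<Longrightarrow> orthonormal (v p)"
begin

abbreviation "c \<equiv> chart_at M x"
abbreviation "q0 \<equiv> chart_pt M x"
abbreviation "F \<equiv> cinv c"

lemma mfdM: "smooth_manifold M"
  using qk by (simp add: quaternion_kaehler_def)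

lemma openU: "open U"
  using frame by (simp add: quat_frame_def)

lemma basisI: "p \<in> U \<Longrightarrow> quat_basis met Q p (I p)"
  using frame by (simp add: quat_frame_def)

lemma near_x: "\<forall>\<^sub>F y in nhds q0. F y \<in> fst c \<and> snd c (F y) = y \<and> F y \<in> U"
proof -
  have "\<forall>\<^sub>F p in nhds x. p \<in> U"
    using openU xU by (rule eventually_nhds_in_open)
  from eventually_cinv[OF mfdM this] chart_at_nhds(1)[OF mfdM, of x] show ?thesis
    by eventually_elim simp
qed

lemma F_q0 [simp]: "F q0 = x"
  by (rule chart_at_nhds(5)[OF mfdM])

lemma smooth_endo_differentiable:
  assumes "smooth_endo_on M W J" "x \<in> W"
  shows "(\<lambda>y. endo_in M c J (F y)) differentiable (at q0)"
proof -
  have "smooth_on (snd c ` (fst c \<inter> W)) (\<lambda>y. endo_in M c J (F y))"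
    using assms(1) chart_at_atlas(1)[OF mfdM] by (simp add: smooth_endo_on_def)
  then show ?thesis
    by (rule smooth_on_differentiable) (use assms(2) chart_at_atlas(2)[OF mfdM] in \<open>auto simp: chart_pt_def\<close>)
qed

definition I_chart :: "3 \<Rightarrow> 'e \<Rightarrow> 'e \<Rightarrow>\<^sub>L 'e" where
  "I_chart i y = endo_in M c (\<lambda>p. I p $ i) (F y)"

lemma I_chart_differentiable: "I_chart i differentiable (at q0)"
  unfolding I_chart_def[abs_def]
  using frame xU by (intro smooth_endo_differentiable[of U]) (auto simp: quat_frame_def)

lemma I_chart_q0: "I_chart i q0 = I x $ i"
  by (simp add: I_chart_def endo_in_self[OF mfdM])

lemma I_chart_triple: "\<forall>\<^sub>F y in nhds q0. quat_triple (\<chi> i. I_chart i y)"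
  using near_x
proof eventually_elim
  case (elim y)
  then have "quat_triple (\<chi> i. endo_in M c (\<lambda>p. I p $ i) (F y))"
    using basisI[of "F y"] quat_basis_triple
    by (intro quat_triple_endo_in[OF mfdM chart_at_atlas(1)[OF mfdM]]) auto
  then show ?case
    by (simp add: I_chart_def)
qed

lemma mu_chart: "\<forall>\<^sub>F y in nhds q0. endo_in M c (\<lambda>p. mu p A) (F y) = (\<Sum>i\<in>UNIV. ip G (B (F y) $ i) A *\<^sub>R I_chart i y)"
  using near_x
proof eventually_elim
  case (elim y)
  have "endo_in M c (\<lambda>p. mu p A) (F y) =
      endo_in M c (\<lambda>p. \<Sum>i\<in>UNIV. ip G (B p $ i) A *\<^sub>R I p $ i) (F y)"
    using elim coeffs[of "F y"] by (intro endo_in_cong) (simp add: moment_coeffs_def)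
  then show ?case
    by (simp add: endo_in_sum I_chart_def)
qed

lemma mu_chart_differentiable: "(\<lambda>y. endo_in M c (\<lambda>p. mu p A) (F y)) differentiable (at q0)"
  using moment by (intro smooth_endo_differentiable[of UNIV]) (auto simp: moment_map_def)

text \<open>The coefficient of \<open>I\<^sub>j\<close> in \<open>\<mu>\<^sub>A\<close> is the trace of \<open>\<mu>\<^sub>A I\<^sub>j\<close> up to a constant factor, and both
  factors are differentiable in the chart.\<close>

lemma B_differentiable: "(\<lambda>y. B (F y)) differentiable (at q0)"
proof -
  have "(\<lambda>y. ip G (B (F y) $ j) A) differentiable (at q0)" for j A
  proof -
    have "(\<lambda>y. (- inverse (real DIM('e))) *\<^sub>R btrace (endo_in M c (\<lambda>p. mu p A) (F y) o\<^sub>L I_chart j y)) differentiable (at q0)"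
      by (intro differentiable_scaleR differentiable_btrace differentiable_blinfun_compose
          mu_chart_differentiable I_chart_differentiable) simp
    moreover have "\<forall>\<^sub>F y in nhds q0. (- inverse (real DIM('e))) *\<^sub>R btrace (endo_in M c (\<lambda>p. mu p A) (F y) o\<^sub>L I_chart j y)
        = ip G (B (F y) $ j) A"
      using mu_chart[of A] I_chart_triple
    proof eventually_elim
      case (elim y)
      have "btrace (endo_in M c (\<lambda>p. mu p A) (F y) o\<^sub>L I_chart j y) = - (real DIM('e) * ip G (B (F y) $ j) A)"
        using quat_triple_coeff[OF elim(2), of "\<lambda>i. ip G (B (F y) $ i) A" j] elim(1) by simp
      then show ?case
        by simp
    qed
    ultimately show ?thesis
      by (rule frechet_derivative_eventually_eq(1))
  qed
  then have "(\<lambda>y. B (F y) $ j) differentiable (at q0)" for j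
    by (rule differentiable_of_ip)
  then have "((\<lambda>y. B (F y) $ j) has_derivative frechet_derivative (\<lambda>y. B (F y) $ j) (at q0)) (at q0)" for j
    by (simp add: frechet_derivative_works)
  from has_derivative_vec_lambda[where f = "\<lambda>j y. B (F y) $ j", OF this] show ?thesis
    by (auto simp: differentiable_def)
qed

definition dB :: "'e \<Rightarrow> 'k ^ 3" where
  "dB = frechet_derivative (\<lambda>y. B (F y)) (at q0)"

lemma dB: "((\<lambda>y. B (F y)) has_derivative dB) (at q0)"
  using B_differentiable by (simp add: dB_def frechet_derivative_works)

lemma dB_ip: "((\<lambda>y. ip G (B (F y) $ i) A) has_derivative (\<lambda>u. ip G (dB u $ i) A)) (at q0)"
  by (rule bounded_linear.has_derivative[OF bounded_bilinear.bounded_linear_left[OF bounded_bilinear_ip]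
        bounded_linear.has_derivative[OF bounded_linear_vec_nth dB]])

abbreviation "nabla J u \<equiv> nabla_endo M met J x u"

text \<open>The connection form in the direction \<open>u\<close>. It enters a covariant derivative through
  commutators, which respect linear combinations of endomorphisms and have trace zero against the
  endomorphism itself.\<close>

definition gam :: "'e \<Rightarrow> 'e \<Rightarrow>\<^sub>L 'e" where
  "gam u = blinfun_apply (christoffel M met c x) u"

lemma nabla_eq: "nabla J u = frechet_derivative (\<lambda>y. endo_in M c J (F y)) (at q0) u
    + (gam u o\<^sub>L J x) - (J x o\<^sub>L gam u)"
  by (simp add: nabla_endo_def gam_def chart_pt_def Let_def)

lemma nabla_mu: "nabla (\<lambda>p. mu p A) u =
  (\<Sum>i\<in>UNIV. ip G (dB u $ i) A *\<^sub>R I x $ i) + (\<Sum>i\<in>UNIV. ip G (B x $ i) A *\<^sub>R nabla (\<lambda>p. I p $ i) u)"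
proof -
  have I: "(I_chart i has_derivative frechet_derivative (I_chart i) (at q0)) (at q0)" for i
    using I_chart_differentiable by (simp add: frechet_derivative_works)
  have "((\<lambda>y. \<Sum>i\<in>UNIV. ip G (B (F y) $ i) A *\<^sub>R I_chart i y) has_derivative
      (\<lambda>u. \<Sum>i\<in>UNIV. ip G (B (F q0) $ i) A *\<^sub>R frechet_derivative (I_chart i) (at q0) u
        + ip G (dB u $ i) A *\<^sub>R I_chart i q0)) (at q0)"
    by (intro has_derivative_sum has_derivative_scaleR dB_ip I)
  moreover have "\<forall>\<^sub>F y in nhds q0. (\<Sum>i\<in>UNIV. ip G (B (F y) $ i) A *\<^sub>R I_chart i y) = endo_in M c (\<lambda>p. mu p A) (F y)"
    using mu_chart[of A] by eventually_elim simp
  ultimately have "((\<lambda>y. endo_in M c (\<lambda>p. mu p A) (F y)) has_derivative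
      (\<lambda>u. \<Sum>i\<in>UNIV. ip G (B (F q0) $ i) A *\<^sub>R frechet_derivative (I_chart i) (at q0) u
        + ip G (dB u $ i) A *\<^sub>R I_chart i q0)) (at q0)"
    by (auto intro: has_derivative_transform_eventually simp: eventually_nhds_conv_at)
  from fun_cong[OF frechet_derivative_at[OF this], of u]
  have "frechet_derivative (\<lambda>y. endo_in M c (\<lambda>p. mu p A) (F y)) (at q0) u =
      (\<Sum>i\<in>UNIV. ip G (B x $ i) A *\<^sub>R frechet_derivative (I_chart i) (at q0) u + ip G (dB u $ i) A *\<^sub>R I x $ i)"
    by (simp add: I_chart_q0)
  moreover have "mu x A = (\<Sum>i\<in>UNIV. ip G (B x $ i) A *\<^sub>R I x $ i)"
    using coeffs[OF xU] by (simp add: moment_coeffs_def)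
  ultimately show ?thesis
    by (simp add: nabla_eq I_chart_def[abs_def] blinfun_compose_simps sum_3 algebra_simps)
qed

text \<open>Differentiating \<open>I\<^sub>i\<^sup>2 = -1\<close> shows that \<open>\<nabla>I\<^sub>i\<close> has trace zero against \<open>I\<^sub>i\<close>, so its
  \<open>I\<^sub>i\<close>-component vanishes.\<close>

lemma nabla_I:
  obtains \<omega> where "nabla (\<lambda>p. I p $ i) u = (\<Sum>j\<in>UNIV. \<omega> j *\<^sub>R I x $ j)" "\<omega> i = 0"
proof -
  note trip = quat_basis_triple[OF basisI[OF xU]]
  have "I p $ i \<in> Q p" if "p \<in> U" for p
    using basisI[OF that] by (auto simp: quat_basis_def intro: span_base)
  then have "nabla (\<lambda>p. I p $ i) u \<in> Q x"
    using qk openU xU frame unfolding quaternion_kaehler_def quat_frame_def by blast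
  then have "nabla (\<lambda>p. I p $ i) u \<in> span (range (($) (I x)))"
    using basisI[OF xU] by (simp add: quat_basis_def)
  then obtain \<omega> where \<omega>: "nabla (\<lambda>p. I p $ i) u = (\<Sum>j\<in>UNIV. \<omega> j *\<^sub>R I x $ j)"
    by (rule span_triple)
  define D where "D = frechet_derivative (I_chart i) (at q0) u"
  have "btrace (D o\<^sub>L I x $ i) = 0"
  proof -
    have I: "(I_chart i has_derivative frechet_derivative (I_chart i) (at q0)) (at q0)"
      using I_chart_differentiable by (simp add: frechet_derivative_works)
    from bounded_bilinear.FDERIV[OF bounded_bilinear_blinfun_compose I I]
    have "((\<lambda>y. I_chart i y o\<^sub>L I_chart i y) has_derivative
        (\<lambda>u. (I_chart i q0 o\<^sub>L frechet_derivative (I_chart i) (at q0) u) + (frechet_derivative (I_chart i) (at q0) u o\<^sub>L I_chart i q0))) (at q0)" .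
    moreover have "\<forall>\<^sub>F y in nhds q0. I_chart i y o\<^sub>L I_chart i y = - id_blinfun"
      using I_chart_triple by eventually_elim (auto simp: quat_triple_def)
    ultimately have "((\<lambda>y. - id_blinfun) has_derivative
        (\<lambda>u. (I_chart i q0 o\<^sub>L frechet_derivative (I_chart i) (at q0) u) + (frechet_derivative (I_chart i) (at q0) u o\<^sub>L I_chart i q0))) (at q0)"
      by (auto intro: has_derivative_transform_eventually simp: eventually_nhds_conv_at)
    from fun_cong[OF has_derivative_unique[OF this has_derivative_const], of u]
    have "btrace ((I x $ i o\<^sub>L D) + (D o\<^sub>L I x $ i)) = 0"
      by (simp add: D_def I_chart_q0 btrace_linear)
    then show ?thesis
      using btrace_commute[of "I x $ i" D] by (simp add: btrace_linear)
  qed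
  moreover have "btrace (((gam u o\<^sub>L I x $ i) - (I x $ i o\<^sub>L gam u)) o\<^sub>L I x $ i) = 0"
    using btrace_commute[of "I x $ i o\<^sub>L gam u" "I x $ i"]
    by (simp add: blinfun_compose_simps btrace_linear quat_triple_mult[OF trip] comp_assoc
        flip: comp_assoc[of "I x $ i" "I x $ i" "gam u"])
  ultimately have "btrace (nabla (\<lambda>p. I p $ i) u o\<^sub>L I x $ i) = 0"
    by (simp add: nabla_eq I_chart_def[abs_def] D_def blinfun_compose_simps btrace_linear algebra_simps)
  then have "\<omega> i = 0"
    using quat_triple_coeff[OF trip, of \<omega> i] by (simp add: \<omega>)
  with \<omega> show thesis
    by (rule that)
qed

lemma B_x: "B x $ i = lam x *\<^sub>R v x $ i"
  by (rule B_eq[OF xU])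

lemma v_x_orthonormal: "orthonormal (v x)"
  by (rule v_orthonormal[OF xU])

text \<open>The coefficient of \<open>I\<^sub>j\<close> in the moment map equation; \<open>\<omega>\<close> is the connection form of the frame.\<close>

lemma moment_derivative:
  obtains \<omega> where "\<And>i. \<omega> i i = 0" "\<And>A j. ip G (dB u $ j) A + lam x * (\<Sum>i\<in>UNIV. ip G (v x $ i) A * \<omega> i j) =
    met x ((I x $ j) (fund G M act A x)) u"
proof -
  have "\<exists>\<omega>. nabla (\<lambda>p. I p $ i) u = (\<Sum>j\<in>UNIV. \<omega> j *\<^sub>R I x $ j) \<and> \<omega> i = 0" for i
    by (rule nabla_I[of i u]) blast
  then obtain \<omega> where \<omega>: "nabla (\<lambda>p. I p $ i) u = (\<Sum>j\<in>UNIV. \<omega> i j *\<^sub>R I x $ j)" "\<omega> i i = 0" for i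
    by metis
  show thesis
  proof (rule that)
    show "\<omega> i i = 0" for i
      by (rule \<omega>(2))
    fix A j
    have "(\<Sum>j\<in>UNIV. met x ((I x $ j) (fund G M act A x)) u *\<^sub>R I x $ j) = nabla (\<lambda>p. mu p A) u"
      using moment basisI[OF xU] by (simp add: moment_map_def)
    also have "\<dots> = (\<Sum>j\<in>UNIV. (ip G (dB u $ j) A + lam x * (\<Sum>i\<in>UNIV. ip G (v x $ i) A * \<omega> i j)) *\<^sub>R I x $ j)"
      by (simp add: nabla_mu \<omega>(1) B_x ip_simps sum_3 algebra_simps)
    finally show "ip G (dB u $ j) A + lam x * (\<Sum>i\<in>UNIV. ip G (v x $ i) A * \<omega> i j) =
        met x ((I x $ j) (fund G M act A x)) u"
      by (rule quat_triple_independent[OF quat_basis_triple[OF basisI[OF xU]], symmetric])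
  qed
qed

lemma dB_perp:
  assumes "A \<in> perp G (oplane (v x))"
  shows "ip G (dB u $ j) A = met x ((I x $ j) (fund G M act A x)) u"
proof (rule moment_derivative[of u])
  fix \<omega> :: "3 \<Rightarrow> 3 \<Rightarrow> real"
  assume \<omega>: "\<And>A j. ip G (dB u $ j) A + lam x * (\<Sum>i\<in>UNIV. ip G (v x $ i) A * \<omega> i j) =
      met x ((I x $ j) (fund G M act A x)) u"
  have "(\<Sum>i\<in>UNIV. ip G (v x $ i) A * \<omega> i j) = 0"
    using assms by (intro sum.neutral) (auto simp: perp_oplane ip_sym[of _ A])
  then show ?thesis
    using \<omega>[of j A] by simp
qed

lemma dB_v: "ip G (dB u $ j) (v x $ j) = met x ((I x $ j) (fund G M act (v x $ j) x)) u"
proof (rule moment_derivative[of u])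
  fix \<omega> :: "3 \<Rightarrow> 3 \<Rightarrow> real"
  assume \<omega>: "\<And>i. \<omega> i i = 0" "\<And>A j. ip G (dB u $ j) A + lam x * (\<Sum>i\<in>UNIV. ip G (v x $ i) A * \<omega> i j) =
      met x ((I x $ j) (fund G M act A x)) u"
  have "(\<Sum>i\<in>UNIV. ip G (v x $ i) (v x $ j) * \<omega> i j) = 0"
    using v_x_orthonormal \<omega>(1) by (intro sum.neutral) (auto simp: orthonormal_def)
  then show ?thesis
    using \<omega>(2)[of j "v x $ j"] by simp
qed

text \<open>Both sides are the derivative of \<open>\<lambda>\<close> in the direction \<open>u\<close>: differentiate
  \<open>\<langle>B\<^sub>i, B\<^sub>i\<rangle> = \<lambda>\<^sup>2 = \<langle>B\<^sub>j, B\<^sub>j\<rangle>\<close>.\<close>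

lemma dB_v_const: "ip G (dB u $ i) (v x $ i) = ip G (dB u $ j) (v x $ j)"
proof -
  have der: "((\<lambda>y. ip G (B (F y) $ i) (B (F y) $ i)) has_derivative
      (\<lambda>u. ip G (B (F q0) $ i) (dB u $ i) + ip G (dB u $ i) (B (F q0) $ i))) (at q0)" for i
    by (rule bounded_bilinear.FDERIV[OF bounded_bilinear_ip];
        rule bounded_linear.has_derivative[OF bounded_linear_vec_nth dB])
  have "\<forall>\<^sub>F y in nhds q0. ip G (B (F y) $ i) (B (F y) $ i) = ip G (B (F y) $ j) (B (F y) $ j)"
    using near_x
  proof eventually_elim
    case (elim y)
    then show ?case
      using v_orthonormal[of "F y"] by (simp add: B_eq ip_simps orthonormal_def)
  qed
  then have "((\<lambda>y. ip G (B (F y) $ j) (B (F y) $ j)) has_derivative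
      (\<lambda>u. ip G (B (F q0) $ i) (dB u $ i) + ip G (dB u $ i) (B (F q0) $ i))) (at q0)"
    using der[of i] by (auto intro: has_derivative_transform_eventually simp: eventually_nhds_conv_at)
  from fun_cong[OF has_derivative_unique[OF this der[of j]], of u]
  show ?thesis
    using lam_pos by (simp add: B_x ip_simps ip_sym[of "v x $ _"])
qed

lemma met_x: "bilinear (met x)" "u \<noteq> 0 \<Longrightarrow> met x u u > 0"
  using qk by (auto simp: quaternion_kaehler_def riemannian_metric_def)

text \<open>All these vectors are the gradient of \<open>\<lambda>\<close>.\<close>

lemma I_fund_const:
  "(I x $ i) (fund G M act (v x $ i) x) = (I x $ j) (fund G M act (v x $ j) x)" (is "?a = ?b")
proof -
  have "met x ?a u = met x ?b u" for u
    using dB_v_const[of u i j] by (simp add: dB_v)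
  then have "met x (?a - ?b) (?a - ?b) = 0"
    by (simp add: bilinear_lsub[OF met_x(1)])
  then show ?thesis
    using met_x(2)[of "?a - ?b"] by fastforce
qed

lemma Psi_near: "\<forall>\<^sub>F y in nhds q0. Psi G met Q mu (F y) = oplane (B (F y))"
  using near_x by eventually_elim (auto intro!: Psi_eq_oplane[OF basisI coeffs])

lemma Psi_x: "Psi G met Q mu x = oplane (v x)"
proof -
  have "det (mat (lam x) :: real ^ 3 ^ 3) > 0"
    using lam_pos by (simp add: det_3 mat_def)
  moreover have "B x = frame_change (mat (lam x)) (v x)"
    by (simp add: vec_eq_iff forall_3 B_x frame_change_nth mat_def)
  ultimately show ?thesis
    using Psi_eq_oplane[OF basisI[OF xU] coeffs[OF xU]] oplane_frame_change by metis
qed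

lemma gr_push_Psi:
  "((\<lambda>y. gr_coord G (oplane (v x)) (Psi G met Q mu (F y))) has_derivative
     (\<lambda>u. hom3 (v x) (\<chi> j. normal_part (v x) (dB u $ j) /\<^sub>R lam x))) (at q0)"
  by (rule gr_coord_has_derivative[OF v_x_orthonormal dB _ lam_pos Psi_near]) (simp add: vec_eq_iff B_x)

end

section \<open>The differential of the induced map\<close>

locale moment_action = quaternionic_moment G M met Q act mu lam U I B v x + lie G + lie_algebra_inv G
  for G :: "('g::{t2_space,second_countable_topology}, 'k::euclidean_space) lie_group"
    and M :: "('m::{t2_space,second_countable_topology}, 'e::euclidean_space) manifold"
    and met Q act mu lam U I B v x +
  assumes action: "quaternionic_isometric_action G M met Q act"
    and equivariant: "Psi G met Q mu (act g x) = gr_act G g (Psi G met Q mu x)"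
begin

abbreviation "V \<equiv> oplane (v x)"
abbreviation "dPsi \<equiv> gr_push G M (Psi G met Q mu) x"
abbreviation "vfield j \<equiv> fund G M act (v x $ j) x"

lemma gr_push_eqI:
  assumes "((\<lambda>y. gr_coord G (f p) (f (cinv (chart_at N p) y))) has_derivative D) (at (chart_pt N p))"
  shows "gr_push G N f p = D"
  using frechet_derivative_at[OF assms] by (simp add: gr_push_def chart_pt_def)

lemma dPsi_eq: "dPsi u = hom3 (v x) (\<chi> j. normal_part (v x) (dB u $ j) /\<^sub>R lam x)"
  using gr_push_eqI[of "Psi G met Q mu" x M, unfolded Psi_x, OF gr_push_Psi] by simp

lemma linear_dPsi: "linear dPsi"
  using has_derivative_linear[OF gr_push_Psi] gr_push_eqI[of "Psi G met Q mu" x M, unfolded Psi_x, OF gr_push_Psi]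
  by simp

lemma normal_part_scaled_perp: "normal_part (v x) a /\<^sub>R r \<in> perp G V"
  using normal_part_perp[OF v_x_orthonormal, of a] by (simp add: perp_oplane ip_simps)

lemma dPsi_tangent: "dPsi u \<in> gr_tangent G V"
  unfolding dPsi_eq by (rule hom3_gr_tangent) (simp add: normal_part_scaled_perp)

text \<open>Through the moment map equation, the component of \<open>d\<Psi>(u) v\<^sub>j\<close> along a normal vector \<open>A\<close> is an inner
  product with the vector generated by \<open>A\<close>.\<close>

lemma dPsi_ip:
  assumes "A \<in> perp G V"
  shows "ip G (dPsi u (v x $ j)) A = met x ((I x $ j) (fund G M act A x)) u / lam x"
  using dB_perp[OF assms, of u j] assms
  by (simp add: dPsi_eq hom3_nth[OF v_x_orthonormal] ip_simps ip_normal_part divide_inverse mult.commute)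

lemma act_one: "act \<one>\<^bsub>G\<^esub> x = x"
proof -
  have "group_action G UNIV act"
    using action by (simp add: quaternionic_isometric_action_def)
  then show ?thesis
    using fun_cong[OF group_action.id_eq_one, of G UNIV act x] by simp
qed

lemma diff_pt_act: "diff_pt (mfd G) M (\<lambda>g. act g x) \<one>\<^bsub>G\<^esub>"
  using smooth_map_slices(1)[OF mfd mfdM mfdM, of "\<lambda>(g, p). act g p" x] action
  by (simp add: quaternionic_isometric_action_def)

lemma gr_act_V: "gr_act G g V = oplane (\<chi> i. Ad G g (v x $ i))"
  unfolding gr_act_def by (rule image_oplane[OF linear_Ad])

lemma gr_act_one: "gr_act G \<one>\<^bsub>G\<^esub> V = V"
  by (simp add: gr_act_V Ad_one)

lemma gr_act_derivative:
  "((\<lambda>y. gr_coord G V (gr_act G (E y) V)) has_derivative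
     (\<lambda>A. hom3 (v x) (\<chi> j. normal_part (v x) (bracket G A (v x $ j))))) (at o0)"
proof -
  have "((\<lambda>y. \<chi> i. Ad G (E y) (v x $ i)) has_derivative (\<lambda>A. \<chi> i. bracket G A (v x $ i))) (at o0)"
    by (intro has_derivative_vec_lambda Ad_has_derivative)
  from gr_coord_has_derivative[OF v_x_orthonormal this, of 1 "\<lambda>y. gr_act G (E y) V"] show ?thesis
    by (simp add: gr_act_V Ad_one)
qed

text \<open>The action moves the frame \<open>v\<close> of \<open>V\<close> to \<open>Ad g v\<close>, whose derivative is the bracket.\<close>

lemma gr_fund_eq: "gr_fund G A V = hom3 (v x) (\<chi> j. normal_part (v x) (bracket G A (v x $ j)))"
proof -
  have "((\<lambda>y. gr_coord G (gr_act G \<one>\<^bsub>G\<^esub> V) (gr_act G (cinv chart y) V)) has_derivative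
     (\<lambda>A. hom3 (v x) (\<chi> j. normal_part (v x) (bracket G A (v x $ j))))) (at o0)"
    unfolding gr_act_one by (rule gr_act_derivative)
  from gr_push_eqI[OF this] show ?thesis
    by (simp add: gr_fund_def)
qed

lemma gr_fund_apply: "gr_fund G A V (v x $ j) = normal_part (v x) (bracket G A (v x $ j))"
  by (simp add: gr_fund_eq hom3_nth[OF v_x_orthonormal])

text \<open>Differentiate \<open>\<Psi> (g x) = g \<Psi>(x)\<close> at the identity.\<close>

lemma dPsi_fund: "dPsi (fund G M act A x) = gr_fund G A V"
proof -
  let ?\<Phi> = "\<lambda>y. gr_coord G V (Psi G met Q mu (F y))"
  define a where "a = chart_rep (mfd G) M (\<lambda>g. act g x) \<one>\<^bsub>G\<^esub>"
  have a: "(a has_derivative (\<lambda>A. fund G M act A x)) (at o0)"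
    using diff_pt_act unfolding fund_def push_eq a_def
    by (simp add: diff_pt_def frechet_derivative_works[symmetric])
  have a0: "a o0 = q0"
    by (simp add: a_def chart_rep_chart_pt[OF mfd] act_one)
  have \<Phi>: "(?\<Phi> has_derivative dPsi) (at q0)"
    using gr_push_Psi by (simp add: dPsi_eq[abs_def])
  have "((\<lambda>y. ?\<Phi> (a y)) has_derivative (\<lambda>A. dPsi (fund G M act A x))) (at o0)"
    by (rule has_derivative_compose[OF a, where g = ?\<Phi>]) (simp add: a0 \<Phi>)
  moreover have "\<forall>\<^sub>F y in nhds o0. ?\<Phi> (a y) = gr_coord G V (gr_act G (E y) V)"
  proof -
    have "\<forall>\<^sub>F g in nhds \<one>\<^bsub>G\<^esub>. act g x \<in> fst c"
      using diff_pt_act chart_at_nhds(4)[OF mfdM, of x]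
        eventually_isCont[of "\<one>\<^bsub>G\<^esub>" "\<lambda>g. act g x" "\<lambda>p. p \<in> fst c"]
      by (simp add: diff_pt_def act_one)
    from eventually_cinv[OF mfd this] show ?thesis
    proof eventually_elim
      case (elim y)
      then have "F (a y) = act (E y) x"
        by (simp add: a_def chart_rep_def act_one cinv_left[OF mfdM chart_at_atlas(1)[OF mfdM]])
      then show ?case
        by (simp add: equivariant Psi_x)
    qed
  qed
  ultimately have "((\<lambda>y. gr_coord G V (gr_act G (E y) V)) has_derivative
      (\<lambda>A. dPsi (fund G M act A x))) (at o0)"
    by (auto intro: has_derivative_transform_eventually simp: eventually_nhds_conv_at)
  from fun_cong[OF has_derivative_unique[OF this gr_act_derivative], of A] show ?thesis
    by (simp add: gr_fund_eq)
qed

lemma I_apply: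
  "(I x $ i) ((I x $ i) a) = - a"
  "(I x $ 1) ((I x $ 2) a) = (I x $ 3) a" "(I x $ 2) ((I x $ 3) a) = (I x $ 1) a"
  "(I x $ 3) ((I x $ 1) a) = (I x $ 2) a" "(I x $ 2) ((I x $ 1) a) = - (I x $ 3) a"
  "(I x $ 3) ((I x $ 2) a) = - (I x $ 1) a" "(I x $ 1) ((I x $ 3) a) = - (I x $ 2) a"
  using quat_triple_mult[OF quat_basis_triple[OF basisI[OF xU]],
      THEN arg_cong[where f = "\<lambda>f. blinfun_apply f a"]]
  by (simp_all add: blinfun.minus_left)

lemma met_I: "met x ((I x $ i) a) b = - met x a ((I x $ i) b)"
proof -
  have "met x ((I x $ i) a) b = met x ((I x $ i) ((I x $ i) a)) ((I x $ i) b)"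
    using basisI[OF xU] by (simp add: quat_basis_def)
  then show ?thesis
    by (simp add: I_apply(1) bilinear_lneg[OF met_x(1)])
qed

section \<open>The quaternionic subspaces\<close>

text \<open>The gradient of \<open>\<lambda>\<close> at \<open>x\<close>.\<close>

definition Y :: 'e where "Y = (I x $ 1) (vfield 1)"

lemma Y_eq: "Y = (I x $ j) (vfield j)"
  unfolding Y_def by (rule I_fund_const)

text \<open>Equivariance knows \<open>d\<Psi>\<close> on the vectors generated by \<open>v\<^sub>k\<close>, and \<open>Y = I\<^sub>k \<xi>(v\<^sub>k)\<close> for every \<open>k\<close>, where
  \<open>\<xi>\<close> denotes the generated vector at \<open>x\<close>.
  Moving \<open>I\<^sub>j I\<^sub>k = I\<^sub>l\<close> to the other side of the metric turns \<open>d\<Psi>(Y) v\<^sub>j\<close> into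
  \<open>d\<Psi>(\<xi>(v\<^sub>k)) v\<^sub>l\<close>.\<close>

lemma dPsi_Y_component:
  assumes "I x $ j o\<^sub>L I x $ k = I x $ l"
  shows "dPsi Y (v x $ j) = normal_part (v x) (bracket G (v x $ k) (v x $ l))"
proof (rule perp_eqI)
  show "dPsi Y (v x $ j) \<in> perp G V"
    by (rule gr_tangentD(2)[OF dPsi_tangent])
  show "normal_part (v x) (bracket G (v x $ k) (v x $ l)) \<in> perp G V"
    by (rule normal_part_perp[OF v_x_orthonormal])
  fix A assume A: "A \<in> perp G V"
  let ?A = "fund G M act A x"
  have "met x ((I x $ j) ?A) Y = - met x ?A ((I x $ j) ((I x $ k) (vfield k)))"
    unfolding Y_eq[of k] by (rule met_I)
  also have "(I x $ j) ((I x $ k) (vfield k)) = (I x $ l) (vfield k)"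
    by (simp flip: assms)
  also have "- met x ?A ((I x $ l) (vfield k)) = met x ((I x $ l) ?A) (vfield k)"
    by (simp add: met_I)
  finally have "ip G (dPsi Y (v x $ j)) A = ip G (dPsi (vfield k) (v x $ l)) A"
    by (simp add: dPsi_ip[OF A])
  then show "ip G (dPsi Y (v x $ j)) A = ip G (normal_part (v x) (bracket G (v x $ k) (v x $ l))) A"
    by (simp add: dPsi_fund gr_fund_apply)
qed

lemma dPsi_Y: "dPsi Y = grad_psi G V"
  unfolding grad_psi_oplane[OF v_x_orthonormal]
proof (rule gr_tangent_eqI[OF v_x_orthonormal dPsi_tangent])
  let ?n = "vector [normal_part (v x) (bracket G (v x $ 2) (v x $ 3)),
    normal_part (v x) (bracket G (v x $ 3) (v x $ 1)), normal_part (v x) (bracket G (v x $ 1) (v x $ 2))] :: 'k ^ 3"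
  show "hom3 (v x) ?n \<in> gr_tangent G V"
  proof (rule hom3_gr_tangent)
    show "?n $ i \<in> perp G V" for i
      using exhaust_3[of i] by (auto simp: normal_part_perp[OF v_x_orthonormal])
  qed
  note m = quat_triple_mult[OF quat_basis_triple[OF basisI[OF xU]]]
  show "dPsi Y (v x $ i) = hom3 (v x) ?n (v x $ i)" for i
    using exhaust_3[of i] m(2-4) dPsi_Y_component by (auto simp: hom3_nth[OF v_x_orthonormal])
qed

lemma vfield_eq: "vfield j = - (I x $ j) Y"
  by (simp add: Y_eq[of j] I_apply(1))

text \<open>Up to sign the vectors generated by \<open>v\<^sub>j\<close> are \<open>I\<^sub>j Y\<close>, so this is the quaternionic line through \<open>Y\<close>.\<close>

lemma span_quaternionic: "(I x $ k) ` span (insert Y (range vfield)) \<subseteq> span (insert Y (range vfield))"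
proof -
  let ?T = "span (insert Y (range vfield))"
  have Y: "Y \<in> ?T" and vfield: "vfield j \<in> ?T" for j
    by (auto intro: span_base)
  have IY: "(I x $ j) Y \<in> ?T" for j
    using span_neg[OF vfield[of j]] by (simp add: vfield_eq)
  have I_vfield: "(I x $ k) (vfield j) \<in> ?T" for j
    using exhaust_3[of k] exhaust_3[of j] Y IY span_neg[OF Y] span_neg[OF IY]
    by (auto simp: vfield_eq blinfun.minus_right I_apply)
  have "(I x $ k) ` span (insert Y (range vfield)) = span ((I x $ k) ` insert Y (range vfield))"
    by (rule linear_span_image[symmetric]) (simp add: bounded_linear.linear blinfun.bounded_linear_right)
  also have "\<dots> \<subseteq> ?T"
    by (rule span_minimal) (auto simp: IY I_vfield)
  finally show ?thesis .
qed

end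

theorem lemma6p2:
  fixes M :: "('m::{t2_space,second_countable_topology}, 'e::euclidean_space) manifold"
    and met :: "'m \<Rightarrow> 'e \<Rightarrow> 'e \<Rightarrow> real"
    and Q :: "'m \<Rightarrow> ('e \<Rightarrow>\<^sub>L 'e) set"
    and G :: "('g::{t2_space,second_countable_topology}, 'k::euclidean_space) lie_group"
    and act :: "'g \<Rightarrow> 'm \<Rightarrow> 'm"
    and mu :: "'m \<Rightarrow> 'k \<Rightarrow> 'e \<Rightarrow>\<^sub>L 'e"
    and lam :: "'m \<Rightarrow> real"
    and U :: "'m set"
    and I :: "'m \<Rightarrow> ('e \<Rightarrow>\<^sub>L 'e) ^ 3"
    and B v :: "'m \<Rightarrow> 'k ^ 3"
    and x :: 'm
    and V :: "('k ^ 3) set"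
    and dPsi :: "'e \<Rightarrow> 'k \<Rightarrow>\<^sub>L 'k"
    and X :: 'e
    and S :: "('k \<Rightarrow>\<^sub>L 'k) set"
    and T :: "'e set"
  assumes qk: "quaternion_kaehler M met Q"
    and conn: "connected (UNIV :: 'm set)"
    and scal: "\<And>p. scalar_curvature M met p \<noteq> 0"
    and lie: "compact_lie_group G"
    and posdef: "\<And>A. A \<noteq> 0 \<Longrightarrow> ip G A A > 0"
    and action: "quaternionic_isometric_action G M met Q act"
    and moment: "moment_map G M met Q act mu"
    and equivariant: "\<And>g p. p \<in> M0 G met Q mu \<Longrightarrow>
          act g p \<in> M0 G met Q mu \<and> Psi G met Q mu (act g p) = gr_act G g (Psi G met Q mu p)"
    and lam_pos: "\<And>p. p \<in> M0 G met Q mu \<Longrightarrow> lam p > 0"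
    and lam_diff: "\<And>p. p \<in> M0 G met Q mu \<Longrightarrow> differentiable_at_pt M lam p"
    and lam_inv: "\<And>g p. p \<in> M0 G met Q mu \<Longrightarrow> lam (act g p) = lam p"
    and frame: "quat_frame M met Q U I" "x \<in> U" "U \<subseteq> M0 G met Q mu"
    and coeffs: "\<And>p. p \<in> U \<Longrightarrow> moment_coeffs G mu p (I p) (B p)"
    and B_eq: "\<And>p i. p \<in> U \<Longrightarrow> B p $ i = lam p *\<^sub>R v p $ i"
    and onb: "\<And>p. p \<in> U \<Longrightarrow> oriented_onb G (Psi G met Q mu p) (v p)"
    and V: "Psi G met Q mu x = V"
  defines "dPsi \<equiv> gr_push G M (Psi G met Q mu) x"
  assumes inj: "inj dPsi"
  defines "X \<equiv> inv_into UNIV dPsi (grad_psi G V)"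
  defines "S \<equiv> span (insert (grad_psi G V) (range (\<lambda>i. gr_fund G (v x $ i) V)))"
    and "T \<equiv> span (insert X (range (\<lambda>i. fund G M act (v x $ i) x)))"
  shows "S \<subseteq> gr_tangent G V \<and> S \<subseteq> range dPsi \<and>
         (\<forall>k. (I x $ k) ` T \<subseteq> T) \<and>
         (\<forall>k. (\<lambda>Z. dPsi ((I x $ k) (inv_into UNIV dPsi Z))) ` S \<subseteq> S)"
proof -
  interpret L: lie G
    by unfold_locales (rule lie)
  interpret LI: lie_algebra_inv G
    by (rule L.lie_algebra_inv[OF posdef])
  have x: "x \<in> M0 G met Q mu"
    using frame by blast
  interpret moment_action G M met Q act mu lam U I B v x
    using qk moment frame coeffs B_eq onb action equivariant[OF x] lam_pos[OF x]
    by unfold_locales (auto simp: LI.oriented_onb_iff)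
  have V_eq: "V = oplane (v x)"
    using V Psi_x by simp
  have X: "X = Y"
    unfolding X_def V_eq dPsi_Y[symmetric, folded dPsi_def] by (rule inv_into_f_f[OF inj]) simp
  have lin: "linear dPsi"
    unfolding dPsi_def by (rule linear_dPsi)
  have T_eq: "T = span (insert Y (range vfield))"
    unfolding T_def X ..
  have ST: "S = dPsi ` T"
    unfolding S_def T_eq linear_span_image[OF lin, symmetric]
    by (simp add: V_eq dPsi_def dPsi_Y dPsi_fund image_image)
  have I_T: "(I x $ k) ` T \<subseteq> T" for k
    unfolding T_eq by (rule span_quaternionic)
  have "(\<lambda>Z. dPsi ((I x $ k) (inv_into UNIV dPsi Z))) ` S \<subseteq> S" for k
    using I_T[of k] by (auto simp: ST inv_into_f_f[OF inj])
  moreover have "S \<subseteq> gr_tangent G V"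
    unfolding ST V_eq dPsi_def using dPsi_tangent by auto
  ultimately show ?thesis
    using I_T by (auto simp: ST)
qed

end
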